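(* Let $\mathcal{Y}$ be a Polish space, $H$ a probability measure on $\mathcal{Y}$, and $\theta,q>0$. Let $\mu_{\theta,\theta-q}$ be a Beta-Gamma process with parameters $(\theta H,\theta-q)$ and let $\mu_\theta$ be a Gamma process with shape $\theta H$. The following equalities in distribution (of random measures) hold. (i) For every integer $n\ge 0$ with $\theta+n-q>0$, $$\mathcal{L}(\mu_{\theta,\theta-q})=\mathcal{L}\left(U_{q,\theta+n-q}\,\mu_\theta+U_{q,\theta+n-q}\sum_{j=1}^{n(\mathbf{p})}G_{j,n}\,\delta_{Y_j^*}\right),$$ where $\mathbf{Y}=(\mathbf{Y}^*,\mathbf{p})$ has distribution $\mathbb{P}(d\mathbf{Y}|\theta H)$ and, conditionally on $\mathbf{p}$, the quantities $U_{q,\theta+n-q}$, $\mu_\theta$, $G_{1,n},\dots,G_{n(\mathbf{p}),n}$ and $\mathbf{Y}^*$ are mutually independent, with $U_{q,\theta+n-q}$ Beta$(q,\theta+n-q)$ distributed, $\mu_\theta$ a Gamma process with shape $\theta H$, and $G_{j,n}$ Gamma distributed with shape $e_{j,n}$ and scale $1$. In particular, if $H$ is nonatomic, then given $\mathbf{p}$ the $Y_j^*$, $j=1,\dots,n(\mathbf{p})$, are i.i.d. $H$, and $\mathbf{p}$ has distribution $\pi(\mathbf{p}|\theta)$. (ii) For all $\theta>0$ (taking $q=1$), $$\mathcal{L}(\mu_{\theta,\theta-1})=\mathcal{L}(U_{1,\theta}\,\mu_\theta+U_{1,\theta}\,T_1\,\delta_{Y_1}),$$ and for the Gamma process $\mu_\theta$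 with arbitrary shape $\theta H$, $$\mathcal{L}(\mu_\theta)=\mathcal{L}(U_{\theta,1}\,\mu_\theta+U_{\theta,1}\,T_1\,\delta_{Y_1}),$$ where on the right-hand sides $U_{a,b}$ (a Beta$(a,b)$ variable), $\mu_\theta$ (a Gamma process with shape $\theta H$), $T_1$ (a Gamma variable with shape $1$ and scale $1$) and $Y_1$ (with law $H$) are independent. (iii) For all $\theta,q>0$, $$\mathcal{L}(\mu_{\theta,\theta-q})=\mathcal{L}(T_q\,P_\theta),$$ where $T_q$ is a Gamma random variable with shape $q$ and scale $1$, independent of the Dirichlet process $P_\theta$ with shape $\theta H$. Hence for all $\theta,q>0$, $\mathcal{L}(T_\theta\,\mu_{\theta,\theta-q})=\mathcal{L}(T_q\,\mu_\theta)$, where $T_\theta$ is Gamma with shape $\theta$ and scale $1$ independent of $\mu_{\theta,\theta-q}$, and $T_q$ and $\mu_\theta$ are independent.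
   Context: $\mathcal{M}$ is the space of boundedly finite measures on $\mathcal{Y}$, and $T=\mu(\mathcal{Y})$ for $\mu\in\mathcal{M}$. For a finite measure $\alpha$ on $\mathcal{Y}$, the Gamma process with shape $\alpha$ is the random measure $\mu$ with law $\mathcal{G}(d\mu|\alpha)$ determined by $\int_{\mathcal{M}} e^{-\mu(f)}\mathcal{G}(d\mu|\alpha)=\exp(-\int\log[1+f]\,d\alpha)$ for bounded measurable $f\ge0$. The Dirichlet process with shape $\alpha$ is $P=\mu/T$ with $\mu\sim\mathcal{G}(d\mu|\alpha)$. A Beta-Gamma process with parameters $(\theta H,d)$, where $d$ is real with $\theta-d>0$, is a random measure with law $$\mathcal{BG}(d\mu|\theta H,d)=\frac{\Gamma(\theta)}{\Gamma(\theta-d)}T^{-d}\,\mathcal{G}(d\mu|\theta H).$$ $\mathbb{P}(d\mathbf{Y}|\theta H)$ is the Blackwell–MacQueen distribution on $\mathcal{Y}^n$: $$\mathbb{P}(d\mathbf{Y}|\theta H)=\frac{\Gamma(\theta)}{\Gamma(\theta+n)}\theta H(dY_1)\prod_{i=2}^n\Big(\theta H+\sum_{j=1}^{i-1}\delta_{Y_j}\Big)(dY_i).$$ The vector $\mathbf{Y}=(Y_1,\dots,Y_n)$ is written $(\mathbf{Y}^*,\mathbf{p})$, where $\mathbf{Y}^*=(Y_1^*,\dots,Y_{n(\mathbf{p})}^* )$ are the distinct values in $\mathbf{Y}$, $\mathbf{p}=\{C_1,\dots,C_{n(\mathbf{p})}\}$ is the partition of $\{1,\dots,n\}$ with $C_j=\{i:Y_i=Y_j^*\}$,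 and $e_{j,n}=|C_j|$ (for $n=0$ the sum over $j$ is empty). For a partition $\mathbf{p}$ of $\{1,\dots,n\}$, $\pi(\mathbf{p}|\theta)=\frac{\theta^{n(\mathbf{p})}\Gamma(\theta)}{\Gamma(\theta+n)}\prod_{j=1}^{n(\mathbf{p})}(e_{j,n}-1)!$. $\mathcal{L}(Z)$ denotes the law of $Z$. *)

theory Defs
  imports "HOL-Probability.Probability"
begin

section \<open>Random boundedly finite measures\<close>

definition boundedly_finite :: "'a::polish_space measure set" where
  "boundedly_finite =
    {m. sets m = sets borel \<and> (\<forall>A\<in>sets borel. bounded A \<longrightarrow> emeasure m A < \<infinity>)}"

text \<open>The \<sigma>-algebra on the boundedly finite measures generated by the evaluations
  \<open>m \<mapsto> m(A)\<close>, built in the same way as \<^const>\<open>subprob_algebra\<close>.\<close>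

definition bf_algebra :: "'a::polish_space measure measure" where
  "bf_algebra =
    (SUP A\<in>sets borel. vimage_algebra boundedly_finite (\<lambda>m. emeasure m A) borel)"

text \<open>The measure \<open>m + (\<Sum>j\<in>I. c j \<delta>\<^bsub>y j\<^esub>)\<close>.\<close>

definition add_atoms ::
    "'a measure \<Rightarrow> nat set \<Rightarrow> (nat \<Rightarrow> real) \<Rightarrow> (nat \<Rightarrow> 'a) \<Rightarrow> 'a measure" where
  "add_atoms m I c y = measure_of (space m) (sets m)
    (\<lambda>A. emeasure m A + (\<Sum>j\<in>I. ennreal (c j) * indicator A (y j)))"

text \<open>\<open>T = \<mu>(\<Y>)\<close> as a real number. It is \<open>0\<close> by convention when \<open>\<mu>\<close> is infinite, which
  has probability zero for the processes below.\<close>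

definition total_mass :: "'a measure \<Rightarrow> real" where
  "total_mass m = measure m (space m)"

definition normalized :: "'a measure \<Rightarrow> 'a measure" where
  "normalized m = scale_measure (ennreal (1 / total_mass m)) m"

text \<open>\<open>exp (- t)\<close> for \<open>t \<in> [0, \<infinity>]\<close>, with \<open>exp (- \<infinity>) = 0\<close>.\<close>

definition exp_neg :: "ennreal \<Rightarrow> real" where
  "exp_neg t = (if t = \<infinity> then 0 else exp (- enn2real t))"


section \<open>Gamma, Beta-Gamma and Dirichlet processes\<close>

definition gamma_process_law ::
    "'a::polish_space measure \<Rightarrow> 'a measure measure \<Rightarrow> bool" where
  "gamma_process_law \<alpha> G \<longleftrightarrow>
    prob_space G \<and> sets G = sets bf_algebra \<and>
    (\<forall>f\<in>borel_measurable borel. (\<forall>x. 0 \<le> f x) \<and> bounded (range f) \<longrightarrow>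
      (\<integral>m. exp_neg (\<integral>\<^sup>+x. ennreal (f x) \<partial>m) \<partial>G) = exp (- (\<integral>x. ln (1 + f x) \<partial>\<alpha>)))"

definition beta_gamma_law ::
    "real \<Rightarrow> 'a::polish_space measure \<Rightarrow> real \<Rightarrow> 'a measure measure \<Rightarrow> bool" where
  "beta_gamma_law \<theta> H d B \<longleftrightarrow>
    (\<exists>G. gamma_process_law (scale_measure (ennreal \<theta>) H) G \<and>
      B = density G (\<lambda>m. ennreal (Gamma \<theta> / Gamma (\<theta> - d) * total_mass m powr (- d))))"

definition dirichlet_law ::
    "'a::polish_space measure \<Rightarrow> 'a measure measure \<Rightarrow> bool" where
  "dirichlet_law \<alpha> D \<longleftrightarrow>
    (\<exists>G. gamma_process_law \<alpha> G \<and> D = distr G bf_algebra normalized)"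

definition gamma_process ::
    "'w measure \<Rightarrow> ('w \<Rightarrow> 'a::polish_space measure) \<Rightarrow> 'a measure \<Rightarrow> bool" where
  "gamma_process M \<mu> \<alpha> \<longleftrightarrow>
    \<mu> \<in> measurable M bf_algebra \<and> gamma_process_law \<alpha> (distr M bf_algebra \<mu>)"

definition beta_gamma_process ::
    "'w measure \<Rightarrow> ('w \<Rightarrow> 'a::polish_space measure) \<Rightarrow> real \<Rightarrow> 'a measure \<Rightarrow> real \<Rightarrow> bool" where
  "beta_gamma_process M \<mu> \<theta> H d \<longleftrightarrow>
    \<mu> \<in> measurable M bf_algebra \<and> beta_gamma_law \<theta> H d (distr M bf_algebra \<mu>)"

definition dirichlet_process ::
    "'w measure \<Rightarrow> ('w \<Rightarrow> 'a::polish_space measure) \<Rightarrow> 'a measure \<Rightarrow> bool" where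
  "dirichlet_process M P \<alpha> \<longleftrightarrow>
    P \<in> measurable M bf_algebra \<and> dirichlet_law \<alpha> (distr M bf_algebra P)"


section \<open>Beta and Gamma variables, independence\<close>

definition gamma_density :: "real \<Rightarrow> real \<Rightarrow> real" where
  "gamma_density a x = (if 0 < x then x powr (a - 1) * exp (- x) / Gamma a else 0)"

definition beta_density :: "real \<Rightarrow> real \<Rightarrow> real \<Rightarrow> real" where
  "beta_density a b x =
    (if 0 < x \<and> x < 1 then x powr (a - 1) * (1 - x) powr (b - 1) / Beta a b else 0)"

definition gamma_variable :: "'w measure \<Rightarrow> ('w \<Rightarrow> real) \<Rightarrow> real \<Rightarrow> bool" where
  "gamma_variable M X a \<longleftrightarrow> distributed M lborel X (\<lambda>x. ennreal (gamma_density a x))"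

definition beta_variable :: "'w measure \<Rightarrow> ('w \<Rightarrow> real) \<Rightarrow> real \<Rightarrow> real \<Rightarrow> bool" where
  "beta_variable M X a b \<longleftrightarrow> distributed M lborel X (\<lambda>x. ennreal (beta_density a b x))"

text \<open>\<open>indep_vars\<close> requires all variables to have the same type of values. Here real, point and
  measure valued variables occur together, so independence is stated for the list of the
  \<sigma>-algebras they generate.\<close>

definition generated :: "'w measure \<Rightarrow> 'b measure \<Rightarrow> ('w \<Rightarrow> 'b) \<Rightarrow> 'w set set" where
  "generated M N X = {X -` A \<inter> space M | A. A \<in> sets N}"

definition mutually_indep :: "'w measure \<Rightarrow> 'w set set list \<Rightarrow> bool" where
  "mutually_indep M Fs \<longleftrightarrow> prob_space.indep_sets M (\<lambda>k. Fs ! k) {..<length Fs}"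


section \<open>The Blackwell--MacQueen distribution and its partition\<close>

text \<open>The integral of \<open>g(Y\<^sub>1, \<dots>, Y\<^sub>n)\<close> with respect to the unnormalized measure
  \<open>\<alpha>(dY\<^sub>1) \<Prod>\<^bsub>i=2..n\<^esub> (\<alpha> + \<Sum>\<^bsub>j<i\<^esub> \<delta>\<^bsub>Y j\<^esub>)(dY\<^sub>i)\<close>; the innermost integration is over the last coordinate.\<close>

primrec urn_integral ::
    "'a measure \<Rightarrow> nat \<Rightarrow> ((nat \<Rightarrow> 'a) \<Rightarrow> ennreal) \<Rightarrow> ennreal" where
  "urn_integral \<alpha> 0 g = g (\<lambda>_. undefined)"
| "urn_integral \<alpha> (Suc n) g =
    urn_integral \<alpha> n (\<lambda>y. \<integral>\<^sup>+x. g (y(Suc n := x)) \<partial>add_atoms \<alpha> {1..n} (\<lambda>_. 1) y)"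

definition blackwell_macqueen ::
    "real \<Rightarrow> 'a::polish_space measure \<Rightarrow> nat \<Rightarrow> (nat \<Rightarrow> 'a) measure" where
  "blackwell_macqueen \<theta> H n =
    measure_of (space (Pi\<^sub>M {1..n} (\<lambda>_. borel))) (sets (Pi\<^sub>M {1..n} (\<lambda>_. borel)))
      (\<lambda>A. ennreal (Gamma \<theta> / Gamma (\<theta> + real n)) *
        urn_integral (scale_measure (ennreal \<theta>) H) n (indicator A))"

definition ties :: "nat \<Rightarrow> (nat \<Rightarrow> 'a) \<Rightarrow> nat set set" where
  "ties n y = (\<lambda>k. {i\<in>{1..n}. y i = y k}) ` {1..n}"

text \<open>\<open>C\<^sub>1, C\<^sub>2, \<dots>\<close> are the blocks of \<open>p\<close> in the order of their least elements, so that
  the distinct values \<open>Y\<^sup>*\<^sub>1, Y\<^sup>*\<^sub>2, \<dots>\<close> are listed in order of appearance.\<close>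

definition block :: "nat set set \<Rightarrow> nat \<Rightarrow> nat set" where
  "block p j = (THE C. C \<in> p \<and> Min C = sorted_list_of_set (Min ` p) ! (j - 1))"

definition distinct_value :: "nat set set \<Rightarrow> (nat \<Rightarrow> 'a) \<Rightarrow> nat \<Rightarrow> 'a" where
  "distinct_value p y j = y (Min (block p j))"

definition partition_prob :: "real \<Rightarrow> nat \<Rightarrow> nat set set \<Rightarrow> real" where
  "partition_prob \<theta> n p =
    \<theta> ^ card p * Gamma \<theta> / Gamma (\<theta> + real n) * (\<Prod>C\<in>p. fact (card C - 1))"

definition ties_event :: "'w measure \<Rightarrow> nat \<Rightarrow> ('w \<Rightarrow> nat \<Rightarrow> 'a) \<Rightarrow> nat set set \<Rightarrow> 'w set" where
  "ties_event M n Y p = {\<omega>\<in>space M. ties n (Y \<omega>) = p}"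

text \<open>The partition takes finitely many values, so conditioning on it means passing to the
  elementary conditional probability given \<open>ties n Y = p\<close> for each value \<open>p\<close> of positive
  probability.\<close>

abbreviation given_ties ::
    "'w measure \<Rightarrow> nat \<Rightarrow> ('w \<Rightarrow> nat \<Rightarrow> 'a) \<Rightarrow> nat set set \<Rightarrow> 'w measure" where
  "given_ties M n Y p \<equiv> uniform_measure M (ties_event M n Y p)"

text \<open>The joint conditional distribution, given the partition, of \<open>U\<close>, \<open>\<mu>\<close>,
  \<open>G\<^sub>1, \<dots>, G\<^bsub>n(p)\<^esub>\<close> and the vector of distinct values, with \<open>U\<close> a Beta\<open>(a, b)\<close> variable.\<close>

definition conditional_model ::
    "'w measure \<Rightarrow> nat \<Rightarrow> ('w \<Rightarrow> nat \<Rightarrow> 'a::polish_space) \<Rightarrow> ('w \<Rightarrow> real) \<Rightarrow> ('w \<Rightarrow> 'a measure)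
      \<Rightarrow> (nat \<Rightarrow> 'w \<Rightarrow> real) \<Rightarrow> real \<Rightarrow> real \<Rightarrow> 'a measure \<Rightarrow> bool" where
  "conditional_model M n Y U \<mu> G a b \<alpha> \<longleftrightarrow>
    U \<in> borel_measurable M \<and> \<mu> \<in> measurable M bf_algebra \<and>
    (\<forall>j\<in>{1..n}. G j \<in> borel_measurable M) \<and>
    (\<forall>p. partition_on {1..n} p \<and> measure M (ties_event M n Y p) > 0 \<longrightarrow>
      beta_variable (given_ties M n Y p) U a b \<and>
      gamma_process (given_ties M n Y p) \<mu> \<alpha> \<and>
      (\<forall>j\<in>{1..card p}. gamma_variable (given_ties M n Y p) (G j) (real (card (block p j)))) \<and>
      mutually_indep (given_ties M n Y p)
        ([generated M borel U, generated M bf_algebra \<mu>,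
          generated M (Pi\<^sub>M {1..card p} (\<lambda>_. borel))
            (\<lambda>\<omega>. \<lambda>j\<in>{1..card p}. distinct_value p (Y \<omega>) j)]
         @ map (\<lambda>j. generated M borel (G j)) [1..<Suc (card p)]))"

end

theory Submission
  imports Defs
begin

text \<open>
  Laws of random measures are compared through their Laplace functionals, which determine them by
  a multiplicative-class argument whose one-dimensional core is Hausdorff's moment problem on
  \<open>[0, 1]\<close>. Tilting a Gamma process by \<open>exp (- s T)\<close> rescales it by the constant \<open>1 / (1 + s)\<close>; hence
  \<open>T\<close> is independent of \<open>P = \<mu> / T\<close>, and the Laplace functional of \<open>\<mu>\<^bsub>\<theta>, \<theta> - q\<^esub>\<close> at \<open>f\<close> is
  \<open>\<Phi> q f = E ((1 + P f) powr (- q))\<close>, which is also the one of \<open>T\<^sub>q P\<close>. For the mixtures with atoms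
  it remains to use \<open>\<Phi> (\<theta> + n) f = exp (- \<theta> \<integral> ln (1 + f) dH) E (\<Prod>i\<le>n. 1 / (1 + f Y\<^sub>i))\<close>, obtained by
  differentiating at \<open>s + f\<close> in \<open>s = 0\<close> by induction on \<open>n\<close>, and that mixing
  \<open>(1 + u x) powr (- (\<theta> + n))\<close> over a Beta\<open>(q, \<theta> + n - q)\<close> variable \<open>u\<close> gives \<open>(1 + x) powr (- q)\<close>.
\<close>

text \<open>The factor \<open>1 / (1 + f Y_i)\<close> is the Laplace transform of a standard
  exponential mass sitting at \<open>Y_i\<close>. Exponential masses on equal values add up to a
  Gamma mass whose shape is the size of the block, so the product over all \<open>i\<close> is the
  Laplace functional of the atoms in a form that does not mention the partition. This is what allows
  the conditional statements given \<open>p\<close> to be averaged over \<open>p\<close>. The order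
  \<open>\<theta> + n\<close> arises because the Gamma process itself has order
  \<open>\<theta>\<close> and each differentiation raises the exponent by one. The Beta parameters
  \<open>q\<close> and \<open>\<theta> + n - q\<close> are the ones that add up to this order. The
  moment problem enters twice. For test functions it applies since \<open>exp (- \<mu> f)\<close>
  lies in the unit interval. For \<open>T\<close> it applies since the moments of
  \<open>exp (- T)\<close> are the values of its Laplace transform at 0, 1, 2 and so on, which the
  tilting identity computes on every event that is invariant under scaling.\<close>

section \<open>Moments on the unit interval and multiplicative classes\<close>

text \<open>Equal moments give equal integrals of \<open>x ^ k * (1 - x) ^ m\<close>, hence of
  Bernstein polynomials, hence of continuous functions by uniform approximation, and finally of
  indicators of half lines. Finite measures are allowed because the lemma is applied below to
  measures with a weight; the moment of order 0 compares their total masses.\<close>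

lemma distr_eq_if_moments_eq:
  fixes X :: "'b \<Rightarrow> real" and Y :: "'c \<Rightarrow> real"
  assumes "finite_measure M" "finite_measure N"
    and X [measurable]: "X \<in> borel_measurable M" and Y [measurable]: "Y \<in> borel_measurable N"
    and X01: "\<And>\<omega>. \<omega> \<in> space M \<Longrightarrow> X \<omega> \<in> {0..1}" and Y01: "\<And>\<omega>. \<omega> \<in> space N \<Longrightarrow> Y \<omega> \<in> {0..1}"
    and moments: "\<And>n. (\<integral>\<omega>. X \<omega> ^ n \<partial>M) = (\<integral>\<omega>. Y \<omega> ^ n \<partial>N)"
  shows "distr M borel X = distr N borel Y"
proof -
  interpret M: finite_measure M by fact
  interpret N: finite_measure N by fact
  \<comment> \<open>The induction step uses
    \<open>(1 - x) ^ Suc m = (1 - x) ^ m - x * (1 - x) ^ m\<close>. It raises the power of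
    \<open>x\<close>, so \<open>k\<close> has to vary.\<close>
  have poly_eq: "(\<integral>\<omega>. X \<omega> ^ k * (1 - X \<omega>) ^ m \<partial>M) = (\<integral>\<omega>. Y \<omega> ^ k * (1 - Y \<omega>) ^ m \<partial>N)" for k m
  proof (induction m arbitrary: k)
    case 0
    then show ?case using moments by simp
  next
    case (Suc m)
    have iM: "integrable M (\<lambda>\<omega>. X \<omega> ^ k * (1 - X \<omega>) ^ m)" for k
      by (rule M.integrable_const_bound[where B = 1])
         (use X01 in \<open>auto intro!: AE_I2 simp: abs_mult power_le_one mult_le_one\<close>)
    have iN: "integrable N (\<lambda>\<omega>. Y \<omega> ^ k * (1 - Y \<omega>) ^ m)" for k
      by (rule N.integrable_const_bound[where B = 1])
         (use Y01 in \<open>auto intro!: AE_I2 simp: abs_mult power_le_one mult_le_one\<close>)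
    have "(\<integral>\<omega>. X \<omega> ^ k * (1 - X \<omega>) ^ Suc m \<partial>M) =
        (\<integral>\<omega>. X \<omega> ^ k * (1 - X \<omega>) ^ m - X \<omega> ^ Suc k * (1 - X \<omega>) ^ m \<partial>M)"
      by (simp add: algebra_simps)
    also have "\<dots> = (\<integral>\<omega>. Y \<omega> ^ k * (1 - Y \<omega>) ^ m - Y \<omega> ^ Suc k * (1 - Y \<omega>) ^ m \<partial>N)"
      using Suc iM[of k] iM[of "Suc k"] iN[of k] iN[of "Suc k"]
      by (simp only: Bochner_Integration.integral_diff)
    also have "\<dots> = (\<integral>\<omega>. Y \<omega> ^ k * (1 - Y \<omega>) ^ Suc m \<partial>N)"
      by (simp add: algebra_simps)
    finally show ?case .
  qed
  have cont_eq: "(\<integral>\<omega>. g (X \<omega>) \<partial>M) = (\<integral>\<omega>. g (Y \<omega>) \<partial>N)"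
    if g: "continuous_on UNIV g" for g :: "real \<Rightarrow> real"
  proof -
    define b where "b n x = (\<Sum>k\<le>n. g (real k / real n) * Bernstein n k x)" for n x
    have "continuous_on {0..1} g" using g continuous_on_subset by blast
    then have unif: "\<exists>N. \<forall>n\<ge>N. \<forall>x\<in>{0..1}. \<bar>g x - b n x\<bar> < e" if "e > 0" for e
      using Bernstein_Weierstrass[of g e] that unfolding b_def by blast
    have lim: "(\<lambda>n. b n x) \<longlonglongrightarrow> g x" if "x \<in> {0..1}" for x
      unfolding LIMSEQ_iff
    proof safe
      fix e :: real assume "e > 0"
      from unif[OF this] that show "\<exists>N. \<forall>n\<ge>N. norm (b n x - g x) < e"
        by (fastforce simp: abs_minus_commute)
    qed
    have "bounded (g ` {0..1})"
      using compact_imp_bounded[OF compact_continuous_image[OF \<open>continuous_on {0..1} g\<close>]] by simp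
    then obtain B where "\<forall>x\<in>{0..1}. \<bar>g x\<bar> \<le> B"
      by (auto simp: bounded_iff)
    then have B: "\<bar>g x\<bar> \<le> B" if "x \<in> {0..1}" for x
      using that by blast
    \<comment> \<open>Dominated convergence asks for one bound for all polynomials. From index
      \<open>n0\<close> on they stay within 1 of \<open>g\<close> on the unit interval, so the
      sequence is shifted by \<open>n0\<close>.\<close>
    obtain n0 where "\<forall>n\<ge>n0. \<forall>x\<in>{0..1}. \<bar>g x - b n x\<bar> < 1"
      using unif[of 1] by auto
    then have n0: "\<bar>g x - b n x\<bar> < 1" if "n \<ge> n0" "x \<in> {0..1}" for x n
      using that by blast
    have bb: "\<bar>b (n + n0) x\<bar> \<le> B + 1" if "x \<in> {0..1}" for x n
      using n0[of "n + n0" x] B[of x] that by (auto simp: abs_le_iff abs_less_iff)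
    have [measurable]: "g \<in> borel_measurable borel"
      by (rule borel_measurable_continuous_onI[OF g])
    have [measurable]: "b n \<in> borel_measurable borel" for n
      unfolding b_def Bernstein_def by measurable
    have eq: "(\<integral>\<omega>. b n (X \<omega>) \<partial>M) = (\<integral>\<omega>. b n (Y \<omega>) \<partial>N)" for n
    proof -
      have iM: "integrable M (\<lambda>\<omega>. X \<omega> ^ k * (1 - X \<omega>) ^ m)" for k m
        by (rule M.integrable_const_bound[where B = 1])
           (use X01 in \<open>auto intro!: AE_I2 simp: abs_mult power_le_one mult_le_one\<close>)
      have iN: "integrable N (\<lambda>\<omega>. Y \<omega> ^ k * (1 - Y \<omega>) ^ m)" for k m
        by (rule N.integrable_const_bound[where B = 1])
           (use Y01 in \<open>auto intro!: AE_I2 simp: abs_mult power_le_one mult_le_one\<close>)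
      show ?thesis
        unfolding b_def Bernstein_def
        using iM iN poly_eq by (simp add: mult.assoc)
    qed
    have "(\<lambda>n. \<integral>\<omega>. b (n + n0) (X \<omega>) \<partial>M) \<longlonglongrightarrow> (\<integral>\<omega>. g (X \<omega>) \<partial>M)"
      by (rule integral_dominated_convergence[where w = "\<lambda>_. B + 1"])
         (use X01 bb lim in \<open>auto intro!: AE_I2 LIMSEQ_ignore_initial_segment\<close>)
    moreover have "(\<lambda>n. \<integral>\<omega>. b (n + n0) (Y \<omega>) \<partial>N) \<longlonglongrightarrow> (\<integral>\<omega>. g (Y \<omega>) \<partial>N)"
      by (rule integral_dominated_convergence[where w = "\<lambda>_. B + 1"])
         (use Y01 bb lim in \<open>auto intro!: AE_I2 LIMSEQ_ignore_initial_segment\<close>)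
    ultimately show ?thesis
      unfolding eq by (rule LIMSEQ_unique)
  qed
  have meas_eq: "measure (distr M borel X) {a<..} = measure (distr N borel Y) {a<..}" for a
  proof -
    \<comment> \<open>Ramps of slope \<open>n\<close> that start at \<open>a\<close> and are capped
      at 1. They vanish at \<open>a\<close> itself, so the limit is the indicator of the open half
      line.\<close>
    define g where "g n x = min 1 (max 0 (real n * (x - a)))" for n x
    have g_cont: "continuous_on UNIV (g n)" for n
      unfolding g_def by (intro continuous_intros)
    then have [measurable]: "g n \<in> borel_measurable borel" for n
      by (rule borel_measurable_continuous_onI)
    have g_bd: "\<bar>g n x\<bar> \<le> 1" for n x
      by (simp add: g_def)
    have g_lim: "(\<lambda>n. g n x) \<longlonglongrightarrow> indicator {a<..} x" for x
    proof (cases "x > a")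
      case True
      then obtain n0 where n0: "1 < real n0 * (x - a)"
        using reals_Archimedean3[of "x - a"] by auto
      have "g n x = 1" if "n \<ge> n0" for n
      proof -
        have "real n0 * (x - a) \<le> real n * (x - a)"
          using that True by (intro mult_right_mono) auto
        then show ?thesis using n0 by (simp add: g_def)
      qed
      then have "eventually (\<lambda>n. g n x = 1) sequentially"
        by (auto simp: eventually_sequentially)
      then show ?thesis using True by (simp add: tendsto_eventually)
    next
      case False
      then have "real n * (x - a) \<le> 0" for n
        by (simp add: mult_nonneg_nonpos)
      then have "g n x = 0" for n
        by (simp add: g_def max_absorb1)
      then show ?thesis using False by simp
    qed
    have "(\<lambda>n. \<integral>\<omega>. g n (X \<omega>) \<partial>M) \<longlonglongrightarrow> (\<integral>\<omega>. indicator {a<..} (X \<omega>) \<partial>M)"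
      by (rule integral_dominated_convergence[where w = "\<lambda>_. 1"])
         (auto intro!: AE_I2 g_lim g_bd)
    moreover have "(\<lambda>n. \<integral>\<omega>. g n (Y \<omega>) \<partial>N) \<longlonglongrightarrow> (\<integral>\<omega>. indicator {a<..} (Y \<omega>) \<partial>N)"
      by (rule integral_dominated_convergence[where w = "\<lambda>_. 1"])
         (auto intro!: AE_I2 g_lim g_bd)
    ultimately have "(\<integral>\<omega>. indicator {a<..} (X \<omega>) \<partial>M) = (\<integral>\<omega>. indicator {a<..} (Y \<omega>) \<partial>N :: real)"
      unfolding cont_eq[OF g_cont] by (rule LIMSEQ_unique)
    moreover have "(\<integral>\<omega>. indicator {a<..} (X \<omega>) \<partial>M) = measure (distr M borel X) {a<..}"
      by (subst integral_distr[symmetric, where N = borel]) auto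
    moreover have "(\<integral>\<omega>. indicator {a<..} (Y \<omega>) \<partial>N) = measure (distr N borel Y) {a<..}"
      by (subst integral_distr[symmetric, where N = borel]) auto
    ultimately show ?thesis by simp
  qed
  interpret DM: finite_measure "distr M borel X" by (rule M.finite_measure_distr) simp
  interpret DN: finite_measure "distr N borel Y" by (rule N.finite_measure_distr) simp
  show ?thesis
    by (rule measure_eqI_lessThan)
       (auto simp: DM.emeasure_eq_measure DN.emeasure_eq_measure meas_eq)
qed

text \<open>Finite intersections of superlevel sets of functions in \<open>F\<close> form an
  intersection-stable generator, so the measures are compared there. The constraints are added one
  at a time: with the earlier ones absorbed into a weight, the moment problem identifies the law of
  a single \<open>X\<close>, and the moments that it asks for are again integrals of members of
  \<open>F\<close>, by closure under products.\<close>

lemma measure_eqI_multiplicative_class: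
  fixes F :: "('b \<Rightarrow> real) set"
  assumes fin: "finite_measure M" "finite_measure N"
    and sp: "space N = space M"
    and gen: "sets M = sigma_sets (space M) {{\<omega>\<in>space M. a < X \<omega>} | X a. X \<in> F}" "sets N = sets M"
    and one: "(\<lambda>_. 1) \<in> F"
    and mult: "\<And>X Y. X \<in> F \<Longrightarrow> Y \<in> F \<Longrightarrow> (\<lambda>\<omega>. X \<omega> * Y \<omega>) \<in> F"
    and F01: "\<And>X \<omega>. X \<in> F \<Longrightarrow> \<omega> \<in> space M \<Longrightarrow> X \<omega> \<in> {0..1}"
    and eq: "\<And>X. X \<in> F \<Longrightarrow> (\<integral>\<omega>. X \<omega> \<partial>M) = (\<integral>\<omega>. X \<omega> \<partial>N)"
  shows "M = N"
proof -
  interpret M: finite_measure M by fact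
  interpret N: finite_measure N by fact
  \<comment> \<open>Lists turn the number of constraints into an induction, appending lists
    intersects the sets, and the empty list gives the whole space.\<close>
  define S where "S L = {\<omega>\<in>space M. \<forall>(X, a)\<in>set L. a < X \<omega>}" for L :: "(('b \<Rightarrow> real) \<times> real) list"
  have lev: "{\<omega>\<in>space M. a < X \<omega>} \<in> sets M" if "X \<in> F" for X a
    unfolding gen using that by (auto intro!: sigma_sets.Basic)
  have mM [measurable]: "X \<in> borel_measurable M" if "X \<in> F" for X
    using lev[OF that] by (simp add: borel_measurable_iff_greater)
  have mN [measurable]: "X \<in> borel_measurable N" if "X \<in> F" for X
    using mM[OF that] measurable_cong_sets[OF gen(2) refl] by blast
  have S_sets: "S L \<in> sets M" if "set L \<subseteq> F \<times> UNIV" for L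
    using that
  proof (induction L)
    case (Cons Xa L)
    have "S (Xa # L) = {\<omega>\<in>space M. snd Xa < fst Xa \<omega>} \<inter> S L"
      by (auto simp: S_def)
    with Cons lev[of "fst Xa" "snd Xa"] show ?case by auto
  qed (simp add: S_def)
  have pow: "(\<lambda>\<omega>. h \<omega> * X \<omega> ^ n) \<in> F" if "h \<in> F" "X \<in> F" for h X n
  proof (induction n)
    case (Suc n)
    from mult[OF Suc \<open>X \<in> F\<close>] show ?case by (simp add: mult_ac)
  qed (use that in simp)
  \<comment> \<open>The factor \<open>h\<close> carries the induction: the moments of
    \<open>X\<close> under the weight \<open>h * indicator (S L)\<close> are the integrals of
    \<open>h * X ^ n\<close> over \<open>S L\<close>, which are covered by the hypothesis for
    \<open>L\<close> with \<open>h * X ^ n\<close> in place of \<open>h\<close>.\<close>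
  have key: "(\<integral>\<omega>. h \<omega> * indicator (S L) \<omega> \<partial>M) = (\<integral>\<omega>. h \<omega> * indicator (S L) \<omega> \<partial>N)"
    if "set L \<subseteq> F \<times> UNIV" "h \<in> F" for L h
    using that
  proof (induction L arbitrary: h)
    case Nil
    have "(\<integral>\<omega>. h \<omega> * indicator (S []) \<omega> \<partial>M) = (\<integral>\<omega>. h \<omega> \<partial>M)"
      by (intro Bochner_Integration.integral_cong) (auto simp: S_def)
    moreover have "(\<integral>\<omega>. h \<omega> * indicator (S []) \<omega> \<partial>N) = (\<integral>\<omega>. h \<omega> \<partial>N)"
      by (intro Bochner_Integration.integral_cong) (auto simp: S_def sp)
    ultimately show ?case using eq[OF Nil(2)] by simp
  next
    case (Cons Xa L)
    obtain X a where Xa: "Xa = (X, a)" by force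
    have XF: "X \<in> F" and LF: "set L \<subseteq> F \<times> UNIV" using Cons.prems Xa by auto
    note [measurable] = mM[OF XF] mN[OF XF] mM[OF Cons.prems(2)] mN[OF Cons.prems(2)] 
    have SM [measurable]: "S L \<in> sets M" using S_sets[OF LF] .
    then have SN [measurable]: "S L \<in> sets N" using gen by simp
    define w where "w \<omega> = h \<omega> * indicator (S L) \<omega>" for \<omega>
    have [measurable]: "w \<in> borel_measurable M" "w \<in> borel_measurable N"
      unfolding w_def by measurable
    have w01: "0 \<le> w \<omega>" "w \<omega> \<le> 1" if "\<omega> \<in> space M" for \<omega>
      using F01[OF Cons.prems(2) that] by (auto simp: w_def indicator_def)
    define M' where "M' = density M w"
    define N' where "N' = density N w"
    have "distr M' borel X = distr N' borel X"
    proof (rule distr_eq_if_moments_eq)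
      have "(\<integral>\<^sup>+\<omega>. ennreal (w \<omega>) \<partial>M) \<le> (\<integral>\<^sup>+\<omega>. 1 \<partial>M)"
        using w01 by (intro nn_integral_mono) (auto intro!: ennreal_leI)
      then show "finite_measure M'"
        by (intro finite_measureI)
           (auto simp: M'_def emeasure_density M.emeasure_eq_measure top_unique cong: nn_integral_cong)
      have "(\<integral>\<^sup>+\<omega>. ennreal (w \<omega>) \<partial>N) \<le> (\<integral>\<^sup>+\<omega>. 1 \<partial>N)"
        using w01 sp by (intro nn_integral_mono) (auto intro!: ennreal_leI)
      then show "finite_measure N'"
        by (intro finite_measureI)
           (auto simp: N'_def emeasure_density N.emeasure_eq_measure top_unique cong: nn_integral_cong)
      show "X \<in> borel_measurable M'" "X \<in> borel_measurable N'"
        by (simp_all add: M'_def N'_def)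
      show "X \<omega> \<in> {0..1}" if "\<omega> \<in> space M'" for \<omega>
        using F01[OF XF, of \<omega>] that by (simp add: M'_def)
      show "X \<omega> \<in> {0..1}" if "\<omega> \<in> space N'" for \<omega>
        using F01[OF XF, of \<omega>] that sp by (simp add: N'_def)
      show "(\<integral>\<omega>. X \<omega> ^ n \<partial>M') = (\<integral>\<omega>. X \<omega> ^ n \<partial>N')" for n
      proof -
        have "(\<integral>\<omega>. X \<omega> ^ n \<partial>M') = (\<integral>\<omega>. (h \<omega> * X \<omega> ^ n) * indicator (S L) \<omega> \<partial>M)"
          unfolding M'_def using w01
          by (subst integral_density) (auto intro!: AE_I2 simp: w_def mult_ac)
        also have "\<dots> = (\<integral>\<omega>. (h \<omega> * X \<omega> ^ n) * indicator (S L) \<omega> \<partial>N)"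
          using Cons.IH[OF LF pow[OF Cons.prems(2) XF]] .
        also have "\<dots> = (\<integral>\<omega>. X \<omega> ^ n \<partial>N')"
          unfolding N'_def using w01 sp
          by (subst integral_density) (auto intro!: AE_I2 simp: w_def mult_ac)
        finally show ?thesis .
      qed
    qed
    then have "(\<integral>x. indicator {a<..} x \<partial>distr M' borel X) = (\<integral>x. indicator {a<..} x \<partial>distr N' borel X :: real)"
      by simp
    then have "(\<integral>\<omega>. indicator {a<..} (X \<omega>) \<partial>M') = (\<integral>\<omega>. indicator {a<..} (X \<omega>) \<partial>N' :: real)"
      by (subst (asm) (1 2) integral_distr) (auto simp: M'_def N'_def)
    then have *: "(\<integral>\<omega>. w \<omega> * indicator {a<..} (X \<omega>) \<partial>M) = (\<integral>\<omega>. w \<omega> * indicator {a<..} (X \<omega>) \<partial>N :: real)"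
      unfolding M'_def N'_def using w01 sp
      by (subst (asm) (1 2) integral_density) (auto intro!: AE_I2)
    have "h \<omega> * indicator (S (Xa # L)) \<omega> = w \<omega> * indicator {a<..} (X \<omega>)" if "\<omega> \<in> space M" for \<omega>
      using that by (auto simp: w_def S_def Xa indicator_def)
    then have "(\<integral>\<omega>. h \<omega> * indicator (S (Xa # L)) \<omega> \<partial>M) = (\<integral>\<omega>. w \<omega> * indicator {a<..} (X \<omega>) \<partial>M)"
      "(\<integral>\<omega>. h \<omega> * indicator (S (Xa # L)) \<omega> \<partial>N) = (\<integral>\<omega>. w \<omega> * indicator {a<..} (X \<omega>) \<partial>N)"
      using sp by (auto intro!: Bochner_Integration.integral_cong)
    with * show ?case by simp
  qed
  define E where "E = {S L | L. set L \<subseteq> F \<times> UNIV}"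
  show ?thesis
  proof (rule measure_eqI_generator_eq[where E = E and A = "\<lambda>_. space M"])
    show "Int_stable E"
    proof (rule Int_stableI)
      fix A B assume "A \<in> E" "B \<in> E"
      then obtain L L' where L: "A = S L" "set L \<subseteq> F \<times> UNIV" "B = S L'" "set L' \<subseteq> F \<times> UNIV"
        unfolding E_def by auto
      moreover have "S (L @ L') = S L \<inter> S L'" by (auto simp: S_def)
      ultimately show "A \<inter> B \<in> E"
        unfolding E_def by (auto intro!: exI[of _ "L @ L'"])
    qed
    show "E \<subseteq> Pow (space M)" by (auto simp: E_def S_def)
    show "emeasure M A = emeasure N A" if "A \<in> E" for A
    proof -
      obtain L where L: "A = S L" "set L \<subseteq> F \<times> UNIV" using \<open>A \<in> E\<close> unfolding E_def by auto
      have "measure M (S L) = measure N (S L)"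
        using key[OF L(2) one] S_sets[OF L(2)] gen(2) sp by (simp add: Int_absorb2 sets.sets_into_space)
      then show ?thesis using L by (simp add: M.emeasure_eq_measure N.emeasure_eq_measure)
    qed
    have "{{\<omega>\<in>space M. a < X \<omega>} | X a. X \<in> F} \<subseteq> E"
    proof safe
      fix X a assume "X \<in> F"
      then show "{\<omega>\<in>space M. a < X \<omega>} \<in> E"
        unfolding E_def by (auto intro!: exI[of _ "[(X, a)]"] simp: S_def)
    qed
    then have "sets M \<subseteq> sigma_sets (space M) E"
      unfolding gen(1) by (rule sigma_sets_mono')
    moreover have "sigma_sets (space M) E \<subseteq> sets M"
      using S_sets by (intro sets.sigma_sets_subset) (auto simp: E_def)
    ultimately show "sets M = sigma_sets (space M) E" by auto
    then show "sets N = sigma_sets (space M) E" using gen(2) by simp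
    show "range (\<lambda>_. space M) \<subseteq> E"
      unfolding E_def by (auto intro!: exI[of _ "[]"] simp: S_def)
  qed auto
qed

section \<open>Integrals as monotone linear functionals\<close>

text \<open>\<open>add_atoms\<close> and \<open>blackwell_macqueen\<close> are specified by their
  values on sets. This lemma turns such a specification into a formula for integrals, by the
  standard induction over nonnegative measurable functions.\<close>

lemma nn_integral_eqI_functional:
  assumes meas: "f \<in> borel_measurable M"
    and cong: "\<And>g h. g \<in> borel_measurable M \<Longrightarrow> (\<And>x. x \<in> space M \<Longrightarrow> g x = h x) \<Longrightarrow> \<Phi> g = \<Phi> h"
    and set: "\<And>A. A \<in> sets M \<Longrightarrow> \<Phi> (indicator A) = emeasure M A"
    and cmult: "\<And>g c. g \<in> borel_measurable M \<Longrightarrow> \<Phi> (\<lambda>x. c * g x) = c * \<Phi> g"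
    and add: "\<And>g h. g \<in> borel_measurable M \<Longrightarrow> h \<in> borel_measurable M \<Longrightarrow> \<Phi> (\<lambda>x. g x + h x) = \<Phi> g + \<Phi> h"
    and SUP: "\<And>U. (\<And>i::nat. U i \<in> borel_measurable M) \<Longrightarrow> incseq U \<Longrightarrow> \<Phi> (\<lambda>x. SUP i. U i x) = (SUP i. \<Phi> (U i))"
  shows "\<Phi> f = (\<integral>\<^sup>+x. f x \<partial>M)"
  using meas
proof induction
  case (cong g h)
  then show ?case using assms(2)[of g h] by (metis nn_integral_cong)
next
  case (set A)
  then show ?case by (simp add: assms(3))
next
  case (mult u c)
  then show ?case by (simp add: assms(4) nn_integral_cmult)
next
  case (add u v)
  then show ?case by (simp add: assms(5) nn_integral_add)
next
  case (seq U)
  have "(SUP i. U i) = (\<lambda>x. SUP i. U i x)"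
    by (simp add: fun_eq_iff image_comp)
  then have "\<Phi> (SUP i. U i) = \<Phi> (\<lambda>x. SUP i. U i x)"
    by simp
  also have "\<dots> = (SUP i. \<integral>\<^sup>+x. U i x \<partial>M)"
    using seq by (simp add: SUP)
  also have "\<dots> = (\<integral>\<^sup>+x. (SUP i. U i x) \<partial>M)"
    using seq by (intro nn_integral_monotone_convergence_SUP[symmetric]) auto
  finally show ?case
    using \<open>(SUP i. U i) = (\<lambda>x. SUP i. U i x)\<close> by simp
qed

section \<open>Boundedly finite measures\<close>

lemma sets_add_atoms [simp, measurable_cong]: "sets (add_atoms m I c y) = sets m"
  and space_add_atoms [simp]: "space (add_atoms m I c y) = space m"
  by (simp_all add: add_atoms_def sets.sets_measure_of_eq sets.space_measure_of_eq)

lemma emeasure_add_atoms: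
  assumes "finite I" "A \<in> sets m"
  shows "emeasure (add_atoms m I c y) A = emeasure m A + (\<Sum>j\<in>I. ennreal (c j) * indicator A (y j))"
proof (rule emeasure_measure_of[OF add_atoms_def])
  show "sets m \<subseteq> Pow (space m)" by (rule sets.space_closed)
  show "A \<in> sets (add_atoms m I c y)" using assms by simp
  show "positive (sets (add_atoms m I c y)) (\<lambda>A. emeasure m A + (\<Sum>j\<in>I. ennreal (c j) * indicator A (y j)))"
    by (simp add: positive_def)
  show "countably_additive (sets (add_atoms m I c y)) (\<lambda>A. emeasure m A + (\<Sum>j\<in>I. ennreal (c j) * indicator A (y j)))"
  proof (rule countably_additiveI)
    fix A :: "nat \<Rightarrow> _" assume A: "range A \<subseteq> sets (add_atoms m I c y)" "disjoint_family A"
    have "(\<Sum>i. emeasure m (A i) + (\<Sum>j\<in>I. ennreal (c j) * indicator (A i) (y j))) =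
        (\<Sum>i. emeasure m (A i)) + (\<Sum>i. \<Sum>j\<in>I. ennreal (c j) * indicator (A i) (y j))"
      by (rule suminf_add[symmetric]) auto
    also have "(\<Sum>i. emeasure m (A i)) = emeasure m (\<Union>i. A i)"
      using A by (intro suminf_emeasure) auto
    also have "(\<Sum>i. \<Sum>j\<in>I. ennreal (c j) * indicator (A i) (y j)) = (\<Sum>j\<in>I. \<Sum>i. ennreal (c j) * indicator (A i) (y j))"
      by (rule suminf_sum) auto
    also have "\<dots> = (\<Sum>j\<in>I. ennreal (c j) * indicator (\<Union>i. A i) (y j))"
      by (intro sum.cong refl) (simp add: suminf_indicator[OF A(2)])
    finally show "(\<Sum>i. emeasure m (A i) + (\<Sum>j\<in>I. ennreal (c j) * indicator (A i) (y j))) =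
      emeasure m (\<Union>i. A i) + (\<Sum>j\<in>I. ennreal (c j) * indicator (\<Union>i. A i) (y j))" .
  qed
qed

lemma nn_integral_add_atoms:
  assumes "finite I" and f: "f \<in> borel_measurable m" and y: "\<And>j. j \<in> I \<Longrightarrow> y j \<in> space m"
  shows "(\<integral>\<^sup>+x. f x \<partial>add_atoms m I c y) = (\<integral>\<^sup>+x. f x \<partial>m) + (\<Sum>j\<in>I. ennreal (c j) * f (y j))"
proof (rule nn_integral_eqI_functional[symmetric, where \<Phi> = "\<lambda>f. (\<integral>\<^sup>+x. f x \<partial>m) + (\<Sum>j\<in>I. ennreal (c j) * f (y j))"])
  show "f \<in> borel_measurable (add_atoms m I c y)" using f by simp
next
  fix g h :: "'a \<Rightarrow> ennreal" assume *: "\<And>x. x \<in> space (add_atoms m I c y) \<Longrightarrow> g x = h x"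
  then have "(\<integral>\<^sup>+x. g x \<partial>m) = (\<integral>\<^sup>+x. h x \<partial>m)" by (intro nn_integral_cong) simp
  then show "(\<integral>\<^sup>+x. g x \<partial>m) + (\<Sum>j\<in>I. ennreal (c j) * g (y j)) = (\<integral>\<^sup>+x. h x \<partial>m) + (\<Sum>j\<in>I. ennreal (c j) * h (y j))"
    using * y by simp
next
  fix A assume "A \<in> sets (add_atoms m I c y)"
  then show "(\<integral>\<^sup>+x. indicator A x \<partial>m) + (\<Sum>j\<in>I. ennreal (c j) * indicator A (y j)) = emeasure (add_atoms m I c y) A"
    using \<open>finite I\<close> by (simp add: emeasure_add_atoms)
next
  fix g :: "'a \<Rightarrow> ennreal" and d assume "g \<in> borel_measurable (add_atoms m I c y)"
  then show "(\<integral>\<^sup>+x. d * g x \<partial>m) + (\<Sum>j\<in>I. ennreal (c j) * (d * g (y j))) =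
      d * ((\<integral>\<^sup>+x. g x \<partial>m) + (\<Sum>j\<in>I. ennreal (c j) * g (y j)))"
    by (simp add: nn_integral_cmult distrib_left sum_distrib_left mult_ac)
next
  fix g h :: "'a \<Rightarrow> ennreal" assume "g \<in> borel_measurable (add_atoms m I c y)" "h \<in> borel_measurable (add_atoms m I c y)"
  then show "(\<integral>\<^sup>+x. g x + h x \<partial>m) + (\<Sum>j\<in>I. ennreal (c j) * (g (y j) + h (y j))) =
      (\<integral>\<^sup>+x. g x \<partial>m) + (\<Sum>j\<in>I. ennreal (c j) * g (y j)) + ((\<integral>\<^sup>+x. h x \<partial>m) + (\<Sum>j\<in>I. ennreal (c j) * h (y j)))"
    by (simp add: nn_integral_add distrib_left sum.distrib add_ac)
next
  fix U :: "nat \<Rightarrow> 'a \<Rightarrow> ennreal" assume U: "\<And>i. U i \<in> borel_measurable (add_atoms m I c y)" "incseq U"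
  have U': "incseq (\<lambda>i. U i x)" for x using U(2) by (auto simp: incseq_def le_fun_def)
  have int: "incseq (\<lambda>i. \<integral>\<^sup>+x. U i x \<partial>m)"
    using U' by (auto simp: incseq_def intro!: nn_integral_mono)
  have "(\<Sum>j\<in>I. ennreal (c j) * (SUP i. U i (y j))) = (SUP i. \<Sum>j\<in>I. ennreal (c j) * U i (y j))"
    using \<open>finite I\<close>
  proof (induction I)
    case (insert j I)
    show ?case using insert U'
      by (simp add: SUP_mult_left_ennreal ennreal_SUP_add[symmetric] incseq_def sum_mono mult_left_mono)
  qed simp
  moreover have "(\<integral>\<^sup>+x. (SUP i. U i x) \<partial>m) = (SUP i. \<integral>\<^sup>+x. U i x \<partial>m)"
    using U by (intro nn_integral_monotone_convergence_SUP) auto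
  ultimately show "(\<integral>\<^sup>+x. (SUP i. U i x) \<partial>m) + (\<Sum>j\<in>I. ennreal (c j) * (SUP i. U i (y j))) =
      (SUP i. (\<integral>\<^sup>+x. U i x \<partial>m) + (\<Sum>j\<in>I. ennreal (c j) * U i (y j)))"
    using int U' by (simp add: ennreal_SUP_add[symmetric] incseq_def sum_mono mult_left_mono)
qed

lemma space_bf_algebra [simp]: "space bf_algebra = boundedly_finite"
  by (auto simp add: bf_algebra_def space_Sup_eq_UN)

lemma sets_boundedly_finite: "m \<in> boundedly_finite \<Longrightarrow> sets m = sets borel"
  and space_boundedly_finite: "m \<in> boundedly_finite \<Longrightarrow> space m = UNIV"
  unfolding boundedly_finite_def by (auto dest: sets_eq_imp_space_eq)

lemma measurable_emeasure_bf_algebra [measurable]: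
  "A \<in> sets borel \<Longrightarrow> (\<lambda>m. emeasure m A) \<in> borel_measurable bf_algebra"
  by (auto intro!: measurable_Sup1 measurable_vimage_algebra1 simp: bf_algebra_def)

lemma measurable_bf_algebraI:
  "(\<And>x. x \<in> space M \<Longrightarrow> K x \<in> boundedly_finite) \<Longrightarrow>
    (\<And>A. A \<in> sets borel \<Longrightarrow> (\<lambda>x. emeasure (K x) A) \<in> borel_measurable M) \<Longrightarrow>
    K \<in> measurable M bf_algebra"
  by (auto intro!: measurable_Sup2 measurable_vimage_algebra2 simp: bf_algebra_def)

lemma measurable_nn_integral_bf_algebra [measurable]:
  fixes f :: "'a::polish_space \<Rightarrow> ennreal"
  assumes "f \<in> borel_measurable borel"
  shows "(\<lambda>m. \<integral>\<^sup>+x. f x \<partial>m) \<in> borel_measurable bf_algebra"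
  using assms
proof induction
  case (cong f g)
  have "f = g" using cong by auto
  then show ?case using cong by simp
next
  case (set B)
  then have "(\<lambda>m. \<integral>\<^sup>+x. indicator B x \<partial>m) \<in> borel_measurable bf_algebra \<longleftrightarrow>
      (\<lambda>m. emeasure m B) \<in> borel_measurable bf_algebra"
    by (intro measurable_cong nn_integral_indicator) (simp add: sets_boundedly_finite)
  with set show ?case by simp
next
  case (mult f c)
  then have "(\<lambda>m. \<integral>\<^sup>+x. c * f x \<partial>m) \<in> borel_measurable bf_algebra \<longleftrightarrow>
      (\<lambda>m. c * \<integral>\<^sup>+x. f x \<partial>m) \<in> borel_measurable bf_algebra"
    by (intro measurable_cong nn_integral_cmult) (simp add: measurable_cong_sets[OF sets_boundedly_finite])
  with mult show ?case by simp
next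
  case (add f g)
  then have "(\<lambda>m. \<integral>\<^sup>+x. g x + f x \<partial>m) \<in> borel_measurable bf_algebra \<longleftrightarrow>
      (\<lambda>m. (\<integral>\<^sup>+x. g x \<partial>m) + (\<integral>\<^sup>+x. f x \<partial>m)) \<in> borel_measurable bf_algebra"
    by (intro measurable_cong nn_integral_add) (simp_all add: measurable_cong_sets[OF sets_boundedly_finite])
  with add show ?case by simp
next
  case (seq F)
  then have "(\<lambda>m. \<integral>\<^sup>+x. (SUP i. F i) x \<partial>m) \<in> borel_measurable bf_algebra \<longleftrightarrow>
      (\<lambda>m. SUP i. \<integral>\<^sup>+x. F i x \<partial>m) \<in> borel_measurable bf_algebra"
    unfolding SUP_apply
    by (intro measurable_cong nn_integral_monotone_convergence_SUP)
       (simp_all add: measurable_cong_sets[OF sets_boundedly_finite])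
  with seq show ?case by (simp add: image_comp)
qed

section \<open>Laplace functionals of random measures\<close>

lemma measurable_exp_neg [measurable]: "exp_neg \<in> borel_measurable borel"
  unfolding exp_neg_def by measurable

lemma exp_neg_01: "0 \<le> exp_neg t" "exp_neg t \<le> 1"
  by (auto simp: exp_neg_def)

lemma exp_neg_0 [simp]: "exp_neg 0 = 1"
  by (simp add: exp_neg_def)

lemma exp_neg_ennreal [simp]: "0 \<le> x \<Longrightarrow> exp_neg (ennreal x) = exp (- x)"
  by (simp add: exp_neg_def)

lemma exp_neg_add: "exp_neg (s + t) = exp_neg s * exp_neg t"
  by (cases s; cases t) (auto simp: exp_neg_def exp_add[symmetric] simp flip: ennreal_plus)

text \<open>The value 0 at infinity is attained nowhere else, so \<open>exp_neg\<close> is injective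
  and \<open>m A\<close> can be read off from \<open>exp (- m A)\<close> even when it is
  infinite.\<close>

lemma exp_neg_inverse: "t = (if exp_neg t = 0 then \<infinity> else ennreal (- ln (exp_neg t)))"
  by (cases t) (auto simp: exp_neg_def)

text \<open>These are the functions that \<open>gamma_process_law\<close> quantifies over. Their
  closure under addition makes the Laplace functionals closed under products.\<close>

definition test_functions :: "('a::polish_space \<Rightarrow> real) set" where
  "test_functions = {f \<in> borel_measurable borel. (\<forall>x. 0 \<le> f x) \<and> bounded (range f)}"

lemma test_functions_add:
  "f \<in> test_functions \<Longrightarrow> g \<in> test_functions \<Longrightarrow> (\<lambda>x. f x + g x) \<in> test_functions"
  by (auto simp: test_functions_def intro: bounded_plus_comp)

lemma test_functions_cmult:
  "f \<in> test_functions \<Longrightarrow> 0 \<le> c \<Longrightarrow> (\<lambda>x. c * f x) \<in> test_functions"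
  by (auto simp: test_functions_def bounded_iff abs_mult intro!: exI[of _ "c * b" for b] mult_left_mono)

lemma test_functions_const: "0 \<le> c \<Longrightarrow> (\<lambda>_. c) \<in> test_functions"
  by (auto simp: test_functions_def bounded_iff)

lemma test_functions_indicator: "A \<in> sets borel \<Longrightarrow> indicator A \<in> test_functions"
  by (auto simp: test_functions_def bounded_iff indicator_def intro!: exI[of _ 1])

lemma test_functionsD:
  assumes "f \<in> test_functions"
  shows "f \<in> borel_measurable borel" "0 \<le> f x"
  using assms by (auto simp: test_functions_def)

text \<open>Indicators are test functions and \<open>exp_neg\<close> can be inverted, so the Laplace
  functionals generate every evaluation \<open>m A\<close>. Conversely, each functional is
  measurable because integrals are measurable in the measure.\<close>

lemma sets_bf_algebra_eq:
  "sets bf_algebra = sigma_sets boundedly_finite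
    {{m\<in>boundedly_finite. a < X m} | X a. X \<in> (\<lambda>f m. exp_neg (\<integral>\<^sup>+x. ennreal (f x) \<partial>m)) ` test_functions}"
    (is "_ = sigma_sets _ ?E")
proof
  define S where "S = sigma (boundedly_finite :: 'a measure set) ?E"
  have [simp]: "space S = boundedly_finite" "sets S = sigma_sets boundedly_finite ?E"
    unfolding S_def by (auto intro!: space_measure_of sets_measure_of)
  \<comment> \<open>Inclusion of sigma-algebras is stated as measurability of the identity, so that
    it can be checked on the evaluations alone.\<close>
  have "(\<lambda>m. m) \<in> measurable S bf_algebra"
  proof (rule measurable_bf_algebraI)
    fix A :: "'a set" assume A [measurable]: "A \<in> sets borel"
    have [measurable]: "(\<lambda>m. exp_neg (\<integral>\<^sup>+x. ennreal (indicator A x) \<partial>m)) \<in> borel_measurable S"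
      unfolding borel_measurable_iff_greater
      by (auto intro!: sigma_sets.Basic imageI test_functions_indicator)
    have "(\<lambda>m. let e = exp_neg (\<integral>\<^sup>+x. ennreal (indicator A x) \<partial>m) in
        if e = 0 then \<infinity> else ennreal (- ln e)) \<in> borel_measurable S"
      unfolding Let_def by measurable
    also have "?this \<longleftrightarrow> (\<lambda>m. emeasure m A) \<in> borel_measurable S"
      using exp_neg_inverse A
      by (intro measurable_cong) (auto simp: Let_def ennreal_indicator sets_boundedly_finite)
    finally show "(\<lambda>m. emeasure m A) \<in> borel_measurable S" .
  qed simp
  then have "A \<in> sets S" if "A \<in> sets bf_algebra" for A :: "'a measure set"
    using measurable_sets[of "\<lambda>m. m" S bf_algebra A] that sets.sets_into_space[OF that]
    by (simp add: Int_absorb2)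
  then show "sets bf_algebra \<subseteq> sigma_sets boundedly_finite ?E" by auto
  show "sigma_sets boundedly_finite ?E \<subseteq> sets bf_algebra"
  proof (rule sets.sigma_sets_subset[of _ bf_algebra, simplified], safe)
    fix a and f :: "'a \<Rightarrow> real" assume "f \<in> test_functions"
    note [measurable] = test_functionsD(1)[OF this]
    have "{m \<in> space bf_algebra. a < exp_neg (\<integral>\<^sup>+x. ennreal (f x) \<partial>m)} \<in> sets bf_algebra"
      by measurable
    then show "{m \<in> boundedly_finite. a < exp_neg (\<integral>\<^sup>+x. ennreal (f x) \<partial>m)} \<in> sets bf_algebra"
      by simp
  qed
qed

text \<open>The functional at \<open>f\<close> times the functional at \<open>g\<close> is the
  functional at \<open>f + g\<close>. So the functionals form a multiplicative class with values in
  the unit interval, and this class generates the sigma-algebra.\<close>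

theorem bf_measure_eqI_Laplace:
  fixes M N :: "'a::polish_space measure measure"
  assumes fin: "finite_measure M" "finite_measure N"
    and sets: "sets M = sets bf_algebra" "sets N = sets bf_algebra"
    and eq: "\<And>f. f \<in> test_functions \<Longrightarrow>
      (\<integral>m. exp_neg (\<integral>\<^sup>+x. ennreal (f x) \<partial>m) \<partial>M) = (\<integral>m. exp_neg (\<integral>\<^sup>+x. ennreal (f x) \<partial>m) \<partial>N)"
  shows "M = N"
proof -
  let ?e = "\<lambda>f m. exp_neg (\<integral>\<^sup>+x. ennreal (f x) \<partial>m) :: real"
  \<comment> \<open>Membership prescribes the values on \<open>boundedly_finite\<close> only. The
    product rule rests on Borel functions being measurable for \<open>m\<close>, which an arbitrary
    measure on the type does not guarantee.\<close>
  define F :: "('a measure \<Rightarrow> real) set"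
    where "F = {X. \<exists>f\<in>test_functions. \<forall>m\<in>boundedly_finite. X m = ?e f m}"
  have sp: "space M = boundedly_finite" "space N = boundedly_finite"
    using sets_eq_imp_space_eq[OF sets(1)] sets_eq_imp_space_eq[OF sets(2)] by simp_all
  show ?thesis
  proof (rule measure_eqI_multiplicative_class[OF fin, where F = F])
    show "space N = space M" using sp by simp
    have "{{m\<in>boundedly_finite. a < X m} | X a. X \<in> F} =
        {{m\<in>boundedly_finite. a < X m} | X a. X \<in> ?e ` test_functions}"
    proof (intro equalityI subsetI)
      fix A assume "A \<in> {{m\<in>boundedly_finite. a < X m} | X a. X \<in> F}"
      then obtain X a f where "A = {m\<in>boundedly_finite. a < X m}" "f \<in> test_functions"
        "\<forall>m\<in>boundedly_finite. X m = ?e f m"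
        unfolding F_def by auto
      then have "A = {m\<in>boundedly_finite. a < ?e f m}" "?e f \<in> ?e ` test_functions"
        by auto
      then show "A \<in> {{m\<in>boundedly_finite. a < X m} | X a. X \<in> ?e ` test_functions}"
        unfolding mem_Collect_eq by (intro exI[of _ "?e f"] exI[of _ a] conjI)
    qed (auto simp: F_def)
    then show "sets M = sigma_sets (space M) {{m\<in>space M. a < X m} | X a. X \<in> F}"
      unfolding sp sets sets_bf_algebra_eq by simp
    show "sets N = sets M" using sets by simp
    show "(\<lambda>_. 1) \<in> F"
      using test_functions_const[of 0] by (auto simp: F_def intro!: bexI[of _ "\<lambda>_. 0"])
    show "(\<lambda>m. X m * Y m) \<in> F" if XY: "X \<in> F" "Y \<in> F" for X Y
    proof -
      obtain f g where fg: "f \<in> test_functions" "g \<in> test_functions"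
        and eq: "\<forall>m\<in>boundedly_finite. X m = ?e f m" "\<forall>m\<in>boundedly_finite. Y m = ?e g m"
        using XY unfolding F_def by auto
      have "X m * Y m = ?e (\<lambda>x. f x + g x) m" if "m \<in> boundedly_finite" for m
        using fg[THEN test_functionsD(1)] fg[THEN test_functionsD(2)] eq that
        by (simp add: ennreal_plus nn_integral_add exp_neg_add
          measurable_cong_sets[OF sets_boundedly_finite[OF that]])
      then show ?thesis using test_functions_add[OF fg] unfolding F_def by auto
    qed
    show "X m \<in> {0..1}" if "X \<in> F" "m \<in> space M" for X m
      using that exp_neg_01 by (auto simp: F_def sp)
    show "(\<integral>m. X m \<partial>M) = (\<integral>m. X m \<partial>N)" if "X \<in> F" for X
    proof -
      obtain f where f: "f \<in> test_functions" "\<forall>m\<in>boundedly_finite. X m = ?e f m"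
        using \<open>X \<in> F\<close> unfolding F_def by auto
      then have "(\<integral>m. X m \<partial>M) = (\<integral>m. ?e f m \<partial>M)" "(\<integral>m. X m \<partial>N) = (\<integral>m. ?e f m \<partial>N)"
        by (auto intro!: Bochner_Integration.integral_cong simp: sp)
      then show ?thesis using eq[OF f(1)] by simp
    qed
  qed
qed

lemma scale_measure_eq_density:
  "scale_measure r M = density M (\<lambda>_. r)"
  by (rule measure_eqI) (simp_all add: emeasure_density_const)

lemma integral_scale_measure:
  fixes f :: "'b \<Rightarrow> real"
  assumes "f \<in> borel_measurable M" "0 \<le> r"
  shows "(\<integral>x. f x \<partial>scale_measure (ennreal r) M) = r * (\<integral>x. f x \<partial>M)"
  using assms by (simp add: scale_measure_eq_density integral_density)

text \<open>The Laplace functional with values in \<open>ennreal\<close>, so that densities, image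
  measures and Fubini's theorem apply without integrability conditions.\<close>

abbreviation elap :: "('a \<Rightarrow> real) \<Rightarrow> 'a measure \<Rightarrow> ennreal" where
  "elap f m \<equiv> ennreal (exp_neg (\<integral>\<^sup>+x. ennreal (f x) \<partial>m))"

lemma measurable_elap [measurable]:
  fixes f :: "'a::polish_space \<Rightarrow> real"
  assumes [measurable]: "f \<in> borel_measurable borel"
  shows "elap f \<in> borel_measurable bf_algebra"
  by measurable

lemma bf_measure_eqI_elap:
  fixes M N :: "'a::polish_space measure measure"
  assumes fin: "finite_measure M" "finite_measure N"
    and sets: "sets M = sets bf_algebra" "sets N = sets bf_algebra"
    and eq: "\<And>f. f \<in> test_functions \<Longrightarrow> (\<integral>\<^sup>+m. elap f m \<partial>M) = (\<integral>\<^sup>+m. elap f m \<partial>N)"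
  shows "M = N"
proof (rule bf_measure_eqI_Laplace[OF fin sets])
  fix f :: "'a \<Rightarrow> real" assume f: "f \<in> test_functions"
  note [measurable] = test_functionsD(1)[OF f]
  note [measurable_cong] = sets
  show "(\<integral>m. exp_neg (\<integral>\<^sup>+x. ennreal (f x) \<partial>m) \<partial>M) = (\<integral>m. exp_neg (\<integral>\<^sup>+x. ennreal (f x) \<partial>m) \<partial>N)"
    using eq[OF f] by (subst (1 2) integral_eq_nn_integral) (auto simp: exp_neg_01)
qed

lemma measurable_boundedly_finite:
  "m \<in> boundedly_finite \<Longrightarrow> f \<in> borel_measurable borel \<Longrightarrow> f \<in> borel_measurable m"
  using measurable_cong_sets[OF sets_boundedly_finite] by blast

lemma elap_add:
  assumes "m \<in> boundedly_finite" "f \<in> test_functions" "g \<in> test_functions"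
  shows "elap (\<lambda>x. f x + g x) m = elap f m * elap g m"
proof -
  have "(\<integral>\<^sup>+x. ennreal (f x + g x) \<partial>m) = (\<integral>\<^sup>+x. ennreal (f x) \<partial>m) + (\<integral>\<^sup>+x. ennreal (g x) \<partial>m)"
    using assms by (simp add: ennreal_plus test_functionsD nn_integral_add measurable_boundedly_finite)
  then show ?thesis by (simp add: exp_neg_add ennreal_mult exp_neg_01)
qed

lemma elap_scale_measure:
  assumes "m \<in> boundedly_finite" "f \<in> test_functions" "0 \<le> c"
  shows "elap f (scale_measure (ennreal c) m) = elap (\<lambda>x. c * f x) m"
proof -
  have "(\<integral>\<^sup>+x. ennreal (f x) \<partial>scale_measure (ennreal c) m) = (\<integral>\<^sup>+x. ennreal (c * f x) \<partial>m)"
    using assms by (simp add: nn_integral_scale_measure ennreal_mult test_functionsD nn_integral_cmult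
        measurable_boundedly_finite)
  then show ?thesis by simp
qed

lemma elap_add_atoms:
  assumes "m \<in> boundedly_finite" "f \<in> test_functions" "finite I" "\<And>j. j \<in> I \<Longrightarrow> 0 \<le> c j"
  shows "elap f (add_atoms m I c y) = elap f m * (\<Prod>j\<in>I. ennreal (exp (- (c j * f (y j)))))"
proof -
  have "(\<integral>\<^sup>+x. ennreal (f x) \<partial>add_atoms m I c y) =
      (\<integral>\<^sup>+x. ennreal (f x) \<partial>m) + ennreal (\<Sum>j\<in>I. c j * f (y j))"
    using assms by (subst nn_integral_add_atoms)
      (auto simp: test_functionsD measurable_boundedly_finite space_boundedly_finite ennreal_mult[symmetric] sum_ennreal)
  then show ?thesis
    using assms by (simp add: exp_neg_add ennreal_mult exp_neg_01 sum_nonneg test_functionsD exp_sum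
        prod_ennreal sum_negf[symmetric] prod_nonneg)
qed

section \<open>Total mass and normalization\<close>

lemma emeasure_normalized [simp]: "emeasure (normalized m) A = ennreal (1 / total_mass m) * emeasure m A"
  by (simp add: normalized_def)

lemma sets_normalized [simp, measurable_cong]: "sets (normalized m) = sets m"
  and space_normalized [simp]: "space (normalized m) = space m"
  by (simp_all add: normalized_def space_scale_measure)

lemma scale_measure_boundedly_finite:
  "m \<in> boundedly_finite \<Longrightarrow> scale_measure (ennreal c) m \<in> boundedly_finite"
  by (auto simp: boundedly_finite_def ennreal_mult_less_top)

lemma normalized_boundedly_finite:
  "m \<in> boundedly_finite \<Longrightarrow> normalized m \<in> boundedly_finite"
  unfolding normalized_def by (rule scale_measure_boundedly_finite)

lemma add_atoms_boundedly_finite: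
  "m \<in> boundedly_finite \<Longrightarrow> finite I \<Longrightarrow> add_atoms m I c y \<in> boundedly_finite"
  by (auto simp: boundedly_finite_def emeasure_add_atoms ennreal_mult_less_top indicator_def)

lemma measurable_total_mass [measurable]: "total_mass \<in> borel_measurable bf_algebra"
proof -
  have "(\<lambda>m::'a measure. enn2real (emeasure m UNIV)) \<in> borel_measurable bf_algebra"
    by measurable
  also have "?this \<longleftrightarrow> ?thesis"
    by (intro measurable_cong) (simp add: total_mass_def measure_def space_boundedly_finite)
  finally show ?thesis .
qed

lemma measurable_scale_measure_bf [measurable]:
  assumes [measurable]: "c \<in> borel_measurable M" "m \<in> measurable M bf_algebra"
  shows "(\<lambda>x. scale_measure (ennreal (c x)) (m x)) \<in> measurable M bf_algebra"
  using measurable_space[OF assms(2)]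
  by (intro measurable_bf_algebraI) (auto simp: scale_measure_boundedly_finite)

lemma measurable_normalized [measurable]: "normalized \<in> measurable bf_algebra bf_algebra"
  unfolding normalized_def by measurable

lemma total_mass_nonneg: "0 \<le> total_mass m"
  by (simp add: total_mass_def)

lemma total_mass_scale_measure: "0 \<le> c \<Longrightarrow> total_mass (scale_measure (ennreal c) m) = c * total_mass m"
  by (simp add: total_mass_def measure_def enn2real_mult space_scale_measure)

text \<open>The total mass picks up the factor \<open>c\<close>, which cancels. If the total mass is
  0, which includes infinite measures by convention, both sides carry the factor
  \<open>1 / 0 = 0\<close>. Hence the invariance holds for every \<open>m\<close>, as the
  independence lemmas below require.\<close>

lemma normalized_scale_measure:
  assumes "0 < c"
  shows "normalized (scale_measure (ennreal c) m) = normalized m"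
proof (rule measure_eqI)
  fix A
  have "ennreal (1 / (c * total_mass m)) * ennreal c = ennreal (1 / total_mass m)"
    using assms by (simp add: ennreal_mult[symmetric] total_mass_nonneg)
  then show "emeasure (normalized (scale_measure (ennreal c) m)) A = emeasure (normalized m) A"
    using assms by (simp add: total_mass_scale_measure mult.assoc[symmetric])
qed simp

text \<open>This transfers statements about \<open>exp (- T)\<close> to \<open>T\<close>. For
  infinite mass both sides are 0, the right one because \<open>ln 0 = 0\<close>.\<close>

lemma total_mass_eq_ln: "space m = UNIV \<Longrightarrow> total_mass m = - ln (exp_neg (emeasure m UNIV))"
  by (cases "emeasure m UNIV") (auto simp: total_mass_def measure_def exp_neg_def)

text \<open>This is \<open>P f\<close> for \<open>P = m / T\<close>. It does not change when
  \<open>m\<close> is scaled, and it is the quantity that turns out to be independent of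
  \<open>T\<close>.\<close>

definition mean :: "('a \<Rightarrow> real) \<Rightarrow> 'a measure \<Rightarrow> real" where
  "mean f m = enn2real (\<integral>\<^sup>+x. ennreal (f x) \<partial>normalized m)"

lemma mean_nonneg: "0 \<le> mean f m"
  by (simp add: mean_def)

lemma mean_scale_measure: "0 < c \<Longrightarrow> mean f (scale_measure (ennreal c) m) = mean f m"
  by (simp add: mean_def normalized_scale_measure)

lemma measurable_mean [measurable]:
  fixes f :: "'a::polish_space \<Rightarrow> real"
  assumes [measurable]: "f \<in> borel_measurable borel"
  shows "mean f \<in> borel_measurable bf_algebra"
  unfolding mean_def by measurable

lemma nn_integral_eq_mass_mean:
  fixes f :: "'a::polish_space \<Rightarrow> real"
  assumes m: "m \<in> boundedly_finite" and mass: "0 < total_mass m" and f: "f \<in> test_functions"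
  shows "(\<integral>\<^sup>+x. ennreal (f x) \<partial>m) = ennreal (total_mass m * mean f m)"
    and "mean f m = (\<integral>x. f x \<partial>m) / total_mass m"
proof -
  have [measurable]: "f \<in> borel_measurable m"
    using test_functionsD(1)[OF f] measurable_cong_sets[OF sets_boundedly_finite[OF m]] by blast
  \<comment> \<open>A positive \<open>total_mass\<close> excludes infinite mass, where it is 0 by
    convention.\<close>
  interpret finite_measure m
    using mass by (intro finite_measureI) (auto simp: total_mass_def measure_def)
  obtain B where B: "\<And>x. f x \<le> B" "\<And>x. 0 \<le> f x"
    using f by (auto simp: test_functions_def bounded_iff) (metis abs_le_D1)
  have int: "integrable m f"
    by (rule integrable_const_bound[of _ B]) (use B in auto)
  then have eq: "(\<integral>\<^sup>+x. ennreal (f x) \<partial>m) = ennreal (\<integral>x. f x \<partial>m)"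
    using B by (intro nn_integral_eq_integral) auto
  have "(\<integral>\<^sup>+x. ennreal (f x) \<partial>normalized m) = ennreal (1 / total_mass m) * ennreal (\<integral>x. f x \<partial>m)"
    unfolding normalized_def by (simp add: nn_integral_scale_measure eq)
  then show 2: "mean f m = (\<integral>x. f x \<partial>m) / total_mass m"
    using mass B by (simp add: mean_def enn2real_mult)
  show "(\<integral>\<^sup>+x. ennreal (f x) \<partial>m) = ennreal (total_mass m * mean f m)"
    using mass by (simp add: eq 2)
qed

section \<open>Gamma variables\<close>

lemma gamma_density_nonneg: "0 < a \<Longrightarrow> 0 \<le> gamma_density a x"
  by (simp add: gamma_density_def Gamma_real_pos less_imp_le)

lemma measurable_gamma_density [measurable]: "gamma_density a \<in> borel_measurable borel"
  unfolding gamma_density_def by measurable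

text \<open>Rescale the variable by \<open>c = 1 + x\<close> in Euler's integral for
  \<open>Gamma a\<close>. At \<open>x = 0\<close> the formula says that the density has mass
  1.\<close>

lemma gamma_density_Laplace:
  assumes a: "0 < a" and x: "0 \<le> x"
  shows "(\<integral>\<^sup>+t. ennreal (gamma_density a t) * ennreal (exp (- (x * t))) \<partial>lborel) = ennreal ((1 + x) powr (- a))"
proof -
  define c where "c = 1 + x"
  have c: "c > 0" using x by (simp add: c_def)
  have gpos: "Gamma a > 0" "Gamma a \<noteq> 0" using Gamma_real_pos[OF a] by auto
  have "ennreal (Gamma a) = (\<integral>\<^sup>+t. ennreal (indicator {0..} t * t powr (a - 1) / exp t) \<partial>lborel)"
    by (rule Gamma_conv_nn_integral_real[OF a])
  also have "\<dots> = (\<integral>\<^sup>+t. ennreal c * ennreal (indicator {0..} (0 + c * t) * (0 + c * t) powr (a - 1) / exp (0 + c * t)) \<partial>lborel)"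
    using c by (subst nn_integral_real_affine[where c = c and t = 0]) (auto simp: nn_integral_cmult)
  also have "\<dots> = (\<integral>\<^sup>+t. ennreal (Gamma a * c powr a) * (ennreal (gamma_density a t) * ennreal (exp (- (x * t)))) \<partial>lborel)"
  proof (rule nn_integral_cong)
    fix t :: real
    show "ennreal c * ennreal (indicator {0..} (0 + c * t) * (0 + c * t) powr (a - 1) / exp (0 + c * t)) =
        ennreal (Gamma a * c powr a) * (ennreal (gamma_density a t) * ennreal (exp (- (x * t))))"
    proof (cases "0 < t")
      case True
      have 1: "exp (- t) * exp (- (x * t)) = inverse (exp (c * t))"
        by (simp add: c_def exp_add[symmetric] exp_minus[symmetric] algebra_simps)
      have 2: "(c * t) powr (a - 1) * c = c powr a * t powr (a - 1)"
        using c True by (simp add: powr_mult powr_diff)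
      have "c * ((c * t) powr (a - 1) / exp (c * t)) = ((c * t) powr (a - 1) * c) * inverse (exp (c * t))"
        by (simp add: divide_inverse)
      also have "\<dots> = (c powr a * t powr (a - 1)) * (exp (- t) * exp (- (x * t)))"
        by (simp only: 1 2)
      finally have "c * ((c * t) powr (a - 1) / exp (c * t)) =
          Gamma a * c powr a * (t powr (a - 1) * exp (- t) / Gamma a * exp (- (x * t)))"
        using gpos by simp
      then show ?thesis
        using True c a gpos by (simp add: gamma_density_def ennreal_mult[symmetric])
    next
      case False
      show ?thesis
      proof (cases "t = 0")
        case True then show ?thesis by (simp add: gamma_density_def)
      next
        assume "t \<noteq> 0"
        with False c have "\<not> 0 \<le> c * t" by (simp add: zero_le_mult_iff)
        with False show ?thesis by (simp add: gamma_density_def)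
      qed
    qed
  qed
  also have "\<dots> = ennreal (Gamma a * c powr a) * (\<integral>\<^sup>+t. ennreal (gamma_density a t) * ennreal (exp (- (x * t))) \<partial>lborel)"
    by (rule nn_integral_cmult) measurable
  finally have *: "ennreal (Gamma a) = ennreal (Gamma a * c powr a) * (\<integral>\<^sup>+t. ennreal (gamma_density a t) * ennreal (exp (- (x * t))) \<partial>lborel)" (is "_ = _ * ?I") .
  have "ennreal (c powr (- a) / Gamma a) * ennreal (Gamma a) =
      (ennreal (c powr (- a) / Gamma a) * ennreal (Gamma a * c powr a)) * ?I"
    unfolding mult.assoc by (subst *) simp
  also have "ennreal (c powr (- a) / Gamma a) * ennreal (Gamma a * c powr a) = 1"
    using c a gpos by (simp add: ennreal_mult[symmetric] powr_minus field_simps)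
  also have "ennreal (c powr (- a) / Gamma a) * ennreal (Gamma a) = ennreal (c powr (- a))"
    using Gamma_real_pos[OF a] by (simp add: ennreal_mult[symmetric])
  finally show ?thesis by (simp add: c_def)
qed

lemma prob_space_gamma_density: "0 < a \<Longrightarrow> prob_space (density lborel (\<lambda>t. ennreal (gamma_density a t)))"
  using gamma_density_Laplace[of a 0] by (intro prob_spaceI) (simp add: emeasure_density)

section \<open>The Gamma process\<close>

lemma nn_integral_bounded_eq_integral:
  assumes "finite_measure M" "f \<in> borel_measurable M" "\<And>x. x \<in> space M \<Longrightarrow> 0 \<le> f x" "\<And>x. x \<in> space M \<Longrightarrow> f x \<le> (B::real)"
  shows "(\<integral>\<^sup>+x. ennreal (f x) \<partial>M) = ennreal (\<integral>x. f x \<partial>M)"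
proof (rule nn_integral_eq_integral)
  show "integrable M f"
    by (rule finite_measure.integrable_const_bound[OF assms(1), where B = B]) (use assms in \<open>auto intro!: AE_I2\<close>)
qed (use assms in auto)

lemma test_functions_bound:
  assumes "f \<in> test_functions"
  obtains B where "0 \<le> B" "\<And>x. f x \<le> B"
proof -
  obtain B where "\<forall>x. \<bar>f x\<bar> \<le> B" using assms by (auto simp: test_functions_def bounded_iff)
  then have "f x \<le> \<bar>B\<bar>" for x
    by (meson abs_ge_self order_trans)
  then show ?thesis by (intro that[of "\<bar>B\<bar>"]) auto
qed

text \<open>Fixes one Gamma law \<open>G\<close> as a hypothesis. In the theorem it is always
  supplied by an assumption, since each identity speaks of a process that is a Gamma process or has
  a density with respect to one.\<close>

locale gamma_law =
  fixes H :: "'a::polish_space measure" and \<theta> :: real and G :: "'a measure measure"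
  assumes prob_H: "prob_space H" and sets_H [simp, measurable_cong]: "sets H = sets borel"
    and \<theta>: "0 < \<theta>" and law: "gamma_process_law (scale_measure (ennreal \<theta>) H) G"
begin

sublocale H: prob_space H by (rule prob_H)
sublocale G: prob_space G using law by (simp add: gamma_process_law_def)

lemma sets_G [simp, measurable_cong]: "sets G = sets bf_algebra"
  using law by (simp add: gamma_process_law_def)

lemma space_H [simp]: "space H = UNIV"
  using sets_eq_imp_space_eq[OF sets_H] by simp

lemma space_G [simp]: "space G = boundedly_finite"
  using sets_eq_imp_space_eq[OF sets_G] by simp

definition log_mean :: "('a \<Rightarrow> real) \<Rightarrow> real" where
  "log_mean f = (\<integral>x. ln (1 + f x) \<partial>H)"

lemma integrable_ln:
  assumes f: "f \<in> test_functions"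
  shows "integrable H (\<lambda>x. ln (1 + f x))"
proof -
  obtain B where B: "0 \<le> B" "\<And>x. f x \<le> B" using test_functions_bound[OF f] by auto
  note [measurable] = test_functionsD(1)[OF f]
  have "\<bar>ln (1 + f x)\<bar> \<le> ln (1 + B)" for x
    using B(1) B(2)[of x] test_functionsD(2)[OF f, of x] by simp
  then show ?thesis by (intro H.integrable_const_bound[of _ "ln (1 + B)"]) auto
qed

lemma Laplace_G:
  assumes f: "f \<in> test_functions"
  shows "(\<integral>\<^sup>+m. elap f m \<partial>G) = ennreal (exp (- (\<theta> * log_mean f)))"
proof -
  note [measurable] = test_functionsD(1)[OF f]
  have "(\<integral>m. exp_neg (\<integral>\<^sup>+x. ennreal (f x) \<partial>m) \<partial>G) = exp (- (\<integral>x. ln (1 + f x) \<partial>scale_measure (ennreal \<theta>) H))"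
    using law f by (auto simp: gamma_process_law_def test_functions_def)
  also have "(\<integral>x. ln (1 + f x) \<partial>scale_measure (ennreal \<theta>) H) = \<theta> * log_mean f"
    using \<theta> by (simp add: integral_scale_measure log_mean_def)
  finally show ?thesis
    by (subst nn_integral_bounded_eq_integral[where B = 1]) (auto simp: exp_neg_01 G.finite_measure_axioms)
qed

text \<open>Take logarithms in \<open>1 + s + f = (1 + s) * (1 + f / (1 + s))\<close>. The constant
  comes out unchanged because \<open>H\<close> has mass 1.\<close>

lemma log_mean_add_const:
  assumes f: "f \<in> test_functions" and s: "0 \<le> s"
  shows "log_mean (\<lambda>x. s + f x) = ln (1 + s) + log_mean (\<lambda>x. 1 / (1 + s) * f x)"
proof -
  have f': "(\<lambda>x. 1 / (1 + s) * f x) \<in> test_functions" using f s by (intro test_functions_cmult) auto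
  have "ln (1 + (s + f x)) = ln (1 + s) + ln (1 + 1 / (1 + s) * f x)" for x
    using s test_functionsD(2)[OF f, of x]
    by (subst ln_mult_pos[symmetric]) (auto simp: field_simps add_nonneg_pos add_pos_nonneg)
  then show ?thesis
    unfolding log_mean_def using integrable_ln[OF f'] by (simp add: H.prob_space[simplified])
qed

section \<open>Tilting, and independence of the mass and the normalized measure\<close>

text \<open>Multiplying by \<open>exp (- s T)\<close> replaces \<open>f\<close> by
  \<open>s + f\<close> in the Laplace functional. By \<open>log_mean_add_const\<close> this splits
  into the constant \<open>(1 + s) powr (- \<theta>)\<close>, which the density compensates, and the
  functional at \<open>f / (1 + s)\<close>, which is the one of the scaled process.\<close>

lemma tilt:
  assumes s: "0 \<le> s"
  shows "density G (\<lambda>m. ennreal ((1 + s) powr \<theta>) * elap (\<lambda>_. s) m) =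
    distr G bf_algebra (\<lambda>m. scale_measure (ennreal (1 / (1 + s))) m)" (is "?D = ?S")
proof (rule bf_measure_eqI_elap)
  have Lap: "(\<integral>\<^sup>+m. elap f m \<partial>?D) = ennreal (exp (- (\<theta> * log_mean (\<lambda>x. 1 / (1 + s) * f x))))"
    if f: "f \<in> test_functions" for f
  proof -
    note [measurable] = test_functionsD(1)[OF f]
    have "(\<integral>\<^sup>+m. elap f m \<partial>?D) = (\<integral>\<^sup>+m. ennreal ((1 + s) powr \<theta>) * elap (\<lambda>x. s + f x) m \<partial>G)"
      by (subst nn_integral_density)
         (auto intro!: nn_integral_cong simp: mult.assoc elap_add[OF _ test_functions_const[OF s] f]
           simp del: nn_integral_const)
    also have "\<dots> = ennreal ((1 + s) powr \<theta>) * ennreal (exp (- (\<theta> * log_mean (\<lambda>x. s + f x))))"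
      by (subst nn_integral_cmult) (auto simp: Laplace_G test_functions_add test_functions_const f s)
    also have "\<dots> = ennreal (exp (- (\<theta> * log_mean (\<lambda>x. 1 / (1 + s) * f x))))"
      using s by (simp add: ennreal_mult[symmetric] log_mean_add_const[OF f s] powr_def exp_add[symmetric] algebra_simps)
    finally show ?thesis .
  qed
  have Lap': "(\<integral>\<^sup>+m. elap f m \<partial>?S) = ennreal (exp (- (\<theta> * log_mean (\<lambda>x. 1 / (1 + s) * f x))))"
    if f: "f \<in> test_functions" for f
  proof -
    note [measurable] = test_functionsD(1)[OF f]
    have "(\<integral>\<^sup>+m. elap f m \<partial>?S) = (\<integral>\<^sup>+m. elap (\<lambda>x. 1 / (1 + s) * f x) m \<partial>G)"
    proof (subst nn_integral_distr)
      have "0 \<le> 1 / (1 + s)" using s by simp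
      from elap_scale_measure[OF _ f this]
      show "(\<integral>\<^sup>+m. elap f (scale_measure (ennreal (1 / (1 + s))) m) \<partial>G) = (\<integral>\<^sup>+m. elap (\<lambda>x. 1 / (1 + s) * f x) m \<partial>G)"
        by (intro nn_integral_cong) (simp only: space_G)
    qed measurable
    then show ?thesis
      using Laplace_G[OF test_functions_cmult[OF f, of "1 / (1 + s)"]] s by simp
  qed
  show "finite_measure ?D"
    using Lap[OF test_functions_const[of 0]] by (intro finite_measureI) simp
  show "finite_measure ?S"
    by (rule G.finite_measure_distr) measurable
  show "(\<integral>\<^sup>+m. elap f m \<partial>?D) = (\<integral>\<^sup>+m. elap f m \<partial>?S)" if "f \<in> test_functions" for f
    using Lap[OF that] Lap'[OF that] by simp
qed simp_all

text \<open>A scale-invariant \<open>F\<close> cannot see the scaling that the tilt produces. So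
  tilting leaves its expectation unchanged, and the expectation of \<open>exp (- s T) F\<close>
  factorizes.\<close>

lemma Laplace_mass_invariant:
  assumes s: "0 \<le> s" and F [measurable]: "F \<in> borel_measurable bf_algebra"
    and inv: "\<And>c m. 0 < c \<Longrightarrow> F (scale_measure (ennreal c) m) = F m"
  shows "(\<integral>\<^sup>+m. elap (\<lambda>_. s) m * F m \<partial>G) = ennreal ((1 + s) powr (- \<theta>)) * (\<integral>\<^sup>+m. F m \<partial>G)"
proof -
  have "(\<integral>\<^sup>+m. F m \<partial>G) = (\<integral>\<^sup>+m. F m \<partial>distr G bf_algebra (\<lambda>m. scale_measure (ennreal (1 / (1 + s))) m))"
    using s by (subst nn_integral_distr) (auto simp: inv)
  also have "\<dots> = (\<integral>\<^sup>+m. ennreal ((1 + s) powr \<theta>) * (elap (\<lambda>_. s) m * F m) \<partial>G)"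
    unfolding tilt[OF s, symmetric]
    by (subst nn_integral_density) (auto simp: mult.assoc simp del: nn_integral_const)
  also have "\<dots> = ennreal ((1 + s) powr \<theta>) * (\<integral>\<^sup>+m. elap (\<lambda>_. s) m * F m \<partial>G)"
    by (rule nn_integral_cmult) (simp del: nn_integral_const)
  finally have *: "(\<integral>\<^sup>+m. F m \<partial>G) = ennreal ((1 + s) powr \<theta>) * (\<integral>\<^sup>+m. elap (\<lambda>_. s) m * F m \<partial>G)" .
  show ?thesis
    unfolding * using s by (simp add: mult.assoc[symmetric] ennreal_mult[symmetric] powr_minus del: nn_integral_const)
qed

abbreviation gamma_meas :: "real measure" where
  "gamma_meas \<equiv> density lborel (\<lambda>t. ennreal (gamma_density \<theta> t))"

sublocale gamma: prob_space gamma_meas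
  by (rule prob_space_gamma_density[OF \<theta>])

text \<open>The absolute value changes nothing where the density is positive, and it keeps
  \<open>exp (- \<bar>t\<bar>)\<close> in the unit interval for every real \<open>t\<close>, as the
  moment lemma demands pointwise.\<close>

lemma gamma_meas_Laplace: "0 \<le> x \<Longrightarrow> (\<integral>\<^sup>+t. ennreal (exp (- (x * \<bar>t\<bar>))) \<partial>gamma_meas) = ennreal ((1 + x) powr (- \<theta>))"
  unfolding gamma_density_Laplace[OF \<theta>, symmetric]
  by (subst nn_integral_density) (auto intro!: nn_integral_cong simp: gamma_density_def)

text \<open>By Hausdorff's moment problem applied to \<open>exp (- T)\<close>.\<close>

lemma mass_indep_invariant:
  fixes R :: "'a measure \<Rightarrow> real"
  assumes R [measurable]: "R \<in> borel_measurable bf_algebra"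
    and inv: "\<And>c m. 0 < c \<Longrightarrow> R (scale_measure (ennreal c) m) = R m"
    and B [measurable]: "B \<in> sets borel" and \<psi> [measurable]: "\<psi> \<in> borel_measurable borel"
  shows "(\<integral>\<^sup>+m. \<psi> (exp_neg (emeasure m UNIV)) * indicator B (R m) \<partial>G) =
    (\<integral>\<^sup>+t. \<psi> (exp (- \<bar>t\<bar>)) \<partial>gamma_meas) * emeasure (distr G borel R) B"
proof -
  define c where "c = emeasure (distr G borel R) B"
  have "c = (\<integral>\<^sup>+m. indicator (R -` B \<inter> space G) m \<partial>G)"
    unfolding c_def by (subst emeasure_distr, simp, simp) (rule nn_integral_indicator[symmetric], measurable)
  also have "\<dots> = (\<integral>\<^sup>+m. indicator B (R m) \<partial>G)"
    by (intro nn_integral_cong) (auto simp: indicator_def)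
  finally have c: "c = (\<integral>\<^sup>+m. indicator B (R m) \<partial>G)" .
  have fin: "c < \<infinity>"
    unfolding c_def by (simp add: emeasure_distr G.emeasure_eq_measure)
  \<comment> \<open>\<open>D\<close> restricts \<open>G\<close> to the event that \<open>R\<close>
    lies in \<open>B\<close>, and \<open>E\<close> is the Gamma law times the probability of that
    event. The n-th moment of \<open>exp (- T)\<close> is the Laplace transform of \<open>T\<close>
    at \<open>s = n\<close>, so both have the moments
    \<open>(1 + n) powr (- \<theta>) * c\<close>.\<close>
  define D where "D = density G (\<lambda>m. indicator B (R m) :: ennreal)"
  define E where "E = scale_measure c gamma_meas"
  have [simp, measurable_cong]: "sets D = sets bf_algebra" "sets E = sets borel" by (simp_all add: D_def E_def)
  have [simp]: "space D = boundedly_finite" by (simp add: D_def)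
  have eq: "(\<integral>\<^sup>+m. ennreal (exp_neg (emeasure m UNIV) ^ n) \<partial>D) = (\<integral>\<^sup>+t. ennreal (exp (- \<bar>t\<bar>) ^ n) \<partial>E)" for n
  proof -
    have pow: "exp_neg t ^ n = exp_neg (ennreal (real n) * t)" for t
    proof (induction n)
      case (Suc n)
      have "ennreal (real (Suc n)) * t = t + ennreal (real n) * t"
        by (simp add: distrib_right ennreal_plus)
      then show ?case using Suc by (simp add: exp_neg_add)
    qed simp
    have "(\<integral>\<^sup>+m. ennreal (exp_neg (emeasure m UNIV) ^ n) \<partial>D) = (\<integral>\<^sup>+m. elap (\<lambda>_. real n) m * indicator B (R m) \<partial>G)"
      unfolding D_def pow
      by (subst nn_integral_density) (auto intro!: nn_integral_cong simp: mult.commute space_boundedly_finite)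
    also have "\<dots> = ennreal ((1 + real n) powr (- \<theta>)) * c"
      unfolding c by (rule Laplace_mass_invariant) (auto simp: inv)
    also have "\<dots> = (\<integral>\<^sup>+t. ennreal (exp (- \<bar>t\<bar>) ^ n) \<partial>E)"
      unfolding E_def
      by (simp add: nn_integral_scale_measure gamma_meas_Laplace[symmetric] exp_of_nat_mult[symmetric] mult.commute)
    finally show ?thesis .
  qed
  interpret E: finite_measure E
    using fin by (intro finite_measureI)
      (auto simp: E_def gamma.emeasure_space_1[simplified] space_scale_measure ennreal_mult_eq_top_iff)
  interpret D: finite_measure D
    using eq[of 0] by (intro finite_measureI) auto
  have "distr D borel (\<lambda>m. exp_neg (emeasure m UNIV)) = distr E borel (\<lambda>t. exp (- \<bar>t\<bar>))"
  proof (rule distr_eq_if_moments_eq)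
    fix n
    show "(\<integral>m. exp_neg (emeasure m UNIV) ^ n \<partial>D) = (\<integral>t. exp (- \<bar>t\<bar>) ^ n \<partial>E)"
      using eq[of n] by (subst (1 2) integral_eq_nn_integral) (auto simp: exp_neg_01)
  qed (auto simp: exp_neg_01 D.finite_measure_axioms E.finite_measure_axioms)
  then have "(\<integral>\<^sup>+x. \<psi> x \<partial>distr D borel (\<lambda>m. exp_neg (emeasure m UNIV))) = (\<integral>\<^sup>+x. \<psi> x \<partial>distr E borel (\<lambda>t. exp (- \<bar>t\<bar>)))"
    by simp
  then have "(\<integral>\<^sup>+m. \<psi> (exp_neg (emeasure m UNIV)) \<partial>D) = (\<integral>\<^sup>+t. \<psi> (exp (- \<bar>t\<bar>)) \<partial>E)"
    by (subst (asm) (1 2) nn_integral_distr) auto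
  then show ?thesis
    unfolding D_def E_def c_def[symmetric]
    by (subst (asm) nn_integral_density) (auto simp: nn_integral_scale_measure mult.commute)
qed

lemma AE_mass: "AE m in G. 0 < total_mass m"
proof -
  \<comment> \<open>The value 0 of \<open>exp (- T)\<close> corresponds to infinite mass and the
    value 1 to mass zero; both make \<open>total_mass\<close> vanish and both have to be
    excluded.\<close>
  define \<psi> where "\<psi> x = (indicator {0, 1} x :: ennreal)" for x :: real
  have \<psi>: "\<psi> \<in> borel_measurable borel" unfolding \<psi>_def by measurable
  have "(\<integral>\<^sup>+t. \<psi> (exp (- \<bar>t\<bar>)) \<partial>gamma_meas) = 0"
    by (subst nn_integral_density)
       (auto simp: \<psi>_def indicator_def gamma_density_def intro!: nn_integral_zero')
  then have "(\<integral>\<^sup>+m. \<psi> (exp_neg (emeasure m UNIV)) \<partial>G) = 0"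
    using mass_indep_invariant[of "\<lambda>_. 0" UNIV \<psi>] \<psi> by simp
  then have "AE m in G. \<psi> (exp_neg (emeasure m UNIV)) = 0"
    by (subst (asm) nn_integral_0_iff_AE) (auto simp: \<psi>_def)
  with AE_space show ?thesis
  proof eventually_elim
    case (elim m)
    then have "0 < exp_neg (emeasure m UNIV)" "exp_neg (emeasure m UNIV) < 1"
      using exp_neg_01[of "emeasure m UNIV"] by (auto simp: \<psi>_def indicator_def less_le split: if_splits)
    with elim show ?case by (simp add: total_mass_eq_ln space_boundedly_finite)
  qed
qed

text \<open>Rectangles determine the joint law. On them, independence from \<open>exp (- T)\<close>
  becomes independence from \<open>T\<close>, which is recovered from it by
  \<open>- ln\<close>.\<close>

lemma mass_indep:
  fixes R :: "'a measure \<Rightarrow> real"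
  assumes R [measurable]: "R \<in> borel_measurable bf_algebra"
    and inv: "\<And>c m. 0 < c \<Longrightarrow> R (scale_measure (ennreal c) m) = R m"
  shows "distr G (borel \<Otimes>\<^sub>M borel) (\<lambda>m. (total_mass m, R m)) = gamma_meas \<Otimes>\<^sub>M distr G borel R"
proof (rule pair_measure_eqI[symmetric])
  show "sigma_finite_measure gamma_meas" by unfold_locales
  show "sigma_finite_measure (distr G borel R)"
    by (intro finite_measure.axioms(1) G.finite_measure_distr) measurable
  fix A B assume "A \<in> sets gamma_meas" and "B \<in> sets (distr G borel R)"
  then have [measurable]: "A \<in> sets borel" "B \<in> sets borel" by simp_all
  have "emeasure (distr G (borel \<Otimes>\<^sub>M borel) (\<lambda>m. (total_mass m, R m))) (A \<times> B) =
      (\<integral>\<^sup>+m. indicator A (total_mass m) * indicator B (R m) \<partial>G)"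
    by (subst nn_integral_indicator[symmetric], simp, subst nn_integral_distr)
       (auto intro!: nn_integral_cong simp: indicator_times)
  also have "\<dots> = (\<integral>\<^sup>+m. indicator A (- ln (exp_neg (emeasure m UNIV))) * indicator B (R m) \<partial>G)"
    by (intro nn_integral_cong) (simp add: total_mass_eq_ln space_boundedly_finite)
  also have "\<dots> = (\<integral>\<^sup>+t. indicator A (- ln (exp (- \<bar>t\<bar>))) \<partial>gamma_meas) * emeasure (distr G borel R) B"
    using mass_indep_invariant[OF R inv, of B "\<lambda>x. indicator A (- ln x)"] by simp
  also have "(\<integral>\<^sup>+t. indicator A (- ln (exp (- \<bar>t\<bar>))) \<partial>gamma_meas) = (\<integral>\<^sup>+t. indicator A t \<partial>gamma_meas)"
    by (subst (1 2) nn_integral_density) (auto intro!: nn_integral_cong simp: gamma_density_def)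
  finally show "emeasure gamma_meas A * emeasure (distr G borel R) B =
      emeasure (distr G (borel \<Otimes>\<^sub>M borel) (\<lambda>m. (total_mass m, R m))) (A \<times> B)"
    by simp
qed (simp cong: sets_pair_measure_cong)

lemma nn_integral_mass_indep:
  fixes R :: "'a measure \<Rightarrow> real"
  assumes R [measurable]: "R \<in> borel_measurable bf_algebra"
    and inv: "\<And>c m. 0 < c \<Longrightarrow> R (scale_measure (ennreal c) m) = R m"
    and \<psi> [measurable]: "case_prod \<psi> \<in> borel_measurable (borel \<Otimes>\<^sub>M borel)"
  shows "(\<integral>\<^sup>+m. \<psi> (total_mass m) (R m) \<partial>G) =
    (\<integral>\<^sup>+m. (\<integral>\<^sup>+t. ennreal (gamma_density \<theta> t) * \<psi> t (R m) \<partial>lborel) \<partial>G)"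
proof -
  interpret R: prob_space "distr G borel R" by (rule G.prob_space_distr) simp
  interpret pair_sigma_finite gamma_meas "distr G borel R" by unfold_locales
  have "(\<integral>\<^sup>+m. \<psi> (total_mass m) (R m) \<partial>G) =
      (\<integral>\<^sup>+z. case_prod \<psi> z \<partial>distr G (borel \<Otimes>\<^sub>M borel) (\<lambda>m. (total_mass m, R m)))"
    by (subst nn_integral_distr) auto
  also have "\<dots> = (\<integral>\<^sup>+x. (\<integral>\<^sup>+t. \<psi> t x \<partial>gamma_meas) \<partial>distr G borel R)"
    by (subst mass_indep[OF R], rule inv, assumption) (subst nn_integral_snd[symmetric], auto)
  also have "\<dots> = (\<integral>\<^sup>+m. (\<integral>\<^sup>+t. \<psi> t (R m) \<partial>gamma_meas) \<partial>G)"
    by (subst nn_integral_distr) auto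
  also have "\<dots> = (\<integral>\<^sup>+m. (\<integral>\<^sup>+t. ennreal (gamma_density \<theta> t) * \<psi> t (R m) \<partial>lborel) \<partial>G)"
    by (intro nn_integral_cong nn_integral_density) auto
  finally show ?thesis .
qed

section \<open>The transform to which all laws are reduced\<close>

text \<open>The generalized Stieltjes transform of order \<open>a\<close> of the random mean
  \<open>P f\<close>. Every Laplace functional in the theorem is expressed through it.\<close>

definition \<Phi> :: "real \<Rightarrow> ('a \<Rightarrow> real) \<Rightarrow> ennreal" where
  "\<Phi> a f = (\<integral>\<^sup>+m. ennreal ((1 + mean f m) powr (- a)) \<partial>G)"

text \<open>The factor \<open>T powr (q - \<theta>)\<close> with its constant turns the Gamma
  density of shape \<open>\<theta>\<close> into that of shape \<open>q\<close> and leaves the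
  independent \<open>P\<close> alone. Integrating \<open>exp (- T P f)\<close> over the new
  \<open>T\<close> gives \<open>(1 + P f) powr (- q)\<close>.\<close>

lemma nn_integral_elap_powr:
  assumes f: "f \<in> test_functions" and q: "0 < q"
  shows "(\<integral>\<^sup>+m. ennreal (Gamma \<theta> / Gamma q * total_mass m powr (q - \<theta>)) * elap f m \<partial>G) = \<Phi> q f"
proof -
  note [measurable] = test_functionsD(1)[OF f]
  let ?\<psi> = "\<lambda>t x. ennreal (Gamma \<theta> / Gamma q * t powr (q - \<theta>)) * ennreal (exp (- (x * t)))"
  have gpos: "Gamma \<theta> \<noteq> 0" "Gamma q \<noteq> 0" "0 < Gamma \<theta>" "0 < Gamma q"
    using Gamma_real_pos[OF \<theta>] Gamma_real_pos[OF q] by auto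
  have "(\<integral>\<^sup>+m. ennreal (Gamma \<theta> / Gamma q * total_mass m powr (q - \<theta>)) * elap f m \<partial>G) =
      (\<integral>\<^sup>+m. ?\<psi> (total_mass m) (mean f m) \<partial>G)"
  proof (intro nn_integral_cong_AE)
    from AE_mass AE_space show "AE m in G. ennreal (Gamma \<theta> / Gamma q * total_mass m powr (q - \<theta>)) * elap f m =
      ?\<psi> (total_mass m) (mean f m)"
    proof eventually_elim
      case (elim m)
      then have "elap f m = ennreal (exp (- (mean f m * total_mass m)))"
        using mean_nonneg[of f m] by (subst nn_integral_eq_mass_mean) (simp_all add: f mult.commute)
      then show ?case by simp
    qed
  qed
  also have "\<dots> = (\<integral>\<^sup>+m. (\<integral>\<^sup>+t. ennreal (gamma_density \<theta> t) * ?\<psi> t (mean f m) \<partial>lborel) \<partial>G)"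
    by (rule nn_integral_mass_indep) (auto simp: mean_scale_measure)
  also have "\<dots> = \<Phi> q f"
    unfolding \<Phi>_def
  proof (intro nn_integral_cong)
    fix m
    have "ennreal (gamma_density \<theta> t) * ?\<psi> t (mean f m) = ennreal (gamma_density q t) * ennreal (exp (- (mean f m * t)))" for t
    proof (cases "0 < t")
      case True
      have "t powr (\<theta> - 1) * t powr (q - \<theta>) = t powr (q - 1)"
        by (simp add: powr_add[symmetric])
      then have "gamma_density \<theta> t * (Gamma \<theta> / Gamma q * t powr (q - \<theta>)) = gamma_density q t"
        using True gpos by (simp add: gamma_density_def field_simps)
      then have "ennreal (gamma_density \<theta> t) * ennreal (Gamma \<theta> / Gamma q * t powr (q - \<theta>)) = ennreal (gamma_density q t)"
        by (metis ennreal_mult' gamma_density_nonneg \<theta>)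
      then show ?thesis
        by (simp only: mult.assoc[symmetric])
    qed (simp add: gamma_density_def)
    then show "(\<integral>\<^sup>+t. ennreal (gamma_density \<theta> t) * ?\<psi> t (mean f m) \<partial>lborel) = ennreal ((1 + mean f m) powr (- q))"
      using gamma_density_Laplace[OF q mean_nonneg[of f m]] by simp
  qed
  finally show ?thesis .
qed

text \<open>At \<open>q = \<theta>\<close> the density is 1 wherever \<open>T\<close> is positive.
  Since \<open>0 powr 0 = 0\<close>, this is an almost sure statement.\<close>

lemma \<Phi>_theta:
  assumes f: "f \<in> test_functions"
  shows "\<Phi> \<theta> f = ennreal (exp (- (\<theta> * log_mean f)))"
proof -
  have "\<Phi> \<theta> f = (\<integral>\<^sup>+m. ennreal (Gamma \<theta> / Gamma \<theta> * total_mass m powr (\<theta> - \<theta>)) * elap f m \<partial>G)"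
    using nn_integral_elap_powr[OF f \<theta>] by simp
  also have "\<dots> = (\<integral>\<^sup>+m. elap f m \<partial>G)"
    using AE_mass Gamma_real_pos[OF \<theta>] by (intro nn_integral_cong_AE) auto
  finally show ?thesis using Laplace_G[OF f] by simp
qed

end

text \<open>The definitions of Beta-Gamma and Dirichlet laws hide the underlying Gamma law behind an
  existential quantifier. Uniqueness identifies it with the fixed \<open>G\<close>.\<close>

lemma gamma_process_law_unique:
  assumes "gamma_law H \<theta> G" "gamma_law H \<theta> G'"
  shows "G = G'"
proof -
  interpret G: gamma_law H \<theta> G by fact
  interpret G': gamma_law H \<theta> G' by fact
  show ?thesis
    by (rule bf_measure_eqI_elap)
       (auto simp: G.Laplace_G G'.Laplace_G G.G.finite_measure_axioms G'.G.finite_measure_axioms)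
qed

lemma (in gamma_law) beta_gamma_Laplace:
  assumes B: "beta_gamma_law \<theta> H (\<theta> - q) B" and q: "0 < q" and f: "f \<in> test_functions"
  shows "(\<integral>\<^sup>+m. elap f m \<partial>B) = \<Phi> q f"
proof -
  obtain G' where law': "gamma_process_law (scale_measure (ennreal \<theta>) H) G'"
    and B_eq: "B = density G' (\<lambda>m. ennreal (Gamma \<theta> / Gamma (\<theta> - (\<theta> - q)) * total_mass m powr (- (\<theta> - q))))"
    using B unfolding beta_gamma_law_def by auto
  have "G' = G"
    by (rule gamma_process_law_unique[where H = H and \<theta> = \<theta>])
       (use law' prob_H \<theta> gamma_law_axioms in \<open>auto simp: gamma_law_def\<close>)
  note [measurable] = test_functionsD(1)[OF f]
  have "(\<integral>\<^sup>+m. elap f m \<partial>B) = (\<integral>\<^sup>+m. ennreal (Gamma \<theta> / Gamma q * total_mass m powr (q - \<theta>)) * elap f m \<partial>G)"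
    unfolding B_eq \<open>G' = G\<close> by (subst nn_integral_density) auto
  then show ?thesis using nn_integral_elap_powr[OF f q] by simp
qed

section \<open>The Blackwell--MacQueen distribution\<close>

abbreviation seq_space :: "nat \<Rightarrow> (nat \<Rightarrow> 'a::topological_space) measure" where
  "seq_space n \<equiv> Pi\<^sub>M {1..n} (\<lambda>_. borel)"

lemma measurable_seq_space_update [measurable]:
  "(\<lambda>(y, x). y(Suc n := x)) \<in> measurable (seq_space n \<Otimes>\<^sub>M borel) (seq_space (Suc n))"
  using measurable_add_dim[of "Suc n" "{1..n}" "\<lambda>_. borel"] by (simp add: atLeastAtMostSuc_conv)

lemma seq_space_update: "y \<in> space (seq_space n) \<Longrightarrow> y(Suc n := x) \<in> space (seq_space (Suc n))"
  by (auto simp: space_PiM PiE_iff extensional_def)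

locale urn = finite_measure \<alpha> for \<alpha> :: "'a::polish_space measure" +
  assumes sets_\<alpha> [simp, measurable_cong]: "sets \<alpha> = sets borel"
begin

lemma space_\<alpha> [simp]: "space \<alpha> = UNIV"
  using sets_eq_imp_space_eq[OF sets_\<alpha>] by simp

text \<open>The innermost integration of \<open>urn_integral\<close> with the point masses split
  off. The inductions on \<open>n\<close> below peel off one such step at a time.\<close>

definition step :: "nat \<Rightarrow> ((nat \<Rightarrow> 'a) \<Rightarrow> ennreal) \<Rightarrow> (nat \<Rightarrow> 'a) \<Rightarrow> ennreal" where
  "step n g y = (\<integral>\<^sup>+x. g (y(Suc n := x)) \<partial>\<alpha>) + (\<Sum>j\<in>{1..n}. g (y(Suc n := y j)))"

lemma measurable_section:
  assumes [measurable]: "g \<in> borel_measurable (seq_space (Suc n))" and y: "y \<in> space (seq_space n)"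
  shows "(\<lambda>x. g (y(Suc n := x))) \<in> borel_measurable \<alpha>"
proof -
  have "(\<lambda>x. g (case (y, x) of (y, x) \<Rightarrow> y(Suc n := x))) \<in> borel_measurable \<alpha>"
    unfolding measurable_cong_sets[OF sets_\<alpha> refl] by (rule measurable_compose[OF _ assms(1)], rule measurable_compose[OF measurable_Pair1'[OF y]], rule measurable_seq_space_update)
  then show ?thesis by simp
qed

lemma measurable_step [measurable]:
  assumes [measurable]: "g \<in> borel_measurable (seq_space (Suc n))"
  shows "step n g \<in> borel_measurable (seq_space n)"
proof -
  have 1: "(\<lambda>z. g ((fst z)(Suc n := snd z))) \<in> borel_measurable (seq_space n \<Otimes>\<^sub>M borel)"
    using measurable_compose[OF measurable_seq_space_update[of n] assms] by (simp add: case_prod_beta)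
  then have [measurable]: "(\<lambda>(y, x). g (y(Suc n := x))) \<in> borel_measurable (seq_space n \<Otimes>\<^sub>M \<alpha>)"
    by (simp add: case_prod_beta cong: measurable_cong_sets sets_pair_measure_cong)
  have "(\<lambda>y. g (y(Suc n := y j))) \<in> borel_measurable (seq_space n)" if "j \<in> {1..n}" for j
    using measurable_compose[of "\<lambda>y. (y, y j)", OF _ 1] that
    by (simp add: measurable_component_singleton measurable_Pair)
  then show ?thesis unfolding step_def by measurable
qed

lemma urn_integral_cong:
  "(\<And>y. y \<in> space (seq_space n) \<Longrightarrow> g y = h y) \<Longrightarrow> urn_integral \<alpha> n g = urn_integral \<alpha> n h"
proof (induction n arbitrary: g h)
  case 0
  then show ?case by (simp add: space_PiM)
next
  case (Suc n)
  show ?case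
    unfolding urn_integral.simps
    by (intro Suc.IH nn_integral_cong Suc.prems seq_space_update)
qed

lemma urn_integral_step:
  assumes g: "g \<in> borel_measurable (seq_space (Suc n))"
  shows "urn_integral \<alpha> (Suc n) g = urn_integral \<alpha> n (step n g)"
  unfolding urn_integral.simps
proof (rule urn_integral_cong)
  fix y :: "nat \<Rightarrow> 'a" assume y: "y \<in> space (seq_space n)"
  show "(\<integral>\<^sup>+x. g (y(Suc n := x)) \<partial>add_atoms \<alpha> {1..n} (\<lambda>_. 1) y) = step n g y"
    by (subst nn_integral_add_atoms[OF _ measurable_section[OF g y]]) (simp_all add: step_def)
qed

lemma urn_integral_cmult:
  "g \<in> borel_measurable (seq_space n) \<Longrightarrow> urn_integral \<alpha> n (\<lambda>y. c * g y) = c * urn_integral \<alpha> n g"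
proof (induction n arbitrary: g)
  case (Suc n)
  note g = Suc.prems
  have m: "(\<lambda>y. c * g y) \<in> borel_measurable (seq_space (Suc n))" using g by simp
  have "step n (\<lambda>y. c * g y) y = c * step n g y" if "y \<in> space (seq_space n)" for y
    unfolding step_def nn_integral_cmult[OF measurable_section[OF g that]]
    by (simp add: distrib_left sum_distrib_left)
  then have "urn_integral \<alpha> n (step n (\<lambda>y. c * g y)) = urn_integral \<alpha> n (\<lambda>y. c * step n g y)"
    by (rule urn_integral_cong)
  also have "\<dots> = c * urn_integral \<alpha> n (step n g)"
    by (rule Suc.IH[OF measurable_step[OF g]])
  finally show ?case unfolding urn_integral_step[OF g] urn_integral_step[OF m] .
qed simp

lemma urn_integral_suminf:
  "(\<And>i. g i \<in> borel_measurable (seq_space n)) \<Longrightarrow>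
    urn_integral \<alpha> n (\<lambda>y. \<Sum>i. g i y) = (\<Sum>i. urn_integral \<alpha> n (g i))"
proof (induction n arbitrary: g)
  case (Suc n)
  note g = Suc.prems
  note [measurable] = g
  have sum_meas: "(\<lambda>y. \<Sum>i. g i y) \<in> borel_measurable (seq_space (Suc n))" by measurable
  have "step n (\<lambda>y. \<Sum>i. g i y) y = (\<Sum>i. step n (g i) y)" if "y \<in> space (seq_space n)" for y
  proof -
    have "(\<integral>\<^sup>+x. (\<Sum>i. g i (y(Suc n := x))) \<partial>\<alpha>) = (\<Sum>i. \<integral>\<^sup>+x. g i (y(Suc n := x)) \<partial>\<alpha>)"
      by (rule nn_integral_suminf[OF measurable_section[OF g that]])
    moreover have "(\<Sum>j\<in>{1..n}. \<Sum>i. g i (y(Suc n := y j))) = (\<Sum>i. \<Sum>j\<in>{1..n}. g i (y(Suc n := y j)))"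
      by (rule suminf_sum[symmetric]) auto
    ultimately show ?thesis unfolding step_def by (simp add: suminf_add[symmetric])
  qed
  then have "urn_integral \<alpha> n (step n (\<lambda>y. \<Sum>i. g i y)) = urn_integral \<alpha> n (\<lambda>y. \<Sum>i. step n (g i) y)"
    by (rule urn_integral_cong)
  also have "\<dots> = (\<Sum>i. urn_integral \<alpha> n (step n (g i)))"
    by (rule Suc.IH) measurable
  finally show ?case unfolding urn_integral_step[OF g] urn_integral_step[OF sum_meas] .
qed simp

lemma urn_integral_add:
  assumes g: "g \<in> borel_measurable (seq_space n)" and h: "h \<in> borel_measurable (seq_space n)"
  shows "urn_integral \<alpha> n (\<lambda>y. g y + h y) = urn_integral \<alpha> n g + urn_integral \<alpha> n h"
proof -
  \<comment> \<open>Finite additivity is read off from countable additivity for the sequence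
    \<open>g, h, 0, 0, ...\<close>.\<close>
  let ?u = "\<lambda>i::nat. if i = 0 then g else if i = 1 then h else (\<lambda>_. 0)"
  have sum: "(\<Sum>i. f i) = f 0 + f 1" if "\<And>i. i \<notin> {0, 1} \<Longrightarrow> f i = 0" for f :: "nat \<Rightarrow> ennreal"
    using that suminf_finite[of "{0, 1}" f] by auto
  have zero: "urn_integral \<alpha> n (\<lambda>_. 0) = 0"
    using urn_integral_cmult[of "\<lambda>_. 0" n 0] by simp
  have "urn_integral \<alpha> n (\<lambda>y. \<Sum>i. ?u i y) = (\<Sum>i. urn_integral \<alpha> n (?u i))"
    by (rule urn_integral_suminf) (use g h in auto)
  also have "(\<lambda>y. \<Sum>i. ?u i y) = (\<lambda>y. g y + h y)"
    by (rule ext, subst sum) auto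
  also have "(\<Sum>i. urn_integral \<alpha> n (?u i)) = urn_integral \<alpha> n g + urn_integral \<alpha> n h"
    by (subst sum) (auto simp: zero)
  finally show ?thesis .
qed

lemma urn_integral_SUP:
  fixes U :: "nat \<Rightarrow> (nat \<Rightarrow> 'a) \<Rightarrow> ennreal"
  shows "(\<And>i. U i \<in> borel_measurable (seq_space n)) \<Longrightarrow> incseq U \<Longrightarrow>
    urn_integral \<alpha> n (\<lambda>y. SUP i. U i y) = (SUP i. urn_integral \<alpha> n (U i))"
proof (induction n arbitrary: U)
  case (Suc n)
  note U = Suc.prems
  note [measurable] = U(1)
  have SUP_meas: "(\<lambda>y. SUP i. U i y) \<in> borel_measurable (seq_space (Suc n))" by measurable
  have inc: "incseq (\<lambda>i. U i y)" for y using incseqD[OF U(2), THEN le_funD] by (simp add: incseq_def)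
  have "step n (\<lambda>y. SUP i. U i y) y = (SUP i. step n (U i) y)" if "y \<in> space (seq_space n)" for y
  proof -
    have "(\<integral>\<^sup>+x. (SUP i. U i (y(Suc n := x))) \<partial>\<alpha>) = (SUP i. \<integral>\<^sup>+x. U i (y(Suc n := x)) \<partial>\<alpha>)"
      by (rule nn_integral_monotone_convergence_SUP[OF _ measurable_section[OF U(1) that]])
         (use inc in \<open>auto simp: incseq_def le_fun_def\<close>)
    moreover have "(\<Sum>j\<in>{1..n}. SUP i. U i (y(Suc n := y j))) = (SUP i. \<Sum>j\<in>{1..n}. U i (y(Suc n := y j)))"
      by (rule ennreal_SUP_sum[symmetric]) (rule inc)
    ultimately show ?thesis
      unfolding step_def
      using inc by (simp add: ennreal_SUP_add incseq_def sum_mono nn_integral_mono)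
  qed
  then have "urn_integral \<alpha> n (step n (\<lambda>y. SUP i. U i y)) = urn_integral \<alpha> n (\<lambda>y. SUP i. step n (U i) y)"
    by (rule urn_integral_cong)
  also have "\<dots> = (SUP i. urn_integral \<alpha> n (step n (U i)))"
  proof (rule Suc.IH)
    show "step n (U i) \<in> borel_measurable (seq_space n)" for i
      by (rule measurable_step[OF U(1)])
    show "incseq (\<lambda>i. step n (U i))"
      unfolding step_def by (intro monoI le_funI add_mono nn_integral_mono sum_mono incseqD[OF inc])
  qed
  finally show ?case unfolding urn_integral_step[OF U(1)] urn_integral_step[OF SUP_meas] .
qed (simp add: incseq_def)

end

lemma urn_scale_measure:
  assumes "prob_space H" "sets H = sets borel"
  shows "urn (scale_measure (ennreal \<theta>) H)"
proof -
  interpret prob_space H by fact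
  show ?thesis
    by (intro urn.intro finite_measureI urn_axioms.intro)
       (auto simp: emeasure_space_1 space_scale_measure assms)
qed

lemma sets_blackwell_macqueen [simp, measurable_cong]: "sets (blackwell_macqueen \<theta> H n) = sets (seq_space n)"
  by (simp add: blackwell_macqueen_def sets.sets_measure_of_eq)

lemma space_blackwell_macqueen [simp]: "space (blackwell_macqueen \<theta> H n) = space (seq_space n)"
  by (simp add: blackwell_macqueen_def sets.space_measure_of_eq)

text \<open>Countable additivity of the iterated integral on indicators shows first that the set
  function in the definition really is the measure. Linearity and monotone continuity then extend
  the formula from sets to functions.\<close>

lemma nn_integral_blackwell_macqueen:
  assumes H: "prob_space H" "sets H = sets borel"
    and g: "g \<in> borel_measurable (seq_space n)"
  shows "(\<integral>\<^sup>+y. g y \<partial>blackwell_macqueen \<theta> H n) =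
    ennreal (Gamma \<theta> / Gamma (\<theta> + real n)) * urn_integral (scale_measure (ennreal \<theta>) H) n g"
proof -
  let ?\<alpha> = "scale_measure (ennreal \<theta>) H" and ?c = "ennreal (Gamma \<theta> / Gamma (\<theta> + real n))"
  interpret urn ?\<alpha> by (rule urn_scale_measure[OF H])
  have emeasure: "emeasure (blackwell_macqueen \<theta> H n) A = ?c * urn_integral ?\<alpha> n (indicator A)"
    if "A \<in> sets (seq_space n)" for A
  proof (rule emeasure_measure_of[OF blackwell_macqueen_def])
    show "A \<in> sets (blackwell_macqueen \<theta> H n)" using that by simp
    have [simp]: "indicator {} = (\<lambda>_. 0 :: ennreal)" by (simp add: fun_eq_iff)
    show "positive (sets (blackwell_macqueen \<theta> H n)) (\<lambda>A. ?c * urn_integral ?\<alpha> n (indicator A))"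
      using urn_integral_cmult[of "\<lambda>_. 0" n 0] by (simp add: positive_def)
    show "countably_additive (sets (blackwell_macqueen \<theta> H n)) (\<lambda>A. ?c * urn_integral ?\<alpha> n (indicator A))"
    proof (rule countably_additiveI)
      fix A :: "nat \<Rightarrow> _" assume A: "range A \<subseteq> sets (blackwell_macqueen \<theta> H n)" "disjoint_family A"
      have "(\<lambda>y. \<Sum>i. indicator (A i) y) = (indicator (\<Union>i. A i) :: _ \<Rightarrow> ennreal)"
        by (rule ext) (rule suminf_indicator[OF A(2)])
      then have "urn_integral ?\<alpha> n (indicator (\<Union>i. A i)) = (\<Sum>i. urn_integral ?\<alpha> n (indicator (A i)))"
        using A by (subst urn_integral_suminf[symmetric]) (auto intro!: borel_measurable_indicator)
      then show "(\<Sum>i. ?c * urn_integral ?\<alpha> n (indicator (A i))) = ?c * urn_integral ?\<alpha> n (indicator (\<Union>i. A i))"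
        by (simp add: ennreal_suminf_cmult)
    qed
  qed (rule sets.space_closed)
  have m: "borel_measurable (blackwell_macqueen \<theta> H n) = borel_measurable (seq_space n)"
    by (rule measurable_cong_sets) simp_all
  have "?c * urn_integral ?\<alpha> n g = (\<integral>\<^sup>+y. g y \<partial>blackwell_macqueen \<theta> H n)"
  proof (rule nn_integral_eqI_functional[where \<Phi> = "\<lambda>g. ?c * urn_integral ?\<alpha> n g"], unfold m sets_blackwell_macqueen space_blackwell_macqueen)
    show "?c * urn_integral ?\<alpha> n g = ?c * urn_integral ?\<alpha> n h"
      if "\<And>x. x \<in> space (seq_space n) \<Longrightarrow> g x = h x" for g h
      using urn_integral_cong[OF that] by simp
    show "?c * urn_integral ?\<alpha> n (\<lambda>x. c * g x) = c * (?c * urn_integral ?\<alpha> n g)"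
      if "g \<in> borel_measurable (seq_space n)" for g c
      using urn_integral_cmult[OF that] by (simp only: mult.left_commute)
    show "?c * urn_integral ?\<alpha> n (\<lambda>x. g x + h x) = ?c * urn_integral ?\<alpha> n g + ?c * urn_integral ?\<alpha> n h"
      if "g \<in> borel_measurable (seq_space n)" "h \<in> borel_measurable (seq_space n)" for g h
      using urn_integral_add[OF that] by (simp only: distrib_left)
    show "?c * urn_integral ?\<alpha> n (\<lambda>x. SUP i. U i x) = (SUP i. ?c * urn_integral ?\<alpha> n (U i))"
      if "\<And>i. U i \<in> borel_measurable (seq_space n)" "incseq U" for U
      using urn_integral_SUP[OF that] by (simp only: SUP_mult_left_ennreal)
  qed (use g emeasure in auto)
  then show ?thesis by simp
qed

section \<open>Differentiation under the integral and the urn identity\<close>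

text \<open>The mean value inequality bounds the difference quotients by \<open>C\<close>, so
  dominated convergence applies along every sequence tending to 0. The derivative is one-sided
  because the integrands are controlled for \<open>s\<close> in the half line only.\<close>

lemma has_derivative_integral_bounded:
  fixes k k' :: "real \<Rightarrow> 'b \<Rightarrow> real"
  assumes "finite_measure M"
    and int: "\<And>s. 0 \<le> s \<Longrightarrow> integrable M (k s)" and [measurable]: "k' 0 \<in> borel_measurable M"
    and deriv: "\<And>s x. 0 \<le> s \<Longrightarrow> x \<in> space M \<Longrightarrow> ((\<lambda>s. k s x) has_real_derivative k' s x) (at s within {0..})"
    and bound: "\<And>s x. 0 \<le> s \<Longrightarrow> x \<in> space M \<Longrightarrow> \<bar>k' s x\<bar> \<le> C"
  shows "((\<lambda>s. \<integral>x. k s x \<partial>M) has_real_derivative (\<integral>x. k' 0 x \<partial>M)) (at 0 within {0..})"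
  unfolding has_field_derivative_iff tendsto_at_iff_sequentially
proof (intro allI impI)
  interpret finite_measure M by fact
  fix X :: "nat \<Rightarrow> real" assume X: "\<forall>i. X i \<in> {0..} - {0}" "X \<longlonglongrightarrow> 0"
  then have X0: "0 < X i" for i by (simp add: less_le)
  have [measurable]: "k s \<in> borel_measurable M" if "0 \<le> s" for s
    using int[OF that] by simp
  note [measurable] = this[OF less_imp_le[OF X0]] this[of 0, simplified]
  have "(\<lambda>i. \<integral>x. (k (X i) x - k 0 x) / (X i - 0) \<partial>M) \<longlonglongrightarrow> (\<integral>x. k' 0 x \<partial>M)"
  proof (rule integral_dominated_convergence[where w = "\<lambda>_. C"])
    show "AE x in M. (\<lambda>i. (k (X i) x - k 0 x) / (X i - 0)) \<longlonglongrightarrow> k' 0 x"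
      using deriv[of 0] X unfolding has_field_derivative_iff tendsto_at_iff_sequentially
      by (intro AE_I2) (auto simp: o_def)
    show "AE x in M. norm ((k (X i) x - k 0 x) / (X i - 0)) \<le> C" for i
    proof (rule AE_I2)
      fix x assume x: "x \<in> space M"
      have "norm (k (X i) x - k 0 x) \<le> C * norm (X i - 0)"
        using X0[of i] deriv[OF _ x] bound[OF _ x]
        by (intro field_differentiable_bound[where S = "{0..}" and f' = "\<lambda>s. k' s x"]) (auto simp: less_imp_le)
      then show "norm ((k (X i) x - k 0 x) / (X i - 0)) \<le> C"
        using X0[of i] by (simp add: divide_simps)
    qed
  qed auto
  moreover have eq: "(\<integral>x. (k (X i) x - k 0 x) / (X i - 0) \<partial>M) = ((\<integral>x. k (X i) x \<partial>M) - (\<integral>x. k 0 x \<partial>M)) / (X i - 0)" for i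
    using int[of 0] int[OF less_imp_le[OF X0[of i]]] by simp
  ultimately show "((\<lambda>y. ((\<integral>x. k y x \<partial>M) - (\<integral>x. k 0 x \<partial>M)) / (y - 0)) \<circ> X) \<longlonglongrightarrow> (\<integral>x. k' 0 x \<partial>M)"
    unfolding eq by (simp add: o_def)
qed

lemma powr_neg_le_1: "1 \<le> (x::real) \<Longrightarrow> 0 \<le> b \<Longrightarrow> x powr (- b) \<le> 1"
  by (simp add: powr_minus inverse_le_1_iff ge_one_powr_ge_zero)

context gamma_law
begin

abbreviation BM :: "nat \<Rightarrow> (nat \<Rightarrow> 'a) measure" where
  "BM n \<equiv> blackwell_macqueen \<theta> H n"

text \<open>The Laplace functional at \<open>f\<close> of the random measure that puts independent
  standard exponential masses on the urn draws \<open>Y_1\<close>, ..., \<open>Y_n\<close>.\<close>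

definition urn_Laplace :: "nat \<Rightarrow> ('a \<Rightarrow> real) \<Rightarrow> ennreal" where
  "urn_Laplace n f = (\<integral>\<^sup>+y. ennreal (\<Prod>i\<in>{1..n}. 1 / (1 + f (y i))) \<partial>BM n)"

lemma measurable_urn_coordinate:
  assumes "f \<in> borel_measurable borel" "i \<in> {1..n}"
  shows "(\<lambda>y. f (y i)) \<in> borel_measurable (BM n)"
  unfolding measurable_cong_sets[OF sets_blackwell_macqueen refl]
  using measurable_compose[OF measurable_component_singleton[OF assms(2)] assms(1)] .

text \<open>Integrating out the last draw against \<open>\<theta> H\<close> plus the point masses at
  the earlier draws yields the weight in front of the product. The constant comes from \<open>Gamma
  (\<theta> + n + 1) = (\<theta> + n) * Gamma (\<theta> + n)\<close>.\<close>

lemma urn_Laplace_Suc: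
  assumes f: "f \<in> test_functions"
  shows "urn_Laplace (Suc n) f = ennreal (1 / (\<theta> + real n)) *
    (\<integral>\<^sup>+y. ennreal ((\<theta> * (\<integral>x. 1 / (1 + f x) \<partial>H) + (\<Sum>j\<in>{1..n}. 1 / (1 + f (y j)))) *
      (\<Prod>i\<in>{1..n}. 1 / (1 + f (y i)))) \<partial>BM n)"
proof -
  note fm [measurable] = test_functionsD(1)[OF f]
  have f0: "0 \<le> f x" for x by (rule test_functionsD(2)[OF f])
  define h where "h x = 1 / (1 + f x)" for x
  have h01: "0 \<le> h x" "h x \<le> 1" for x using f0[of x] by (auto simp: h_def)
  have [measurable]: "h \<in> borel_measurable borel" unfolding h_def by measurable
  have int_h: "(\<integral>\<^sup>+x. ennreal (h x) \<partial>H) = ennreal (\<integral>x. h x \<partial>H)"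
    by (rule nn_integral_bounded_eq_integral[where B = 1]) (auto simp: h01 H.finite_measure_axioms)
  have int_h0: "0 \<le> (\<integral>x. h x \<partial>H)" by (simp add: h01)
  interpret U: urn "scale_measure (ennreal \<theta>) H" by (rule urn_scale_measure[OF prob_H sets_H])
  define g where "g n y = ennreal (\<Prod>i\<in>{1..n}. h (y i))" for n :: nat and y :: "nat \<Rightarrow> 'a"
  define w where "w y = ennreal ((\<theta> * (\<integral>x. h x \<partial>H) + (\<Sum>j\<in>{1..n}. h (y j))) * (\<Prod>i\<in>{1..n}. h (y i)))" for y
  have coord: "(\<lambda>y. h (y i)) \<in> borel_measurable (seq_space n)" if "i \<in> {1..n}" for i and n :: nat
    by (rule measurable_compose[OF measurable_component_singleton[OF that]]) measurable
  have g_meas: "g n \<in> borel_measurable (seq_space n)" for n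
    unfolding g_def by (intro measurable_compose[OF _ measurable_ennreal] borel_measurable_prod coord)
  have w_meas: "w \<in> borel_measurable (seq_space n)"
    unfolding w_def
    by (intro measurable_compose[OF _ measurable_ennreal] borel_measurable_times borel_measurable_add
        borel_measurable_sum borel_measurable_prod coord measurable_const) auto
  have step: "U.step n (g (Suc n)) y = w y" for y
  proof -
    have upd: "g (Suc n) (y(Suc n := x)) = g n y * ennreal (h x)" for x
    proof -
      have "(\<Prod>i\<in>{1..n}. h ((y(Suc n := x)) i)) = (\<Prod>i\<in>{1..n}. h (y i))"
        by (intro prod.cong) auto
      moreover have "{1..Suc n} = insert (Suc n) {1..n}" by auto
      ultimately have "(\<Prod>i\<in>{1..Suc n}. h ((y(Suc n := x)) i)) = (\<Prod>i\<in>{1..n}. h (y i)) * h x"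
        by (simp add: mult.commute del: One_nat_def)
      then show ?thesis
        unfolding g_def by (simp add: ennreal_mult prod_nonneg h01)
    qed
    have "U.step n (g (Suc n)) y = g n y * (ennreal \<theta> * ennreal (\<integral>x. h x \<partial>H)) + (\<Sum>j\<in>{1..n}. g n y * ennreal (h (y j)))"
      unfolding U.step_def upd
      by (simp add: nn_integral_cmult nn_integral_scale_measure int_h mult.left_commute)
    also have "\<dots> = g n y * ennreal (\<theta> * (\<integral>x. h x \<partial>H) + (\<Sum>j\<in>{1..n}. h (y j)))"
      using \<theta> int_h0 by (simp add: sum_distrib_left[symmetric] distrib_left ennreal_plus ennreal_mult sum_ennreal h01 sum_nonneg)
    also have "\<dots> = w y"
      using \<theta> int_h0 by (simp add: g_def w_def ennreal_mult prod_nonneg h01 sum_nonneg mult.commute)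
    finally show ?thesis .
  qed
  have "urn_Laplace (Suc n) f = ennreal (Gamma \<theta> / Gamma (\<theta> + real (Suc n))) *
      urn_integral (scale_measure (ennreal \<theta>) H) (Suc n) (g (Suc n))"
    unfolding urn_Laplace_def g_def[symmetric] h_def[symmetric]
    by (rule nn_integral_blackwell_macqueen[OF prob_H sets_H g_meas])
  also have "urn_integral (scale_measure (ennreal \<theta>) H) (Suc n) (g (Suc n)) = urn_integral (scale_measure (ennreal \<theta>) H) n w"
    unfolding U.urn_integral_step[OF g_meas] by (simp only: step[abs_def])
  also have "ennreal (Gamma \<theta> / Gamma (\<theta> + real (Suc n))) = ennreal (1 / (\<theta> + real n)) * ennreal (Gamma \<theta> / Gamma (\<theta> + real n))"
  proof -
    have "\<theta> + real n > 0" using \<theta> by simp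
    then have "\<theta> + real n \<notin> \<int>\<^sub>\<le>\<^sub>0" by (auto elim!: nonpos_Ints_cases)
    then have "Gamma (\<theta> + real (Suc n)) = (\<theta> + real n) * Gamma (\<theta> + real n)"
      using Gamma_plus1[of "\<theta> + real n"] by (simp add: add_ac)
    then show ?thesis
      using \<open>\<theta> + real n > 0\<close> \<theta> by (simp add: ennreal_mult[symmetric] Gamma_real_pos)
  qed
  also have "\<dots> * urn_integral (scale_measure (ennreal \<theta>) H) n w = ennreal (1 / (\<theta> + real n)) * (\<integral>\<^sup>+y. w y \<partial>BM n)"
    unfolding nn_integral_blackwell_macqueen[OF prob_H sets_H w_meas] by (simp only: mult.assoc)
  finally show ?thesis unfolding w_def h_def .
qed

text \<open>Differentiating the identity for \<open>n\<close> at \<open>s + f\<close> in \<open>s = 0\<close> gives the identity for \<open>n + 1\<close>.\<close>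

lemma \<Phi>_eq_urn_Laplace:
  assumes f: "f \<in> test_functions"
  shows "\<Phi> (\<theta> + real n) f = ennreal (exp (- (\<theta> * log_mean f))) * urn_Laplace n f"
  using f
proof (induction n arbitrary: f)
  case (0 f)
  have "urn_Laplace 0 f = 1"
    unfolding urn_Laplace_def
    using nn_integral_blackwell_macqueen[OF prob_H sets_H, of "\<lambda>_. 1" 0 \<theta>] \<theta> Gamma_real_pos[OF \<theta>] by simp
  then show ?case using \<Phi>_theta[OF 0] by simp
next
  case (Suc n f)
  note f = Suc.prems
  note fm [measurable] = test_functionsD(1)[OF f]
  have f0: "0 \<le> f x" for x by (rule test_functionsD(2)[OF f])
  define a where "a = \<theta> + real n"
  have a: "0 < a" using \<theta> by (simp add: a_def)
  have fs: "(\<lambda>x. s + f x) \<in> test_functions" if "0 \<le> s" for s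
    using test_functions_add[OF test_functions_const[OF that] f] .
  \<comment> \<open>That \<open>BM n\<close> has total mass 1 is the induction hypothesis at
    \<open>f = 0\<close>, where both the transform and the exponential are 1.\<close>
  have "urn_Laplace n (\<lambda>_. 0) = 1"
    using Suc.IH[OF test_functions_const[of 0]] by (simp add: log_mean_def \<Phi>_def mean_def G.emeasure_space_1[simplified])
  then interpret BM: prob_space "BM n"
    by (intro prob_spaceI) (simp add: urn_Laplace_def)
  define h where "h s x = 1 / (1 + (s + f x))" for s x
  have h01: "0 \<le> h s x" "h s x \<le> 1" if "0 \<le> s" for s x using f0[of x] that by (auto simp: h_def)
  have [measurable]: "h s \<in> borel_measurable borel" for s unfolding h_def by measurable
  have coord: "(\<lambda>y. h s (y i)) \<in> borel_measurable (BM n)" if "i \<in> {1..n}" for i s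
    by (rule measurable_urn_coordinate[OF _ that]) measurable
  define A where "A s m = (1 + (s + mean f m)) powr (- a)" for s m
  define K where "K s y = (\<Prod>i\<in>{1..n}. h s (y i))" for s and y :: "nat \<Rightarrow> 'a"
  have K01: "0 \<le> K s y" "K s y \<le> 1" if "0 \<le> s" for s y
    unfolding K_def using h01[OF that] by (auto intro!: prod_nonneg prod_le_1)
  have K_meas [measurable]: "K s \<in> borel_measurable (BM n)" for s
    unfolding K_def by (intro borel_measurable_prod coord)
  have A01: "0 \<le> A s m" "A s m \<le> 1" if "0 \<le> s" for s m
    using that mean_nonneg[of f m] a by (auto simp: A_def powr_minus inverse_le_1_iff ge_one_powr_ge_zero)
  have A_meas [measurable]: "A s \<in> borel_measurable G" for s unfolding A_def by measurable
  \<comment> \<open>This is the induction hypothesis at \<open>s + f\<close>. Since \<open>P\<close>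
    has mass 1 almost surely, the constant \<open>s\<close> passes through the mean and only shifts
    the base of the power.\<close>
  have id: "(\<integral>m. A s m \<partial>G) = exp (- (\<theta> * log_mean (\<lambda>x. s + f x))) * (\<integral>y. K s y \<partial>BM n)" if s: "0 \<le> s" for s
  proof -
    have "\<Phi> a (\<lambda>x. s + f x) = (\<integral>\<^sup>+m. ennreal (A s m) \<partial>G)"
      unfolding \<Phi>_def
    proof (intro nn_integral_cong_AE)
      from AE_mass AE_space show "AE m in G. ennreal ((1 + mean (\<lambda>x. s + f x) m) powr - a) = ennreal (A s m)"
      proof eventually_elim
        case (elim m)
        then have m: "m \<in> boundedly_finite" by simp
        interpret finite_measure m
          using elim(1) by (intro finite_measureI) (auto simp: total_mass_def measure_def)
        have "integrable m f"
          using test_functions_bound[OF f] f0 fm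
          by (metis (no_types, lifting) AE_I2 abs_of_nonneg integrable_const_bound measurable_boundedly_finite[OF m] real_norm_def)
        then have "mean (\<lambda>x. s + f x) m = s + mean f m"
          using elim(1) by (simp add: nn_integral_eq_mass_mean(2)[OF m elim(1)] f fs[OF s] total_mass_def add_divide_distrib)
        then show ?case by (simp add: A_def)
      qed
    qed
    also have "\<dots> = ennreal (\<integral>m. A s m \<partial>G)"
      by (rule nn_integral_bounded_eq_integral[where B = 1]) (auto simp: A01 s G.finite_measure_axioms)
    finally have 1: "\<Phi> a (\<lambda>x. s + f x) = ennreal (\<integral>m. A s m \<partial>G)" .
    have "urn_Laplace n (\<lambda>x. s + f x) = (\<integral>\<^sup>+y. ennreal (K s y) \<partial>BM n)"
      unfolding urn_Laplace_def K_def h_def ..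
    also have "\<dots> = ennreal (\<integral>y. K s y \<partial>BM n)"
      by (rule nn_integral_bounded_eq_integral[where B = 1]) (auto simp: K01 s BM.finite_measure_axioms)
    finally have 2: "urn_Laplace n (\<lambda>x. s + f x) = ennreal (\<integral>y. K s y \<partial>BM n)" .
    show ?thesis
      using Suc.IH[OF fs[OF s]] K01[OF s] A01[OF s] unfolding a_def[symmetric] 1 2
      by (simp add: ennreal_mult[symmetric])
  qed
  \<comment> \<open>Differentiating the power gives the exponent \<open>- a - 1\<close>, that is the
    order \<open>\<theta> + n + 1\<close>, and a factor \<open>a\<close>. Dividing by it produces
    the constant \<open>1 / (\<theta> + n)\<close> of \<open>urn_Laplace_Suc\<close>.\<close>
  have dA: "((\<lambda>s. \<integral>m. A s m \<partial>G) has_real_derivative (\<integral>m. - a * (1 + (0 + mean f m)) powr (- a - 1) \<partial>G)) (at 0 within {0..})"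
  proof (rule has_derivative_integral_bounded[where k' = "\<lambda>s m. - a * (1 + (s + mean f m)) powr (- a - 1)" and C = a])
    show "integrable G (A s)" if "0 \<le> s" for s
      by (rule G.integrable_const_bound[where B = 1]) (auto simp: A01 that)
    show "((\<lambda>s. A s m) has_real_derivative - a * (1 + (s + mean f m)) powr (- a - 1)) (at s within {0..})" if "0 \<le> s" for s m
      unfolding A_def using that mean_nonneg[of f m]
      by (auto intro!: derivative_eq_intros)
    show "\<bar>- a * (1 + (s + mean f m)) powr (- a - 1)\<bar> \<le> a" if "0 \<le> s" for s m
    proof -
      have "(1 + (s + mean f m)) powr (- a - 1) \<le> 1"
        using that mean_nonneg[of f m] a by (simp add: powr_minus_divide[of _ "a + 1", simplified] ge_one_powr_ge_zero)
      then show ?thesis using a by (simp add: abs_mult mult_left_le)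
    qed
  qed (simp_all add: G.finite_measure_axioms)
  have dL: "((\<lambda>s. log_mean (\<lambda>x. s + f x)) has_real_derivative (\<integral>x. h 0 x \<partial>H)) (at 0 within {0..})"
    unfolding log_mean_def
  proof (rule has_derivative_integral_bounded[where k' = h and C = 1])
    show "integrable H (\<lambda>x. ln (1 + (s + f x)))" if "0 \<le> s" for s
      by (rule integrable_ln[OF fs[OF that]])
    show "((\<lambda>s. ln (1 + (s + f x))) has_real_derivative h s x) (at s within {0..})" if "0 \<le> s" for s x
      unfolding h_def using that f0[of x] by (auto intro!: derivative_eq_intros)
  qed (auto simp: h01 H.finite_measure_axioms)
  have dK: "((\<lambda>s. \<integral>y. K s y \<partial>BM n) has_real_derivative (\<integral>y. - (\<Sum>j\<in>{1..n}. h 0 (y j)) * K 0 y \<partial>BM n)) (at 0 within {0..})"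
  proof (rule has_derivative_integral_bounded[where k' = "\<lambda>s y. - (\<Sum>j\<in>{1..n}. h s (y j)) * K s y" and C = "real n"])
    show "integrable (BM n) (K s)" if "0 \<le> s" for s
      by (rule BM.integrable_const_bound[where B = 1]) (auto simp: K01 that)
    show "(\<lambda>y. - (\<Sum>j\<in>{1..n}. h 0 (y j)) * K 0 y) \<in> borel_measurable (BM n)"
      by (intro borel_measurable_times borel_measurable_uminus borel_measurable_sum coord K_meas)
    show "((\<lambda>s. K s y) has_real_derivative - (\<Sum>j\<in>{1..n}. h s (y j)) * K s y) (at s within {0..})" if "0 \<le> s" for s y
    proof (rule has_field_derivative_at_within)
      have pos: "0 < 1 + (s + f (y i))" for i using that f0[of "y i"] by simp
      have "((\<lambda>s. \<Prod>i\<in>{1..n}. h s (y i)) has_real_derivative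
          (\<Prod>i\<in>{1..n}. h s (y i)) * (\<Sum>i\<in>{1..n}. - (h s (y i))\<^sup>2 / h s (y i))) (at s)"
      proof (rule has_field_derivative_prod')
        show "h s (y i) \<noteq> 0" for i using pos[of i] by (simp add: h_def)
        show "((\<lambda>s. h s (y i)) has_real_derivative - (h s (y i))\<^sup>2) (at s)" for i
          unfolding h_def using pos[of i] by (auto intro!: derivative_eq_intros simp: power2_eq_square)
      qed
      then show "((\<lambda>s. K s y) has_real_derivative - (\<Sum>j\<in>{1..n}. h s (y j)) * K s y) (at s)"
        by (simp add: K_def power2_eq_square sum_negf mult.commute)
    qed
    show "\<bar>- (\<Sum>j\<in>{1..n}. h s (y j)) * K s y\<bar> \<le> real n" if "0 \<le> s" for s y
    proof -
      have "0 \<le> (\<Sum>j\<in>{1..n}. h s (y j))" "(\<Sum>j\<in>{1..n}. h s (y j)) \<le> real n"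
        using h01[OF that] sum_bounded_above[of "{1..n}" "\<lambda>j. h s (y j)" 1] by (auto intro!: sum_nonneg)
      then show ?thesis
        using K01[OF that, of y] mult_mono[of "\<Sum>j\<in>{1..n}. h s (y j)" "real n" "K s y" 1] by (simp add: abs_mult)
    qed
  qed (simp_all add: BM.finite_measure_axioms)
  define E where "E = exp (- (\<theta> * log_mean f))"
  \<comment> \<open>The exponential contributes \<open>\<theta>\<close> times the mean of
    \<open>h 0\<close> to the derivative and the product contributes the sum over the coordinates.
    Together they form the weight that appears in \<open>urn_Laplace_Suc\<close>.\<close>
  define W where "W y = \<theta> * (\<integral>x. h 0 x \<partial>H) + (\<Sum>j\<in>{1..n}. h 0 (y j))" for y
  have int_h0: "0 \<le> (\<integral>x. h 0 x \<partial>H)" by (simp add: h01)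
  have W0: "0 \<le> W y" for y
    unfolding W_def using \<theta> int_h0 by (auto intro!: add_nonneg_nonneg sum_nonneg simp: h01)
  have sum_meas: "(\<lambda>y. \<Sum>j\<in>{1..n}. h 0 (y j)) \<in> borel_measurable (BM n)"
    by (intro borel_measurable_sum coord)
  have sum_le: "(\<Sum>j\<in>{1..n}. h 0 (y j)) \<le> real n" for y
    using sum_bounded_above[of "{1..n}" "\<lambda>j. h 0 (y j)" 1] h01 by simp
  have intK: "integrable (BM n) (K 0)"
    by (rule BM.integrable_const_bound[where B = 1]) (auto simp: K01)
  have intSK: "integrable (BM n) (\<lambda>y. (\<Sum>j\<in>{1..n}. h 0 (y j)) * K 0 y)"
  proof (rule BM.integrable_const_bound[where B = "real n"])
    show "AE y in BM n. norm ((\<Sum>j\<in>{1..n}. h 0 (y j)) * K 0 y) \<le> real n"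
      using sum_le h01 K01 mult_mono[OF sum_le, of "K 0 _" 1] by (intro AE_I2) (auto simp: abs_mult sum_nonneg)
  qed (intro borel_measurable_times sum_meas K_meas)
  have "((\<lambda>s. exp (- (\<theta> * log_mean (\<lambda>x. s + f x)))) has_real_derivative - (E * (\<theta> * (\<integral>x. h 0 x \<partial>H)))) (at 0 within {0..})"
    by (auto intro!: derivative_eq_intros dL simp: E_def)
  from DERIV_mult[OF this dK]
  have "((\<lambda>s. exp (- (\<theta> * log_mean (\<lambda>x. s + f x))) * (\<integral>y. K s y \<partial>BM n)) has_real_derivative
      - (E * (\<theta> * (\<integral>x. h 0 x \<partial>H)) * (\<integral>y. K 0 y \<partial>BM n)) - E * (\<integral>y. (\<Sum>j\<in>{1..n}. h 0 (y j)) * K 0 y \<partial>BM n)) (at 0 within {0..})"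
    by (simp add: E_def mult.commute)
  moreover have "(\<integral>y. W y * K 0 y \<partial>BM n) = \<theta> * (\<integral>x. h 0 x \<partial>H) * (\<integral>y. K 0 y \<partial>BM n) + (\<integral>y. (\<Sum>j\<in>{1..n}. h 0 (y j)) * K 0 y \<partial>BM n)"
    unfolding W_def distrib_right using intK intSK by (subst Bochner_Integration.integral_add) simp_all
  ultimately have "((\<lambda>s. exp (- (\<theta> * log_mean (\<lambda>x. s + f x))) * (\<integral>y. K s y \<partial>BM n)) has_real_derivative
      - (E * (\<integral>y. W y * K 0 y \<partial>BM n))) (at 0 within {0..})"
    by (simp add: algebra_simps)
  then have "((\<lambda>s. \<integral>m. A s m \<partial>G) has_real_derivative - (E * (\<integral>y. W y * K 0 y \<partial>BM n))) (at 0 within {0..})"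
    by (rule has_field_derivative_transform_within[where d = 1]) (simp_all add: id)
  \<comment> \<open>The identity \<open>id\<close> is available for nonnegative \<open>s\<close>
    only. One-sided derivatives are still unique, since 0 is a limit point of the half line.\<close>
  moreover have "at 0 within {0::real..} \<noteq> bot"
    by (simp add: at_within_Ici_at_right)
  ultimately have *: "(\<integral>m. - a * (1 + (0 + mean f m)) powr (- a - 1) \<partial>G) = - (E * (\<integral>y. W y * K 0 y \<partial>BM n))"
    using has_field_derivative_unique[OF dA] by blast
  have main: "(\<integral>m. (1 + mean f m) powr (- (a + 1)) \<partial>G) = E * (1 / a * (\<integral>y. W y * K 0 y \<partial>BM n))"
  proof -
    have "- (a + 1) = - a - 1" by simp
    moreover have "(\<integral>m. - a * (1 + (0 + mean f m)) powr (- a - 1) \<partial>G) = - (a * (\<integral>m. (1 + mean f m) powr (- a - 1) \<partial>G))"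
      by simp
    ultimately show ?thesis using * a by (simp only: ) (simp add: field_simps)
  qed
  have WK0: "0 \<le> W y * K 0 y" for y using W0 K01 by simp
  have "\<Phi> (\<theta> + real (Suc n)) f = (\<integral>\<^sup>+m. ennreal ((1 + mean f m) powr (- (a + 1))) \<partial>G)"
    unfolding \<Phi>_def a_def by (simp add: add_ac)
  also have "\<dots> = ennreal (\<integral>m. (1 + mean f m) powr (- (a + 1)) \<partial>G)"
  proof (rule nn_integral_bounded_eq_integral[where B = 1])
    show "(1 + mean f m) powr (- (a + 1)) \<le> 1" for m
      using mean_nonneg[of f m] a by (intro powr_neg_le_1) auto
  qed (simp_all add: G.finite_measure_axioms)
  also have "\<dots> = ennreal E * (ennreal (1 / a) * ennreal (\<integral>y. W y * K 0 y \<partial>BM n))"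
  proof -
    have "ennreal (E * (1 / a * I)) = ennreal E * (ennreal (1 / a) * ennreal I)" if "0 \<le> I" for I
      using a that by (simp add: ennreal_mult[symmetric] E_def)
    then show ?thesis
      unfolding main using WK0 by simp
  qed
  also have "ennreal (\<integral>y. W y * K 0 y \<partial>BM n) = (\<integral>\<^sup>+y. ennreal (W y * K 0 y) \<partial>BM n)"
  proof (rule nn_integral_eq_integral[symmetric])
    show "integrable (BM n) (\<lambda>y. W y * K 0 y)"
      unfolding W_def distrib_right using intK intSK by simp
  qed (use WK0 in simp)
  also have "ennreal (1 / a) * \<dots> = urn_Laplace (Suc n) f"
    unfolding urn_Laplace_Suc[OF f] by (simp add: a_def W_def K_def h_def)
  finally show ?case by (simp add: E_def)
qed

end

section \<open>Beta variables\<close>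

lemma beta_density_nonneg: "0 < a \<Longrightarrow> 0 < b \<Longrightarrow> 0 \<le> beta_density a b x"
  by (simp add: beta_density_def Beta_def Gamma_real_pos less_imp_le)

lemma measurable_beta_density [measurable]: "beta_density a b \<in> borel_measurable borel"
  unfolding beta_density_def by measurable

text \<open>Substitute \<open>v = u (1 + x) / (1 + u x)\<close> in the Beta integral.\<close>

lemma beta_density_Stieltjes:
  assumes a: "0 < a" and b: "0 < b" and x: "0 \<le> x"
  shows "(\<integral>\<^sup>+u. ennreal (beta_density a b u) * ennreal ((1 + u * x) powr (- (a + b))) \<partial>lborel) = ennreal ((1 + x) powr (- a))"
proof -
  have Bpos: "Beta a b > 0" using a b by (simp add: Beta_def Gamma_real_pos)
  define f where "f v = v powr (a - 1) * (1 - v) powr (b - 1)" for v :: real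
  \<comment> \<open>This map sends the unit interval onto itself and satisfies
    \<open>1 - g u = (1 - u) / (1 + u * x)\<close>. The powers of \<open>1 + u * x\<close> from the
    two Beta factors and from \<open>g'\<close> are \<open>a - 1\<close>, \<open>b - 1\<close> and
    2, with sum \<open>a + b\<close>.\<close>
  define g where "g u = u * (1 + x) / (1 + u * x)" for u :: real
  define g' where "g' u = (1 + x) / (1 + u * x)\<^sup>2" for u :: real
  have [measurable]: "f \<in> borel_measurable borel" unfolding f_def by measurable
  have pos: "0 < 1 + u * x" if "0 \<le> u" for u using x that by (simp add: add_pos_nonneg)
  have "ennreal (Beta a b) = (\<integral>\<^sup>+v. ennreal (f v) * indicator {0..1} v \<partial>lborel)"
    using nn_integral_has_integral_lebesgue'[OF _ has_integral_Beta_real[OF a b]] by (simp add: f_def)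
  also have "\<dots> = (\<integral>\<^sup>+v. ennreal (f v) * indicator {g 0..g 1} v \<partial>lborel)"
    using pos[of 1] by (simp add: g_def)
  also have "\<dots> = (\<integral>\<^sup>+u. ennreal (f (g u)) * ennreal (g' u) * indicator {0..1} u \<partial>lborel)"
  proof (rule nn_integral_substitution_aux)
    show "(g has_real_derivative g' u) (at u)" if "u \<in> {0..1}" for u
      unfolding g_def g'_def using pos[of u] that
      by (auto intro!: derivative_eq_intros simp: power2_eq_square field_simps)
    show "continuous_on {0..1} g'"
      unfolding g'_def using pos by (intro continuous_intros) force
    show "0 \<le> g' u" for u using x by (simp add: g'_def)
  qed auto
  also have "\<dots> = (\<integral>\<^sup>+u. ennreal (Beta a b * (1 + x) powr a) * (ennreal (beta_density a b u) * ennreal ((1 + u * x) powr (- (a + b)))) \<partial>lborel)"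
  proof (intro nn_integral_cong)
    fix u :: real
    show "ennreal (f (g u)) * ennreal (g' u) * indicator {0..1} u =
      ennreal (Beta a b * (1 + x) powr a) * (ennreal (beta_density a b u) * ennreal ((1 + u * x) powr (- (a + b))))"
    proof (cases "0 < u \<and> u < 1")
      case True
      define c where "c = 1 + u * x"
      have c: "0 < c" using pos[of u] True by (simp add: c_def)
      have gu: "g u = u * (1 + x) / c" "1 - g u = (1 - u) / c"
        using c by (simp_all add: g_def c_def field_simps)
      have "f (g u) = (u powr (a - 1) * (1 + x) powr (a - 1) / c powr (a - 1)) * ((1 - u) powr (b - 1) / c powr (b - 1))"
      proof -
        have "f (g u) = (u * (1 + x) / c) powr (a - 1) * ((1 - u) / c) powr (b - 1)"
          unfolding f_def gu(2) by (simp only: gu(1))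
        then show ?thesis using True x c by (simp add: powr_divide powr_mult)
      qed
      moreover have "g' u = (1 + x) powr 1 / c powr 2"
        using c x by (simp add: g'_def c_def)
      ultimately have "f (g u) * g' u = u powr (a - 1) * (1 - u) powr (b - 1) * ((1 + x) powr (a - 1) * (1 + x) powr 1) *
          (1 / (c powr (a - 1) * c powr (b - 1) * c powr 2))"
        by simp
      also have "(1 + x) powr (a - 1) * (1 + x) powr 1 = (1 + x) powr a"
        using powr_add[of "1 + x" "a - 1" 1] by simp
      also have "1 / (c powr (a - 1) * c powr (b - 1) * c powr 2) = c powr (- (a + b))"
        using powr_minus_divide[of c "a + b"] by (simp add: powr_add[symmetric])
      finally have "f (g u) * g' u = Beta a b * (1 + x) powr a * (beta_density a b u * c powr (- (a + b)))"
        using Bpos True by (simp add: beta_density_def)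
      moreover have "ennreal (f (g u)) * ennreal (g' u) = ennreal (f (g u) * g' u)"
        using x by (intro ennreal_mult[symmetric]) (auto simp: f_def g'_def)
      ultimately show ?thesis
        using True Bpos beta_density_nonneg[OF a b, of u]
        by (simp add: c_def[symmetric] ennreal_mult[symmetric])
    next
      case False
      then have "u \<notin> {0..1} \<or> u = 0 \<or> u = 1" by auto
      with False pos[of 1] show ?thesis by (auto simp: beta_density_def f_def g_def)
    qed
  qed
  also have "\<dots> = ennreal (Beta a b * (1 + x) powr a) * (\<integral>\<^sup>+u. ennreal (beta_density a b u) * ennreal ((1 + u * x) powr (- (a + b))) \<partial>lborel)"
    by (rule nn_integral_cmult) measurable
  finally have *: "ennreal (Beta a b) = ennreal (Beta a b * (1 + x) powr a) *
      (\<integral>\<^sup>+u. ennreal (beta_density a b u) * ennreal ((1 + u * x) powr (- (a + b))) \<partial>lborel)" (is "_ = _ * ?I") .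
  have "ennreal ((1 + x) powr (- a) / Beta a b) * ennreal (Beta a b) =
      (ennreal ((1 + x) powr (- a) / Beta a b) * ennreal (Beta a b * (1 + x) powr a)) * ?I"
    unfolding mult.assoc by (subst *) simp
  also have "ennreal ((1 + x) powr (- a) / Beta a b) * ennreal (Beta a b * (1 + x) powr a) = 1"
    using x Bpos by (simp add: ennreal_mult[symmetric] powr_minus field_simps)
  also have "ennreal ((1 + x) powr (- a) / Beta a b) * ennreal (Beta a b) = ennreal ((1 + x) powr (- a))"
    using Bpos by (simp add: ennreal_mult[symmetric])
  finally show ?thesis by simp
qed

lemma mean_cmult:
  fixes f :: "'a::polish_space \<Rightarrow> real"
  assumes "m \<in> boundedly_finite" "f \<in> test_functions" "0 \<le> c"
  shows "mean (\<lambda>x. c * f x) m = c * mean f m"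
proof -
  have "(\<integral>\<^sup>+x. ennreal (c * f x) \<partial>normalized m) = ennreal c * (\<integral>\<^sup>+x. ennreal (f x) \<partial>normalized m)"
    using assms measurable_boundedly_finite[OF normalized_boundedly_finite[OF assms(1)] test_functionsD(1)[OF assms(2)]]
    by (simp add: ennreal_mult test_functionsD nn_integral_cmult)
  then show ?thesis using assms by (simp add: mean_def enn2real_mult)
qed

lemma (in gamma_law) \<Phi>_cmult:
  assumes "f \<in> test_functions" "0 \<le> c"
  shows "\<Phi> a (\<lambda>x. c * f x) = (\<integral>\<^sup>+m. ennreal ((1 + c * mean f m) powr (- a)) \<partial>G)"
  unfolding \<Phi>_def by (intro nn_integral_cong) (simp add: mean_cmult assms)

lemma (in gamma_law) beta_mixture:
  assumes f: "f \<in> test_functions" and q: "0 < q" and b: "0 < \<theta> + real n - q"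
  shows "(\<integral>\<^sup>+u. ennreal (beta_density q (\<theta> + real n - q) u) *
      (ennreal (exp (- (\<theta> * log_mean (\<lambda>x. u * f x)))) * urn_Laplace n (\<lambda>x. u * f x)) \<partial>lborel) = \<Phi> q f"
proof -
  let ?b = "\<theta> + real n - q"
  note [measurable] = test_functionsD(1)[OF f]
  interpret pair_sigma_finite lborel G by unfold_locales
  have "(\<integral>\<^sup>+u. ennreal (beta_density q ?b u) *
      (ennreal (exp (- (\<theta> * log_mean (\<lambda>x. u * f x)))) * urn_Laplace n (\<lambda>x. u * f x)) \<partial>lborel) =
    (\<integral>\<^sup>+u. (\<integral>\<^sup>+m. ennreal (beta_density q ?b u) * ennreal ((1 + u * mean f m) powr (- (q + ?b))) \<partial>G) \<partial>lborel)"
  proof (intro nn_integral_cong)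
    fix u :: real
    show "ennreal (beta_density q ?b u) * (ennreal (exp (- (\<theta> * log_mean (\<lambda>x. u * f x)))) * urn_Laplace n (\<lambda>x. u * f x)) =
      (\<integral>\<^sup>+m. ennreal (beta_density q ?b u) * ennreal ((1 + u * mean f m) powr (- (q + ?b))) \<partial>G)"
    proof (cases "0 < u")
      case True
      then show ?thesis
        using \<Phi>_eq_urn_Laplace[OF test_functions_cmult[OF f], of u n] \<Phi>_cmult[OF f, of u]
        by (subst nn_integral_cmult) auto
    qed (simp add: beta_density_def)
  qed
  also have "\<dots> = (\<integral>\<^sup>+m. (\<integral>\<^sup>+u. ennreal (beta_density q ?b u) * ennreal ((1 + u * mean f m) powr (- (q + ?b))) \<partial>lborel) \<partial>G)"
    by (rule Fubini'[symmetric]) measurable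
  also have "\<dots> = \<Phi> q f"
    unfolding \<Phi>_def by (intro nn_integral_cong beta_density_Stieltjes q b mean_nonneg)
  finally show ?thesis .
qed

section \<open>Independent \<sigma>-algebras\<close>

lemma Int_stable_generated: "Int_stable (generated M N X)"
proof (rule Int_stableI)
  fix A B assume "A \<in> generated M N X" "B \<in> generated M N X"
  then obtain A' B' where "A' \<in> sets N" "B' \<in> sets N" "A = X -` A' \<inter> space M" "B = X -` B' \<inter> space M"
    unfolding generated_def by auto
  then show "A \<inter> B \<in> generated M N X"
    unfolding generated_def by (auto intro!: exI[of _ "A' \<inter> B'"])
qed

lemma mutually_indep_events: "prob_space M \<Longrightarrow> mutually_indep M Fs \<Longrightarrow> \<Union>(set Fs) \<subseteq> sets M"
  unfolding mutually_indep_def prob_space.indep_sets_def by (fastforce simp: in_set_conv_nth)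

lemma mutually_indep_ConsD:
  assumes M: "prob_space M" and indep: "mutually_indep M (F # Fs)"
  shows "mutually_indep M Fs"
proof -
  interpret prob_space M by fact
  note I = indep[unfolded mutually_indep_def]
  show ?thesis
    unfolding mutually_indep_def
  proof (rule indep_setsI)
    show "Fs ! i \<subseteq> events" if "i \<in> {..<length Fs}" for i
    proof -
      have "Fs ! i \<in> set (F # Fs)" using that by simp
      then show ?thesis using mutually_indep_events[OF M indep] by blast
    qed
    fix A J assume J: "J \<noteq> {}" "J \<subseteq> {..<length Fs}" "finite J" "\<forall>j\<in>J. A j \<in> Fs ! j"
    have "prob (\<Inter>j\<in>Suc ` J. A (j - 1)) = (\<Prod>j\<in>Suc ` J. prob (A (j - 1)))"
      by (rule indep_setsD[OF I]) (use J in auto)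
    then show "prob (\<Inter>j\<in>J. A j) = (\<Prod>j\<in>J. prob (A j))"
      by (simp add: image_image prod.reindex)
  qed
qed

text \<open>The indices are grouped into the head and the rest. Intersection-stability of every
  member lets independence pass to the generated sigma-algebras.\<close>

lemma mutually_indep_Cons_prob:
  assumes M: "prob_space M" and indep: "mutually_indep M (F # Fs)"
    and Int: "\<And>E. E \<in> set (F # Fs) \<Longrightarrow> Int_stable E"
    and A: "A \<in> F" and B: "B \<in> sigma_sets (space M) (\<Union>(set Fs))"
  shows "measure M (A \<inter> B) = measure M A * measure M B"
proof -
  interpret prob_space M by fact
  let ?I = "\<lambda>b. if b then {0} else {1..<Suc (length Fs)}"
  have ind: "indep_sets (\<lambda>j. sigma_sets (space M) (\<Union>i\<in>?I j. (F # Fs) ! i)) UNIV"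
  proof (rule indep_sets_collect_sigma)
    have "(\<Union>j\<in>UNIV. ?I j) = {..<length (F # Fs)}" by (auto simp: UNIV_bool)
    then show "indep_sets (\<lambda>i. (F # Fs) ! i) (\<Union>j\<in>UNIV. ?I j)"
      using indep unfolding mutually_indep_def by simp
    show "Int_stable ((F # Fs) ! i)" if "i \<in> ?I j" for i j
      by (rule Int) (use that in \<open>auto intro!: nth_mem split: if_splits\<close>)
    show "disjoint_family_on ?I UNIV" by (auto simp: disjoint_family_on_def)
  qed
  have "E \<in> (\<lambda>i. (F # Fs) ! i) ` {1..<Suc (length Fs)}" if "E \<in> set Fs" for E
    using that by (auto simp: in_set_conv_nth intro!: image_eqI[of _ _ "Suc _"])
  then have "\<Union>(set Fs) \<subseteq> (\<Union>i\<in>?I False. (F # Fs) ! i)" by auto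
  then have B': "B \<in> sigma_sets (space M) (\<Union>i\<in>?I False. (F # Fs) ! i)"
    using B sigma_sets_mono'[of "\<Union>(set Fs)"] by blast
  have A': "A \<in> sigma_sets (space M) (\<Union>i\<in>?I True. (F # Fs) ! i)"
    using A by (auto intro: sigma_sets.Basic)
  have "prob (\<Inter>j\<in>UNIV. (\<lambda>j. if j then A else B) j) = (\<Prod>j\<in>UNIV. prob ((\<lambda>j. if j then A else B) j))"
    by (rule indep_setsD[OF ind]) (use A' B' in \<open>auto split: if_splits\<close>)
  then show ?thesis by (simp add: UNIV_bool Int_commute)
qed

lemma measurable_generated:
  assumes "Y \<in> measurable M L" "generated M L Y \<subseteq> sigma_sets (space M) S" "S \<subseteq> Pow (space M)"
  shows "Y \<in> measurable (sigma (space M) S) L"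
  using assms measurable_space[OF assms(1)] by (intro measurableI) (auto simp: generated_def)

text \<open>Fubini's theorem for independent variables of different types. \<open>X\<close> is
  independent of the sigma-algebra generated by the remaining members, and the other variables enter
  through the sample point itself; measurability of \<open>\<psi>\<close> with respect to that
  sigma-algebra says that it depends on them alone. The two conclusions are the two orders of
  integration.\<close>

lemma nn_integral_freeze:
  assumes M: "prob_space M" and indep: "mutually_indep M (generated M N X # Fs)"
    and Int: "\<And>E. E \<in> set Fs \<Longrightarrow> Int_stable E"
    and X [measurable]: "X \<in> measurable M N"
    and \<psi>: "case_prod \<psi> \<in> borel_measurable (N \<Otimes>\<^sub>M sigma (space M) (\<Union>(set Fs)))"
  shows "(\<integral>\<^sup>+\<omega>. \<psi> (X \<omega>) \<omega> \<partial>M) = (\<integral>\<^sup>+x. (\<integral>\<^sup>+\<omega>. \<psi> x \<omega> \<partial>M) \<partial>distr M N X)"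
    and "(\<integral>\<^sup>+\<omega>. \<psi> (X \<omega>) \<omega> \<partial>M) = (\<integral>\<^sup>+\<omega>. (\<integral>\<^sup>+x. \<psi> x \<omega> \<partial>distr M N X) \<partial>M)"
proof -
  interpret prob_space M by fact
  let ?S = "\<Union>(set Fs)"
  have ev: "?S \<subseteq> events" using mutually_indep_events[OF M indep] by auto
  then have pow: "?S \<subseteq> Pow (space M)" using sets.space_closed by blast
  \<comment> \<open>The restriction of \<open>M\<close> to the sigma-algebra of the remaining
    variables, as an image under the identity. The joint law of \<open>X\<close> and the sample
    point is then a product measure.\<close>
  define M2 where "M2 = distr M (sigma (space M) ?S) (\<lambda>\<omega>. \<omega>)"
  have id [measurable]: "(\<lambda>\<omega>. \<omega>) \<in> measurable M (sigma (space M) ?S)"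
    using ev pow by (intro measurable_measure_of) auto
  interpret X: prob_space "distr M N X" by (rule prob_space_distr) simp
  interpret M2: prob_space M2 unfolding M2_def by (rule prob_space_distr) simp
  interpret pair_sigma_finite "distr M N X" M2 by unfold_locales
  have [simp, measurable_cong]: "sets M2 = sets (sigma (space M) ?S)" by (simp add: M2_def)
  have joint: "distr M N X \<Otimes>\<^sub>M M2 = distr M (N \<Otimes>\<^sub>M sigma (space M) ?S) (\<lambda>\<omega>. (X \<omega>, \<omega>))"
  proof (rule pair_measure_eqI)
    fix A B assume A: "A \<in> sets (distr M N X)" and B: "B \<in> sets M2"
    then have B': "B \<in> sigma_sets (space M) ?S" using pow by simp
    then have "B \<in> events" using ev by (metis sets.sigma_sets_subset subsetD)
    have AN: "A \<in> sets N" using A by simp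
    have "X -` A \<inter> space M \<in> generated M N X" using A by (auto simp: generated_def)
    from mutually_indep_Cons_prob[OF M indep _ this B'] Int Int_stable_generated
    have "prob ((X -` A \<inter> space M) \<inter> B) = prob (X -` A \<inter> space M) * prob B" by auto
    moreover have "(\<lambda>\<omega>. (X \<omega>, \<omega>)) -` (A \<times> B) \<inter> space M = (X -` A \<inter> space M) \<inter> B"
      by auto
    moreover have "(\<lambda>\<omega>. \<omega>) -` B \<inter> space M = B" using sets.sets_into_space[OF \<open>B \<in> events\<close>] by auto
    ultimately show "emeasure (distr M N X) A * emeasure M2 B =
        emeasure (distr M (N \<Otimes>\<^sub>M sigma (space M) ?S) (\<lambda>\<omega>. (X \<omega>, \<omega>))) (A \<times> B)"
      using AN B unfolding M2_def
      by (simp add: emeasure_distr emeasure_eq_measure ennreal_mult[symmetric])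
  next
    show "sigma_finite_measure (distr M N X)" "sigma_finite_measure M2" by unfold_locales
  qed (simp add: M2_def cong: sets_pair_measure_cong)
  have \<psi>' [measurable]: "case_prod \<psi> \<in> borel_measurable (distr M N X \<Otimes>\<^sub>M M2)"
    using \<psi> by (simp cong: measurable_cong_sets sets_pair_measure_cong)
  have "(\<integral>\<^sup>+\<omega>. \<psi> (X \<omega>) \<omega> \<partial>M) = (\<integral>\<^sup>+z. case_prod \<psi> z \<partial>(distr M N X \<Otimes>\<^sub>M M2))"
    unfolding joint using \<psi> by (subst nn_integral_distr) auto
  note eq = this
  have sec: "\<psi> x \<in> borel_measurable (sigma (space M) ?S)" if "x \<in> space N" for x
    using measurable_Pair2[OF \<psi> that] by simp
  have "(\<integral>\<^sup>+\<omega>. \<psi> (X \<omega>) \<omega> \<partial>M) = (\<integral>\<^sup>+x. (\<integral>\<^sup>+\<omega>. \<psi> x \<omega> \<partial>M2) \<partial>distr M N X)"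
    unfolding eq using M2.nn_integral_fst[OF \<psi>'] by simp
  also have "\<dots> = (\<integral>\<^sup>+x. (\<integral>\<^sup>+\<omega>. \<psi> x \<omega> \<partial>M) \<partial>distr M N X)"
    unfolding M2_def by (intro nn_integral_cong nn_integral_distr[OF id]) (simp add: sec)
  finally show "(\<integral>\<^sup>+\<omega>. \<psi> (X \<omega>) \<omega> \<partial>M) = (\<integral>\<^sup>+x. (\<integral>\<^sup>+\<omega>. \<psi> x \<omega> \<partial>M) \<partial>distr M N X)" .
  have "(\<integral>\<^sup>+\<omega>. \<psi> (X \<omega>) \<omega> \<partial>M) = (\<integral>\<^sup>+\<omega>. (\<integral>\<^sup>+x. \<psi> x \<omega> \<partial>distr M N X) \<partial>M2)"
    unfolding eq using nn_integral_snd[OF \<psi>'] by simp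
  also have "\<dots> = (\<integral>\<^sup>+\<omega>. (\<integral>\<^sup>+x. \<psi> x \<omega> \<partial>distr M N X) \<partial>M)"
    unfolding M2_def by (rule nn_integral_distr[OF id])
      (use X.borel_measurable_nn_integral_fst in \<open>simp add: X.borel_measurable_nn_integral \<psi>\<close>)
  finally show "(\<integral>\<^sup>+\<omega>. \<psi> (X \<omega>) \<omega> \<partial>M) = (\<integral>\<^sup>+\<omega>. (\<integral>\<^sup>+x. \<psi> x \<omega> \<partial>distr M N X) \<partial>M)" .
qed

text \<open>Induction on the list: the head variable is frozen, and the product over the tail is
  measurable for the sigma-algebra that the tail generates.\<close>

lemma mutually_indep_prod_list:
  assumes M: "prob_space M" and indep: "mutually_indep M (map (\<lambda>j. generated M borel (Z j)) js)"
    and Z: "\<And>j. j \<in> set js \<Longrightarrow> Z j \<in> borel_measurable M"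
    and g: "\<And>j. j \<in> set js \<Longrightarrow> g j \<in> borel_measurable borel"
  shows "(\<integral>\<^sup>+\<omega>. prod_list (map (\<lambda>j. g j (Z j \<omega>) :: ennreal) js) \<partial>M) = prod_list (map (\<lambda>j. \<integral>\<^sup>+\<omega>. g j (Z j \<omega>) \<partial>M) js)"
  using indep Z g
proof (induction js)
  case Nil
  then show ?case using prob_space.emeasure_space_1[OF M] by simp
next
  case (Cons j js)
  let ?Fs = "map (\<lambda>j. generated M borel (Z j)) js"
  let ?N2 = "sigma (space M) (\<Union>(set ?Fs))"
  have indep: "mutually_indep M (generated M borel (Z j) # ?Fs)" using Cons.prems by simp
  have pow: "\<Union>(set ?Fs) \<subseteq> Pow (space M)"
    by (auto simp: generated_def)
  have Z2: "Z i \<in> borel_measurable ?N2" if "i \<in> set js" for i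
    by (rule measurable_generated[OF _ _ pow]) (use Cons.prems that in \<open>auto intro: sigma_sets.Basic\<close>)
  have gZ: "(\<lambda>\<omega>. g i (Z i \<omega>)) \<in> borel_measurable ?N2" if "i \<in> set js" for i
    using measurable_compose[OF Z2[OF that] Cons.prems(3)] that by simp
  have prod: "(\<lambda>\<omega>. prod_list (map (\<lambda>j. g j (Z j \<omega>)) js')) \<in> borel_measurable ?N2" if "set js' \<subseteq> set js" for js'
    using that
  proof (induction js')
    case (Cons i js')
    then have "(\<lambda>\<omega>. g i (Z i \<omega>)) \<in> borel_measurable ?N2" by (intro gZ) simp
    with Cons show ?case by (simp only: list.map prod_list.Cons borel_measurable_times_ennreal set_subset_Cons[THEN subset_trans])
  qed simp
  have "\<Union>(set ?Fs) \<subseteq> sets M" using mutually_indep_events[OF M indep] by auto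
  then have "(\<lambda>\<omega>. \<omega>) \<in> measurable M ?N2"
    using pow by (intro measurable_measure_of) auto
  from measurable_compose[OF this prod[OF subset_refl]]
  have prodM: "(\<lambda>\<omega>. prod_list (map (\<lambda>j. g j (Z j \<omega>)) js)) \<in> borel_measurable M" .
  have "(\<integral>\<^sup>+\<omega>. prod_list (map (\<lambda>j. g j (Z j \<omega>)) (j # js)) \<partial>M) =
      (\<integral>\<^sup>+x. (\<integral>\<^sup>+\<omega>. g j x * prod_list (map (\<lambda>j. g j (Z j \<omega>)) js) \<partial>M) \<partial>distr M borel (Z j))"
    unfolding list.map prod_list.Cons
  proof (rule nn_integral_freeze(1)[OF M indep])
    have [measurable]: "g j \<in> borel_measurable borel" using Cons.prems by simp
    note [measurable] = prod[OF subset_refl]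
    show "(\<lambda>(x, \<omega>). g j x * prod_list (map (\<lambda>j. g j (Z j \<omega>)) js)) \<in> borel_measurable (borel \<Otimes>\<^sub>M ?N2)"
      by measurable
  qed (use Cons.prems Int_stable_generated in auto)
  also have "\<dots> = (\<integral>\<^sup>+x. g j x \<partial>distr M borel (Z j)) * (\<integral>\<^sup>+\<omega>. prod_list (map (\<lambda>j. g j (Z j \<omega>)) js) \<partial>M)"
    using Cons.prems prodM by (simp add: nn_integral_cmult nn_integral_multc)
  also have "(\<integral>\<^sup>+x. g j x \<partial>distr M borel (Z j)) = (\<integral>\<^sup>+\<omega>. g j (Z j \<omega>) \<partial>M)"
    using Cons.prems by (subst nn_integral_distr) auto
  also have "(\<integral>\<^sup>+\<omega>. prod_list (map (\<lambda>j. g j (Z j \<omega>)) js) \<partial>M) = prod_list (map (\<lambda>j. \<integral>\<^sup>+\<omega>. g j (Z j \<omega>) \<partial>M) js)"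
    using Cons.prems mutually_indep_ConsD[OF M indep] by (intro Cons.IH) auto
  finally show ?case by simp
qed

lemma measurable_add_atoms:
  fixes m :: "'w \<Rightarrow> 'a::polish_space measure"
  assumes I: "finite I" and m [measurable]: "m \<in> measurable M bf_algebra"
    and c: "\<And>j. j \<in> I \<Longrightarrow> c j \<in> borel_measurable M" and y: "\<And>j. j \<in> I \<Longrightarrow> y j \<in> borel_measurable M"
  shows "(\<lambda>\<omega>. add_atoms (m \<omega>) I (\<lambda>j. c j \<omega>) (\<lambda>j. y j \<omega>)) \<in> measurable M bf_algebra"
proof (rule measurable_bf_algebraI)
  note bf = measurable_space[OF m, simplified]
  show "add_atoms (m \<omega>) I (\<lambda>j. c j \<omega>) (\<lambda>j. y j \<omega>) \<in> boundedly_finite" if "\<omega> \<in> space M" for \<omega>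
    using I bf[OF that] by (simp add: add_atoms_boundedly_finite)
  fix A :: "'a set" assume [measurable]: "A \<in> sets borel"
  note [measurable] = c y
  have "(\<lambda>\<omega>. emeasure (m \<omega>) A + (\<Sum>j\<in>I. ennreal (c j \<omega>) * indicator A (y j \<omega>))) \<in> borel_measurable M"
    by measurable
  also have "?this \<longleftrightarrow> (\<lambda>\<omega>. emeasure (add_atoms (m \<omega>) I (\<lambda>j. c j \<omega>) (\<lambda>j. y j \<omega>)) A) \<in> borel_measurable M"
    by (intro measurable_cong) (simp add: emeasure_add_atoms I sets_boundedly_finite bf)
  finally show "(\<lambda>\<omega>. emeasure (add_atoms (m \<omega>) I (\<lambda>j. c j \<omega>) (\<lambda>j. y j \<omega>)) A) \<in> borel_measurable M" .
qed

lemma gamma_variableD: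
  assumes "gamma_variable M T a"
  shows "T \<in> borel_measurable M" "distr M borel T = density lborel (\<lambda>t. ennreal (gamma_density a t))" "AE \<omega> in M. 0 < T \<omega>"
proof -
  have d: "distributed M lborel T (\<lambda>t. ennreal (gamma_density a t))"
    using assms by (simp add: gamma_variable_def)
  then show [measurable]: "T \<in> borel_measurable M" using distributed_measurable[OF d] by simp
  have "distr M borel T = distr M lborel T" by (rule distr_cong) simp_all
  then show eq: "distr M borel T = density lborel (\<lambda>t. ennreal (gamma_density a t))"
    using distributed_distr_eq_density[OF d] by simp
  have "AE t in distr M borel T. 0 < t"
    unfolding eq by (subst AE_density) (auto intro!: AE_I2 simp: gamma_density_def)
  then show "AE \<omega> in M. 0 < T \<omega>" by (subst (asm) AE_distr_iff) auto
qed

lemma beta_variableD: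
  assumes "beta_variable M T a b"
  shows "T \<in> borel_measurable M" "distr M borel T = density lborel (\<lambda>t. ennreal (beta_density a b t))" "AE \<omega> in M. 0 < T \<omega>"
proof -
  have d: "distributed M lborel T (\<lambda>t. ennreal (beta_density a b t))"
    using assms by (simp add: beta_variable_def)
  then show [measurable]: "T \<in> borel_measurable M" using distributed_measurable[OF d] by simp
  have "distr M borel T = distr M lborel T" by (rule distr_cong) simp_all
  then show eq: "distr M borel T = density lborel (\<lambda>t. ennreal (beta_density a b t))"
    using distributed_distr_eq_density[OF d] by simp
  have "AE t in distr M borel T. 0 < t"
    unfolding eq by (subst AE_density) (auto intro!: AE_I2 simp: beta_density_def)
  then show "AE \<omega> in M. 0 < T \<omega>" by (subst (asm) AE_distr_iff) auto
qed

lemma measurable_ident_sigma: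
  assumes "A \<subseteq> B" "B \<subseteq> Pow \<Omega>"
  shows "(\<lambda>\<omega>. \<omega>) \<in> measurable (sigma \<Omega> B) (sigma \<Omega> A)"
proof (rule measurable_measure_of)
  show "(\<lambda>\<omega>. \<omega>) -` y \<inter> space (sigma \<Omega> B) \<in> sets (sigma \<Omega> B)" if "y \<in> A" for y
  proof -
    have "(\<lambda>\<omega>. \<omega>) -` y \<inter> space (sigma \<Omega> B) = y"
      using that assms by (auto simp: space_measure_of[OF assms(2)])
    then show ?thesis using that assms by (auto simp: sets_measure_of[OF assms(2)] intro: sigma_sets.Basic)
  qed
qed (use assms in \<open>auto simp: space_measure_of[OF assms(2)]\<close>)

lemma measurable_sigma_generated:
  assumes "Y \<in> measurable M L" "generated M L Y \<in> set Fs" "\<Union>(set Fs) \<subseteq> sets M"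
  shows "Y \<in> measurable (sigma (space M) (\<Union>(set Fs))) L"
proof (rule measurable_generated[OF assms(1)])
  show "generated M L Y \<subseteq> sigma_sets (space M) (\<Union>(set Fs))"
    using assms(2) by (auto intro: sigma_sets.Basic)
  show "\<Union>(set Fs) \<subseteq> Pow (space M)" using assms(3) sets.space_closed by blast
qed

section \<open>Laplace functionals of the scaled processes and mixtures\<close>

text \<open>First \<open>U\<close> and then \<open>\<mu>\<close> are frozen, each being independent
  of what comes after it in the list. The factor \<open>w\<close> may depend on \<open>U\<close> and
  on the variables behind \<open>Fs\<close>; in the applications it carries the atoms.\<close>

lemma nn_integral_scaled_process:
  fixes \<mu> :: "'w \<Rightarrow> 'a::polish_space measure"
  assumes M: "prob_space M"
    and indep: "mutually_indep M (generated M borel U # generated M bf_algebra \<mu> # Fs)"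
    and Int: "\<And>E. E \<in> set Fs \<Longrightarrow> Int_stable E"
    and U [measurable]: "U \<in> borel_measurable M" and \<mu> [measurable]: "\<mu> \<in> measurable M bf_algebra"
    and f: "f \<in> test_functions"
    and w: "case_prod w \<in> borel_measurable (borel \<Otimes>\<^sub>M sigma (space M) (\<Union>(set Fs)))"
  shows "(\<integral>\<^sup>+\<omega>. elap f (scale_measure (ennreal (U \<omega>)) (\<mu> \<omega>)) * w (U \<omega>) \<omega> \<partial>M) =
    (\<integral>\<^sup>+u. (\<integral>\<^sup>+m. elap f (scale_measure (ennreal u) m) \<partial>distr M bf_algebra \<mu>) * (\<integral>\<^sup>+\<omega>. w u \<omega> \<partial>M) \<partial>distr M borel U)"
proof -
  note [measurable] = test_functionsD(1)[OF f]
  let ?G = "generated M bf_algebra \<mu> # Fs"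
  have ev: "\<Union>(set ?G) \<subseteq> sets M" "\<Union>(set Fs) \<subseteq> sets M"
    using mutually_indep_events[OF M indep] by auto
  note indep' = mutually_indep_ConsD[OF M indep]
  have IntG: "Int_stable E" if "E \<in> set ?G" for E using that Int Int_stable_generated by auto
  have sub: "(\<lambda>\<omega>. \<omega>) \<in> measurable (sigma (space M) (\<Union>(set ?G))) (sigma (space M) (\<Union>(set Fs)))"
    by (rule measurable_ident_sigma) (use ev sets.space_closed[of M] in auto)
  have \<mu>G [measurable]: "\<mu> \<in> measurable (sigma (space M) (\<Union>(set ?G))) bf_algebra"
    by (rule measurable_sigma_generated[OF \<mu> _ ev(1)]) simp
  have w' [measurable]: "(\<lambda>(u, \<omega>). w u \<omega>) \<in> borel_measurable (borel \<Otimes>\<^sub>M sigma (space M) (\<Union>(set ?G)))"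
  proof -
    have "(\<lambda>z. (fst z, snd z)) \<in> measurable (borel \<Otimes>\<^sub>M sigma (space M) (\<Union>(set ?G))) (borel \<Otimes>\<^sub>M sigma (space M) (\<Union>(set Fs)))"
      by (intro measurable_Pair measurable_fst measurable_compose[OF measurable_snd sub])
    from measurable_compose[OF this w] show ?thesis by (simp add: case_prod_beta)
  qed
  have "(\<integral>\<^sup>+\<omega>. elap f (scale_measure (ennreal (U \<omega>)) (\<mu> \<omega>)) * w (U \<omega>) \<omega> \<partial>M) =
      (\<integral>\<^sup>+u. (\<integral>\<^sup>+\<omega>. elap f (scale_measure (ennreal u) (\<mu> \<omega>)) * w u \<omega> \<partial>M) \<partial>distr M borel U)"
    by (rule nn_integral_freeze(1)[OF M indep IntG U]) measurable
  also have "\<dots> = (\<integral>\<^sup>+u. (\<integral>\<^sup>+m. elap f (scale_measure (ennreal u) m) \<partial>distr M bf_algebra \<mu>) * (\<integral>\<^sup>+\<omega>. w u \<omega> \<partial>M) \<partial>distr M borel U)"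
  proof (intro nn_integral_cong)
    fix u :: real
    have wu [measurable]: "w u \<in> borel_measurable (sigma (space M) (\<Union>(set Fs)))"
      using measurable_Pair2[OF w, of u] by simp
    have "(\<lambda>\<omega>. \<omega>) \<in> measurable M (sigma (space M) (\<Union>(set Fs)))"
      using ev sets.space_closed[of M] sets.sets_into_space[of _ M]
      by (intro measurable_measure_of) (auto simp: Int_absorb2)
    from measurable_compose[OF this wu] have wuM: "w u \<in> borel_measurable M" .
    have "(\<integral>\<^sup>+\<omega>. elap f (scale_measure (ennreal u) (\<mu> \<omega>)) * w u \<omega> \<partial>M) =
        (\<integral>\<^sup>+m. (\<integral>\<^sup>+\<omega>. elap f (scale_measure (ennreal u) m) * w u \<omega> \<partial>M) \<partial>distr M bf_algebra \<mu>)"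
      by (rule nn_integral_freeze(1)[OF M indep' Int \<mu>]) measurable
    also have "\<dots> = (\<integral>\<^sup>+m. elap f (scale_measure (ennreal u) m) \<partial>distr M bf_algebra \<mu>) * (\<integral>\<^sup>+\<omega>. w u \<omega> \<partial>M)"
      using wuM by (simp add: nn_integral_cmult nn_integral_multc)
    finally show "(\<integral>\<^sup>+\<omega>. elap f (scale_measure (ennreal u) (\<mu> \<omega>)) * w u \<omega> \<partial>M) =
        (\<integral>\<^sup>+m. elap f (scale_measure (ennreal u) m) \<partial>distr M bf_algebra \<mu>) * (\<integral>\<^sup>+\<omega>. w u \<omega> \<partial>M)" .
  qed
  finally show ?thesis .
qed

lemma gamma_expectation_exp:
  assumes T: "gamma_variable M T a" and a: "0 < a" and x: "0 \<le> x"
  shows "(\<integral>\<^sup>+\<omega>. ennreal (exp (- (x * T \<omega>))) \<partial>M) = ennreal ((1 + x) powr (- a))"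
proof -
  note [measurable] = gamma_variableD(1)[OF T]
  have "(\<integral>\<^sup>+\<omega>. ennreal (exp (- (x * T \<omega>))) \<partial>M) = (\<integral>\<^sup>+t. ennreal (exp (- (x * t))) \<partial>distr M borel T)"
    by (subst nn_integral_distr) auto
  also have "\<dots> = (\<integral>\<^sup>+t. ennreal (gamma_density a t) * ennreal (exp (- (x * t))) \<partial>lborel)"
    unfolding gamma_variableD(2)[OF T] by (rule nn_integral_density) measurable
  finally show ?thesis using gamma_density_Laplace[OF a x] by simp
qed

context gamma_law
begin

lemma gamma_processD:
  assumes "gamma_process M \<mu> (scale_measure (ennreal \<theta>) H)"
  shows "\<mu> \<in> measurable M bf_algebra" "distr M bf_algebra \<mu> = G"
proof -
  show "\<mu> \<in> measurable M bf_algebra" using assms by (simp add: gamma_process_def)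
  show "distr M bf_algebra \<mu> = G"
    by (rule gamma_process_law_unique[where H = H and \<theta> = \<theta>])
       (use assms prob_H \<theta> gamma_law_axioms in \<open>auto simp: gamma_process_def gamma_law_def\<close>)
qed

lemma dirichlet_processD:
  assumes "dirichlet_process M P (scale_measure (ennreal \<theta>) H)"
  shows "P \<in> measurable M bf_algebra" "distr M bf_algebra P = distr G bf_algebra normalized"
proof -
  show "P \<in> measurable M bf_algebra" using assms by (simp add: dirichlet_process_def)
  obtain G' where G': "gamma_process_law (scale_measure (ennreal \<theta>) H) G'"
    and eq: "distr M bf_algebra P = distr G' bf_algebra normalized"
    using assms by (auto simp: dirichlet_process_def dirichlet_law_def)
  have "G' = G"
    by (rule gamma_process_law_unique[where H = H and \<theta> = \<theta>])
       (use G' prob_H \<theta> gamma_law_axioms in \<open>auto simp: gamma_law_def\<close>)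
  then show "distr M bf_algebra P = distr G bf_algebra normalized" using eq by simp
qed

lemma Laplace_scaled_G:
  assumes "f \<in> test_functions" "0 \<le> u"
  shows "(\<integral>\<^sup>+m. elap f (scale_measure (ennreal u) m) \<partial>G) = ennreal (exp (- (\<theta> * log_mean (\<lambda>x. u * f x))))"
  unfolding Laplace_G[OF test_functions_cmult[OF assms], symmetric]
  by (intro nn_integral_cong) (simp only: space_G elap_scale_measure[OF _ assms])

lemma nn_integral_beta_scaled_process:
  assumes M: "prob_space M" and U: "beta_variable M U a b"
    and \<mu>: "gamma_process M \<mu> (scale_measure (ennreal \<theta>) H)"
    and indep: "mutually_indep M (generated M borel U # generated M bf_algebra \<mu> # Fs)"
    and Int: "\<And>E. E \<in> set Fs \<Longrightarrow> Int_stable E"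
    and f: "f \<in> test_functions"
    and w: "case_prod w \<in> borel_measurable (borel \<Otimes>\<^sub>M sigma (space M) (\<Union>(set Fs)))"
  shows "(\<integral>\<^sup>+\<omega>. elap f (scale_measure (ennreal (U \<omega>)) (\<mu> \<omega>)) * w (U \<omega>) \<omega> \<partial>M) =
    (\<integral>\<^sup>+u. ennreal (beta_density a b u) *
      (ennreal (exp (- (\<theta> * log_mean (\<lambda>x. u * f x)))) * (\<integral>\<^sup>+\<omega>. w u \<omega> \<partial>M)) \<partial>lborel)"
proof -
  interpret M: prob_space M by fact
  note [measurable] = test_functionsD(1)[OF f]
  have ev: "\<Union>(set Fs) \<subseteq> sets M" using mutually_indep_events[OF M indep] by auto
  have "(\<lambda>\<omega>. \<omega>) \<in> measurable M (sigma (space M) (\<Union>(set Fs)))"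
    using ev sets.space_closed[of M] sets.sets_into_space[of _ M]
    by (intro measurable_measure_of) (auto simp: Int_absorb2)
  then have "(\<lambda>z. (fst z, snd z)) \<in> measurable (borel \<Otimes>\<^sub>M M) (borel \<Otimes>\<^sub>M sigma (space M) (\<Union>(set Fs)))"
    by (intro measurable_Pair measurable_fst measurable_compose[OF measurable_snd])
  from measurable_compose[OF this w] have [measurable]: "case_prod w \<in> borel_measurable (borel \<Otimes>\<^sub>M M)"
    by (simp add: case_prod_beta)
  have "(\<integral>\<^sup>+\<omega>. elap f (scale_measure (ennreal (U \<omega>)) (\<mu> \<omega>)) * w (U \<omega>) \<omega> \<partial>M) =
      (\<integral>\<^sup>+u. (\<integral>\<^sup>+m. elap f (scale_measure (ennreal u) m) \<partial>G) * (\<integral>\<^sup>+\<omega>. w u \<omega> \<partial>M) \<partial>density lborel (\<lambda>u. ennreal (beta_density a b u)))"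
    using nn_integral_scaled_process[OF M indep Int beta_variableD(1)[OF U] gamma_processD(1)[OF \<mu>] f w]
    unfolding gamma_processD(2)[OF \<mu>] beta_variableD(2)[OF U] .
  also have "\<dots> = (\<integral>\<^sup>+u. ennreal (beta_density a b u) *
      ((\<integral>\<^sup>+m. elap f (scale_measure (ennreal u) m) \<partial>G) * (\<integral>\<^sup>+\<omega>. w u \<omega> \<partial>M)) \<partial>lborel)"
    by (rule nn_integral_density) measurable
  also have "\<dots> = (\<integral>\<^sup>+u. ennreal (beta_density a b u) *
      (ennreal (exp (- (\<theta> * log_mean (\<lambda>x. u * f x)))) * (\<integral>\<^sup>+\<omega>. w u \<omega> \<partial>M)) \<partial>lborel)"
  \<comment> \<open>The Laplace functional of the scaled process is computed for nonnegative
    \<open>u\<close>; elsewhere the Beta density vanishes.\<close>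
  proof (intro nn_integral_cong)
    fix u :: real
    show "ennreal (beta_density a b u) * ((\<integral>\<^sup>+m. elap f (scale_measure (ennreal u) m) \<partial>G) * (\<integral>\<^sup>+\<omega>. w u \<omega> \<partial>M)) =
      ennreal (beta_density a b u) * (ennreal (exp (- (\<theta> * log_mean (\<lambda>x. u * f x)))) * (\<integral>\<^sup>+\<omega>. w u \<omega> \<partial>M))"
      by (cases "0 < u") (simp_all only: Laplace_scaled_G[OF f] less_imp_le, simp add: beta_density_def)
  qed
  finally show ?thesis .
qed

lemma urn_Laplace_1:
  assumes f: "f \<in> test_functions"
  shows "urn_Laplace 1 f = (\<integral>\<^sup>+x. ennreal (1 / (1 + f x)) \<partial>H)"
proof -
  note [measurable] = test_functionsD(1)[OF f]
  have f0: "0 \<le> f x" for x by (rule test_functionsD(2)[OF f])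
  have I: "(\<integral>\<^sup>+x. ennreal (1 / (1 + f x)) \<partial>H) = ennreal (\<integral>x. 1 / (1 + f x) \<partial>H)"
  proof (rule nn_integral_bounded_eq_integral[where B = 1])
    show "0 \<le> 1 / (1 + f x)" "1 / (1 + f x) \<le> 1" for x using f0[of x] by auto
  qed (auto simp: H.finite_measure_axioms)
  have one: "emeasure (BM 0) (space (BM 0)) = 1"
    using nn_integral_blackwell_macqueen[OF prob_H sets_H, of "\<lambda>_. 1" 0 \<theta>] \<theta> Gamma_real_pos[OF \<theta>] by simp
  show ?thesis
    using urn_Laplace_Suc[OF f, of 0] one \<theta> f0 I by (simp add: ennreal_mult[symmetric])
qed

text \<open>The case \<open>n = 1\<close> with independent variables in place of the conditional
  model. Given \<open>Y\<close>, the exponential mass contributes \<open>1 / (1 + u * f Y)\<close>,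
  whose mean is \<open>urn_Laplace 1\<close>. Keeping \<open>q\<close> general serves both
  identities of part (ii).\<close>

lemma single_atom_Laplace:
  assumes M: "prob_space M" and U: "beta_variable M U q (\<theta> + 1 - q)" and q: "0 < q" "0 < \<theta> + 1 - q"
    and \<mu>: "gamma_process M \<mu> (scale_measure (ennreal \<theta>) H)" and T: "gamma_variable M T 1"
    and Y: "Y \<in> measurable M borel" "distr M borel Y = H"
    and indep: "mutually_indep M [generated M borel U, generated M bf_algebra \<mu>, generated M borel T, generated M borel Y]"
    and f: "f \<in> test_functions"
  shows "(\<integral>\<^sup>+\<omega>. elap f (add_atoms (scale_measure (ennreal (U \<omega>)) (\<mu> \<omega>)) {1} (\<lambda>_. U \<omega> * T \<omega>) (\<lambda>_. Y \<omega>)) \<partial>M) = \<Phi> q f"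
proof -
  let ?Fs = "[generated M borel T, generated M borel Y]"
  note [measurable] = test_functionsD(1)[OF f] gamma_variableD(1)[OF T] Y(1)
  note indep3 = mutually_indep_ConsD[OF M mutually_indep_ConsD[OF M indep]]
  have ev: "\<Union>(set ?Fs) \<subseteq> sets M" "\<Union>(set [generated M borel Y]) \<subseteq> sets M"
    using mutually_indep_events[OF M indep3] by auto
  define w where "w u \<omega> = ennreal (exp (- (u * T \<omega> * f (Y \<omega>))))" for u \<omega>
  have \<mu>m: "\<mu> \<in> measurable M bf_algebra" by (rule gamma_processD(1)[OF \<mu>])
  have "(\<integral>\<^sup>+\<omega>. elap f (add_atoms (scale_measure (ennreal (U \<omega>)) (\<mu> \<omega>)) {1} (\<lambda>_. U \<omega> * T \<omega>) (\<lambda>_. Y \<omega>)) \<partial>M) =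
      (\<integral>\<^sup>+\<omega>. elap f (scale_measure (ennreal (U \<omega>)) (\<mu> \<omega>)) * w (U \<omega>) \<omega> \<partial>M)"
  proof (intro nn_integral_cong_AE)
    from beta_variableD(3)[OF U] gamma_variableD(3)[OF T] AE_space
    show "AE \<omega> in M. elap f (add_atoms (scale_measure (ennreal (U \<omega>)) (\<mu> \<omega>)) {1} (\<lambda>_. U \<omega> * T \<omega>) (\<lambda>_. Y \<omega>)) =
      elap f (scale_measure (ennreal (U \<omega>)) (\<mu> \<omega>)) * w (U \<omega>) \<omega>"
    proof eventually_elim
      case (elim \<omega>)
      have "scale_measure (ennreal (U \<omega>)) (\<mu> \<omega>) \<in> boundedly_finite"
        using measurable_space[OF \<mu>m elim(3)] by (simp add: scale_measure_boundedly_finite)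
      then show ?case
        using elim by (subst elap_add_atoms) (auto simp: f w_def)
    qed
  qed
  also have "\<dots> = (\<integral>\<^sup>+u. ennreal (beta_density q (\<theta> + 1 - q) u) *
      (ennreal (exp (- (\<theta> * log_mean (\<lambda>x. u * f x)))) * (\<integral>\<^sup>+\<omega>. w u \<omega> \<partial>M)) \<partial>lborel)"
  proof (rule nn_integral_beta_scaled_process[OF M U \<mu> indep _ f])
    have [measurable]: "T \<in> borel_measurable (sigma (space M) (\<Union>(set ?Fs)))" "Y \<in> borel_measurable (sigma (space M) (\<Union>(set ?Fs)))"
      by (rule measurable_sigma_generated[OF _ _ ev(1)]; simp)+
    show "case_prod w \<in> borel_measurable (borel \<Otimes>\<^sub>M sigma (space M) (\<Union>(set ?Fs)))"
      unfolding w_def by measurable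
  qed (auto simp: Int_stable_generated)
  also have "\<dots> = (\<integral>\<^sup>+u. ennreal (beta_density q (\<theta> + real 1 - q) u) *
      (ennreal (exp (- (\<theta> * log_mean (\<lambda>x. u * f x)))) * urn_Laplace 1 (\<lambda>x. u * f x)) \<partial>lborel)"
  proof (intro nn_integral_cong)
    fix u :: real
    show "ennreal (beta_density q (\<theta> + 1 - q) u) * (ennreal (exp (- (\<theta> * log_mean (\<lambda>x. u * f x)))) * (\<integral>\<^sup>+\<omega>. w u \<omega> \<partial>M)) =
      ennreal (beta_density q (\<theta> + real 1 - q) u) * (ennreal (exp (- (\<theta> * log_mean (\<lambda>x. u * f x)))) * urn_Laplace 1 (\<lambda>x. u * f x))"
    proof (cases "0 < u")
      case True
      have [measurable]: "Y \<in> borel_measurable (sigma (space M) (\<Union>(set [generated M borel Y])))"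
        by (rule measurable_sigma_generated[OF _ _ ev(2)]) simp_all
      have "(\<integral>\<^sup>+\<omega>. w u \<omega> \<partial>M) = (\<integral>\<^sup>+\<omega>. (\<integral>\<^sup>+t. ennreal (exp (- (u * t * f (Y \<omega>)))) \<partial>distr M borel T) \<partial>M)"
        unfolding w_def
      proof (rule nn_integral_freeze(2)[OF M indep3])
        show "(\<lambda>(t, \<omega>). ennreal (exp (- (u * t * f (Y \<omega>))))) \<in> borel_measurable (borel \<Otimes>\<^sub>M sigma (space M) (\<Union>(set [generated M borel Y])))"
          by measurable
      qed (simp_all add: Int_stable_generated)
      also have "\<dots> = (\<integral>\<^sup>+\<omega>. ennreal (1 / (1 + u * f (Y \<omega>))) \<partial>M)"
      proof (intro nn_integral_cong)
        fix \<omega>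
        have "0 \<le> u * f (Y \<omega>)" using True test_functionsD(2)[OF f] by simp
        then show "(\<integral>\<^sup>+t. ennreal (exp (- (u * t * f (Y \<omega>)))) \<partial>distr M borel T) = ennreal (1 / (1 + u * f (Y \<omega>)))"
          using gamma_expectation_exp[OF T, of "u * f (Y \<omega>)"]
          by (subst nn_integral_distr) (simp_all add: mult_ac powr_minus_divide)
      qed
      also have "\<dots> = (\<integral>\<^sup>+x. ennreal (1 / (1 + u * f x)) \<partial>distr M borel Y)"
        by (subst nn_integral_distr) auto
      also have "\<dots> = urn_Laplace 1 (\<lambda>x. u * f x)"
        unfolding Y(2) using True by (intro urn_Laplace_1[symmetric] test_functions_cmult f) simp
      finally show ?thesis by simp
    qed (simp add: beta_density_def)
  qed
  also have "\<dots> = \<Phi> q f"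
    by (rule beta_mixture[OF f q(1)]) (use q in simp)
  finally show ?thesis .
qed

text \<open>Here \<open>T\<close> is integrated out for a fixed \<open>P\<close>: the Laplace
  transform of the Gamma variable at \<open>P f\<close> is
  \<open>(1 + P f) powr (- q)\<close>.\<close>

lemma scaled_dirichlet_Laplace:
  assumes M: "prob_space M" and T: "gamma_variable M T q" and q: "0 < q"
    and P: "dirichlet_process M P (scale_measure (ennreal \<theta>) H)"
    and indep: "mutually_indep M [generated M borel T, generated M bf_algebra P]"
    and f: "f \<in> test_functions"
  shows "(\<integral>\<^sup>+\<omega>. elap f (scale_measure (ennreal (T \<omega>)) (P \<omega>)) \<partial>M) = \<Phi> q f"
proof -
  let ?Fs = "[generated M bf_algebra P]"
  note [measurable] = test_functionsD(1)[OF f] gamma_variableD(1)[OF T] dirichlet_processD(1)[OF P]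
  have ev: "\<Union>(set ?Fs) \<subseteq> sets M" using mutually_indep_events[OF M indep] by auto
  have [measurable]: "P \<in> measurable (sigma (space M) (\<Union>(set ?Fs))) bf_algebra"
    by (rule measurable_sigma_generated[OF _ _ ev]) simp_all
  let ?g = "density lborel (\<lambda>t. ennreal (gamma_density q t))"
  have "(\<integral>\<^sup>+\<omega>. elap f (scale_measure (ennreal (T \<omega>)) (P \<omega>)) \<partial>M) =
      (\<integral>\<^sup>+\<omega>. (\<integral>\<^sup>+t. elap f (scale_measure (ennreal t) (P \<omega>)) \<partial>distr M borel T) \<partial>M)"
  proof (rule nn_integral_freeze(2)[OF M indep])
    show "(\<lambda>(t, \<omega>). elap f (scale_measure (ennreal t) (P \<omega>))) \<in> borel_measurable (borel \<Otimes>\<^sub>M sigma (space M) (\<Union>(set ?Fs)))"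
      by measurable
  qed (simp_all add: Int_stable_generated)
  also have "\<dots> = (\<integral>\<^sup>+p. (\<integral>\<^sup>+t. elap f (scale_measure (ennreal t) p) \<partial>?g) \<partial>distr M bf_algebra P)"
    unfolding gamma_variableD(2)[OF T]
    using prob_space_gamma_density[OF q] sigma_finite_measure.borel_measurable_nn_integral[of ?g]
    by (subst nn_integral_distr) (auto intro!: sigma_finite_measure.borel_measurable_nn_integral prob_space_imp_sigma_finite)
  also have "\<dots> = (\<integral>\<^sup>+m. (\<integral>\<^sup>+t. elap f (scale_measure (ennreal t) (normalized m)) \<partial>?g) \<partial>G)"
    unfolding dirichlet_processD(2)[OF P]
    by (subst nn_integral_distr)
       (auto intro!: sigma_finite_measure.borel_measurable_nn_integral prob_space_imp_sigma_finite prob_space_gamma_density[OF q])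
  also have "\<dots> = \<Phi> q f"
    unfolding \<Phi>_def
  proof (intro nn_integral_cong_AE)
    from AE_mass AE_space show "AE m in G. (\<integral>\<^sup>+t. elap f (scale_measure (ennreal t) (normalized m)) \<partial>?g) = ennreal ((1 + mean f m) powr (- q))"
    proof eventually_elim
      case (elim m)
      then have m: "m \<in> boundedly_finite" by simp
      have "total_mass (normalized m) = 1"
        using elim(1) by (simp add: normalized_def total_mass_scale_measure)
      then have fin: "(\<integral>\<^sup>+x. ennreal (f x) \<partial>normalized m) = ennreal (mean f m)"
        using nn_integral_eq_mass_mean[OF normalized_boundedly_finite[OF m] _ f] elim(1)
          mean_scale_measure[of "1 / total_mass m" f m] by (simp add: normalized_def)
      have "(\<integral>\<^sup>+t. elap f (scale_measure (ennreal t) (normalized m)) \<partial>?g) =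
          (\<integral>\<^sup>+t. ennreal (gamma_density q t) * elap f (scale_measure (ennreal t) (normalized m)) \<partial>lborel)"
        by (rule nn_integral_density)
           (auto intro!: measurable_compose[OF measurable_scale_measure_bf[where m = "\<lambda>_. normalized m"] measurable_elap]
             simp: normalized_boundedly_finite m)
      also have "\<dots> = (\<integral>\<^sup>+t. ennreal (gamma_density q t) * ennreal (exp (- (mean f m * t))) \<partial>lborel)"
      proof (intro nn_integral_cong)
        fix t :: real
        show "ennreal (gamma_density q t) * elap f (scale_measure (ennreal t) (normalized m)) =
          ennreal (gamma_density q t) * ennreal (exp (- (mean f m * t)))"
        proof (cases "0 < t")
          case True
          have "(\<integral>\<^sup>+x. ennreal (f x) \<partial>scale_measure (ennreal t) (normalized m)) = ennreal (t * mean f m)"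
            using True measurable_boundedly_finite[OF normalized_boundedly_finite[OF m] test_functionsD(1)[OF f]]
            by (simp add: nn_integral_scale_measure fin ennreal_mult mean_nonneg)
          then show ?thesis using True mean_nonneg[of f m] by (simp add: mult.commute)
        qed (simp add: gamma_density_def)
      qed
      finally show ?case using gamma_density_Laplace[OF q mean_nonneg[of f m]] by simp
    qed
  qed
  finally show ?thesis .
qed

text \<open>Resolving the power by the Laplace transform of a second Gamma variable gives the
  expectation of \<open>exp (- s t P f)\<close> with independent Gamma variables \<open>s\<close>
  and \<open>t\<close>. In this form the shapes \<open>a\<close> and \<open>b\<close> play symmetric
  roles.\<close>

lemma gamma_mixture:
  assumes f: "f \<in> test_functions" and a: "0 < a" and b: "0 < b"
  shows "(\<integral>\<^sup>+s. ennreal (gamma_density a s) * \<Phi> b (\<lambda>x. s * f x) \<partial>lborel) =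
    (\<integral>\<^sup>+m. (\<integral>\<^sup>+s. (\<integral>\<^sup>+t. ennreal (gamma_density a s) * ennreal (gamma_density b t) * ennreal (exp (- (s * t * mean f m))) \<partial>lborel) \<partial>lborel) \<partial>G)"
proof -
  note [measurable] = test_functionsD(1)[OF f]
  interpret pair_sigma_finite lborel G by unfold_locales
  have "(\<integral>\<^sup>+s. ennreal (gamma_density a s) * \<Phi> b (\<lambda>x. s * f x) \<partial>lborel) =
      (\<integral>\<^sup>+s. (\<integral>\<^sup>+m. (\<integral>\<^sup>+t. ennreal (gamma_density a s) * ennreal (gamma_density b t) * ennreal (exp (- (s * t * mean f m))) \<partial>lborel) \<partial>G) \<partial>lborel)"
  proof (intro nn_integral_cong)
    fix s :: real
    show "ennreal (gamma_density a s) * \<Phi> b (\<lambda>x. s * f x) =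
      (\<integral>\<^sup>+m. (\<integral>\<^sup>+t. ennreal (gamma_density a s) * ennreal (gamma_density b t) * ennreal (exp (- (s * t * mean f m))) \<partial>lborel) \<partial>G)"
    proof (cases "0 < s")
      case True
      have "(\<integral>\<^sup>+t. ennreal (gamma_density a s) * ennreal (gamma_density b t) * ennreal (exp (- (s * t * mean f m))) \<partial>lborel) =
          ennreal (gamma_density a s) * ennreal ((1 + s * mean f m) powr (- b))" for m
        using gamma_density_Laplace[OF b, of "s * mean f m"] True mean_nonneg[of f m]
        by (simp add: mult.assoc nn_integral_cmult) (simp add: mult_ac)
      then show ?thesis
        using True \<Phi>_cmult[OF f, of s b] by (simp add: nn_integral_cmult)
    qed (simp add: gamma_density_def)
  qed
  also have "\<dots> = (\<integral>\<^sup>+m. (\<integral>\<^sup>+s. (\<integral>\<^sup>+t. ennreal (gamma_density a s) * ennreal (gamma_density b t) * ennreal (exp (- (s * t * mean f m))) \<partial>lborel) \<partial>lborel) \<partial>G)"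
    by (rule Fubini'[symmetric]) measurable
  finally show ?thesis .
qed

lemma gamma_mixture_commute:
  assumes f: "f \<in> test_functions" and a: "0 < a" and b: "0 < b"
  shows "(\<integral>\<^sup>+s. ennreal (gamma_density a s) * \<Phi> b (\<lambda>x. s * f x) \<partial>lborel) =
    (\<integral>\<^sup>+s. ennreal (gamma_density b s) * \<Phi> a (\<lambda>x. s * f x) \<partial>lborel)"
  unfolding gamma_mixture[OF f a b] gamma_mixture[OF f b a]
proof (rule nn_integral_cong)
  fix m
  show "(\<integral>\<^sup>+s. (\<integral>\<^sup>+t. ennreal (gamma_density a s) * ennreal (gamma_density b t) * ennreal (exp (- (s * t * mean f m))) \<partial>lborel) \<partial>lborel) =
    (\<integral>\<^sup>+s. (\<integral>\<^sup>+t. ennreal (gamma_density b s) * ennreal (gamma_density a t) * ennreal (exp (- (s * t * mean f m))) \<partial>lborel) \<partial>lborel)"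
  proof -
    have "(\<integral>\<^sup>+s. (\<integral>\<^sup>+t. ennreal (gamma_density a s) * ennreal (gamma_density b t) * ennreal (exp (- (s * t * mean f m))) \<partial>lborel) \<partial>lborel) =
        (\<integral>\<^sup>+t. (\<integral>\<^sup>+s. ennreal (gamma_density a s) * ennreal (gamma_density b t) * ennreal (exp (- (s * t * mean f m))) \<partial>lborel) \<partial>lborel)"
      by (rule lborel_pair.Fubini'[symmetric]) measurable
    then show ?thesis by (simp add: mult_ac)
  qed
qed

text \<open>Used for a Beta-Gamma process scaled by a Gamma variable of shape
  \<open>\<theta>\<close> and for a Gamma process scaled by one of shape \<open>q\<close>. The
  hypothesis \<open>L\<close> is what the two processes have in common, with orders
  \<open>b = q\<close> and \<open>b = \<theta>\<close>.\<close>

lemma gamma_scaled_Laplace: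
  assumes M: "prob_space M" and T: "gamma_variable M T a"
    and \<mu>: "\<mu> \<in> measurable M bf_algebra"
    and indep: "mutually_indep M [generated M borel T, generated M bf_algebra \<mu>]"
    and f: "f \<in> test_functions"
    and L: "\<And>f. f \<in> test_functions \<Longrightarrow> (\<integral>\<^sup>+m. elap f m \<partial>distr M bf_algebra \<mu>) = \<Phi> b f"
  shows "(\<integral>\<^sup>+\<omega>. elap f (scale_measure (ennreal (T \<omega>)) (\<mu> \<omega>)) \<partial>M) = (\<integral>\<^sup>+s. ennreal (gamma_density a s) * \<Phi> b (\<lambda>x. s * f x) \<partial>lborel)"
proof -
  interpret M: prob_space M by fact
  note [measurable] = test_functionsD(1)[OF f] \<mu>
  have "(\<integral>\<^sup>+\<omega>. elap f (scale_measure (ennreal (T \<omega>)) (\<mu> \<omega>)) * 1 \<partial>M) =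
    (\<integral>\<^sup>+u. (\<integral>\<^sup>+m. elap f (scale_measure (ennreal u) m) \<partial>distr M bf_algebra \<mu>) * (\<integral>\<^sup>+\<omega>. 1 \<partial>M) \<partial>distr M borel T)"
    by (rule nn_integral_scaled_process[where Fs = "[]" and w = "\<lambda>_ _. 1", OF M indep _ gamma_variableD(1)[OF T] \<mu> f]) simp_all
  also have "\<dots> = (\<integral>\<^sup>+u. (\<integral>\<^sup>+m. elap f (scale_measure (ennreal u) m) \<partial>distr M bf_algebra \<mu>) \<partial>density lborel (\<lambda>t. ennreal (gamma_density a t)))"
    unfolding gamma_variableD(2)[OF T] by (simp add: M.emeasure_space_1)
  also have "\<dots> = (\<integral>\<^sup>+u. ennreal (gamma_density a u) * (\<integral>\<^sup>+m. elap f (scale_measure (ennreal u) m) \<partial>distr M bf_algebra \<mu>) \<partial>lborel)"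
    by (rule nn_integral_density)
       (auto intro!: sigma_finite_measure.borel_measurable_nn_integral prob_space_imp_sigma_finite M.prob_space_distr)
  also have "\<dots> = (\<integral>\<^sup>+s. ennreal (gamma_density a s) * \<Phi> b (\<lambda>x. s * f x) \<partial>lborel)"
  proof (intro nn_integral_cong)
    fix s :: real
    show "ennreal (gamma_density a s) * (\<integral>\<^sup>+m. elap f (scale_measure (ennreal s) m) \<partial>distr M bf_algebra \<mu>) = ennreal (gamma_density a s) * \<Phi> b (\<lambda>x. s * f x)"
    proof (cases "0 < s")
      case True
      have "(\<integral>\<^sup>+m. elap f (scale_measure (ennreal s) m) \<partial>distr M bf_algebra \<mu>) = (\<integral>\<^sup>+m. elap (\<lambda>x. s * f x) m \<partial>distr M bf_algebra \<mu>)"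
        using True f by (intro nn_integral_cong elap_scale_measure) simp_all
      then show ?thesis using L[OF test_functions_cmult[OF f, of s]] True by simp
    qed (simp add: gamma_density_def)
  qed
  finally show ?thesis by simp
qed

end

section \<open>The partition of the ties\<close>

context
  fixes p :: "nat set set" and n :: nat
  assumes p: "partition_on {1..n} p"
begin

lemma partition_finite: "finite p"
  using finite_elements[OF _ p] by simp

lemma partition_block: "C \<in> p \<Longrightarrow> C \<subseteq> {1..n}" "C \<in> p \<Longrightarrow> finite C" "C \<in> p \<Longrightarrow> C \<noteq> {}"
proof -
  show sub: "C \<in> p \<Longrightarrow> C \<subseteq> {1..n}" using partition_onD1[OF p] by blast
  show "C \<in> p \<Longrightarrow> finite C" using sub finite_subset by blast
  show "C \<in> p \<Longrightarrow> C \<noteq> {}" using partition_onD3[OF p] by blast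
qed

lemma partition_disjoint: "C \<in> p \<Longrightarrow> D \<in> p \<Longrightarrow> x \<in> C \<Longrightarrow> x \<in> D \<Longrightarrow> C = D"
  using partition_onD2[OF p] by (auto simp: disjoint_def)

lemma Min_block: "C \<in> p \<Longrightarrow> Min C \<in> C"
  using partition_block by (intro Min_in) auto

lemma inj_on_Min: "inj_on Min p"
proof (rule inj_onI)
  fix C D assume "C \<in> p" "D \<in> p" "Min C = Min D"
  with Min_block[of C] Min_block[of D] show "C = D"
    by (intro partition_disjoint[of C D "Min C"]) simp_all
qed

text \<open>Disjoint nonempty blocks have different least elements, so the sorted list of these has
  one entry per block. Blocks are numbered from 1 and list entries from 0.\<close>

lemma bij_betw_block: "bij_betw (block p) {1..card p} p"
proof -
  let ?l = "sorted_list_of_set (Min ` p)"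
  have fin: "finite (Min ` p)" using partition_finite by simp
  have len: "length ?l = card p" using inj_on_Min by (simp add: card_image)
  have l: "set ?l = Min ` p" "distinct ?l" using fin by simp_all
  have block: "block p j \<in> p \<and> Min (block p j) = ?l ! (j - 1)" if j: "j \<in> {1..card p}" for j
  proof -
    have "?l ! (j - 1) \<in> set ?l" using j len by (intro nth_mem) auto
    then obtain C where C: "C \<in> p" "Min C = ?l ! (j - 1)" using l by auto
    have uniq: "D = C" if "D \<in> p \<and> Min D = ?l ! (j - 1)" for D
      using inj_onD[OF inj_on_Min, of D C] that C by simp
    have "block p j = C"
      unfolding block_def using C uniq by (intro the_equality conjI) assumption+
    with C show ?thesis by simp
  qed
  have inj: "inj_on (block p) {1..card p}"
  proof (rule inj_onI)
    fix i j assume ij: "i \<in> {1..card p}" "j \<in> {1..card p}" "block p i = block p j"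
    then have "?l ! (i - 1) = ?l ! (j - 1)" using block[OF ij(1)] block[OF ij(2)] by simp
    moreover have "i - 1 < length ?l" "j - 1 < length ?l" using ij len by auto
    ultimately have "i - 1 = j - 1" using l(2) nth_eq_iff_index_eq by blast
    then show "i = j" using ij by auto
  qed
  moreover have "block p ` {1..card p} = p"
    using block inj partition_finite by (intro card_subset_eq) (auto simp: card_image)
  ultimately show ?thesis by (simp add: bij_betw_def)
qed

lemma block_mem: "j \<in> {1..card p} \<Longrightarrow> block p j \<in> p"
  using bij_betw_block by (auto simp: bij_betw_def)

lemma Min_block_mem: "j \<in> {1..card p} \<Longrightarrow> Min (block p j) \<in> {1..n}"
  using partition_block(1)[OF block_mem] Min_block[OF block_mem] by (rule subsetD)

lemma card_partition_le: "card p \<le> n"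
proof -
  have "card p = card (Min ` p)" using inj_on_Min by (simp add: card_image)
  also have "\<dots> \<le> card {1..n}"
    using Min_block partition_block(1) by (intro card_mono) auto
  finally show ?thesis by simp
qed

lemma ties_eq_on_block: "ties n y = p \<Longrightarrow> C \<in> p \<Longrightarrow> i \<in> C \<Longrightarrow> y i = y (Min C)"
proof -
  assume y: "ties n y = p" and C: "C \<in> p" and i: "i \<in> C"
  from C obtain k where "C = {i\<in>{1..n}. y i = y k}" unfolding y[symmetric] ties_def by blast
  with i Min_block[OF C] show "y i = y (Min C)" by simp
qed

text \<open>Regroups a product over all draws by blocks, on each of which the draws coincide. The
  exponents are the block sizes, which are the shapes of the Gamma masses.\<close>

lemma prod_ties:
  fixes g :: "'b \<Rightarrow> 'c::comm_monoid_mult"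
  assumes y: "ties n y = p"
  shows "(\<Prod>i\<in>{1..n}. g (y i)) = (\<Prod>j\<in>{1..card p}. g (distinct_value p y j) ^ card (block p j))"
proof -
  have "(\<Prod>i\<in>\<Union>p. g (y i)) = (prod \<circ> prod) (\<lambda>i. g (y i)) p"
  proof (rule prod.Union_disjoint)
    show "\<forall>C\<in>p. finite C" using partition_block(2) by blast
    show "\<forall>C\<in>p. \<forall>D\<in>p. C \<noteq> D \<longrightarrow> C \<inter> D = {}" using partition_disjoint by blast
  qed
  then have "(\<Prod>i\<in>{1..n}. g (y i)) = (\<Prod>C\<in>p. \<Prod>i\<in>C. g (y i))"
    unfolding partition_onD1[OF p, symmetric] by simp
  also have "\<dots> = (\<Prod>C\<in>p. g (y (Min C)) ^ card C)"
  proof (intro prod.cong refl)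
    fix C assume "C \<in> p"
    then have "(\<Prod>i\<in>C. g (y i)) = (\<Prod>i\<in>C. g (y (Min C)))"
      using ties_eq_on_block[OF y] by (intro prod.cong) auto
    then show "(\<Prod>i\<in>C. g (y i)) = g (y (Min C)) ^ card C" by simp
  qed
  also have "\<dots> = (\<Prod>j\<in>{1..card p}. g (y (Min (block p j))) ^ card (block p j))"
    by (rule prod.reindex_bij_betw[OF bij_betw_block, symmetric])
  finally show ?thesis by (simp add: distinct_value_def)
qed

end

lemma partition_on_ties: "partition_on {1..n} (ties n y)"
  by (auto simp: partition_on_def ties_def disjoint_def)

text \<open>If \<open>p\<close> is a finite family of subsets of \<open>{1..n}\<close>, the event is
  a finite Boolean combination of the events that two coordinates agree. For any other
  \<open>p\<close> it is empty.\<close>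

lemma sets_ties_event [measurable]:
  fixes Y :: "'w \<Rightarrow> nat \<Rightarrow> 'a::polish_space"
  assumes Y: "Y \<in> measurable M (seq_space n)"
  shows "ties_event M n Y p \<in> sets M"
proof (cases "finite p \<and> (\<forall>C\<in>p. C \<subseteq> {1..n})")
  case True
  have [measurable]: "(\<lambda>\<omega>. Y \<omega> i) \<in> borel_measurable M" if "i \<in> {1..n}" for i
    using measurable_compose[OF Y measurable_component_singleton[OF that]] .
  have "ties n y = p \<longleftrightarrow> (\<forall>k\<in>{1..n}. \<exists>C\<in>p. \<forall>i\<in>{1..n}. y i = y k \<longleftrightarrow> i \<in> C) \<and>
      (\<forall>C\<in>p. \<exists>k\<in>{1..n}. \<forall>i\<in>{1..n}. y i = y k \<longleftrightarrow> i \<in> C)" for y :: "nat \<Rightarrow> 'a"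
  proof -
    define c where "c k = {i\<in>{1..n}. y i = y k}" for k
    have eq: "c k = C \<longleftrightarrow> (\<forall>i\<in>{1..n}. y i = y k \<longleftrightarrow> i \<in> C)" if "C \<in> p" for C k
    proof -
      have "C \<subseteq> {1..n}" using True that by blast
      then show ?thesis unfolding c_def by blast
    qed
    have "ties n y = p \<longleftrightarrow> (\<forall>k\<in>{1..n}. c k \<in> p) \<and> (\<forall>C\<in>p. C \<in> c ` {1..n})"
      unfolding ties_def c_def[symmetric] by blast
    moreover have "c k \<in> p \<longleftrightarrow> (\<exists>C\<in>p. \<forall>i\<in>{1..n}. y i = y k \<longleftrightarrow> i \<in> C)" for k
    proof -
      have "c k \<in> p \<longleftrightarrow> (\<exists>C\<in>p. c k = C)" by auto
      then show ?thesis using eq by (simp only: cong: bex_cong)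
    qed
    moreover have "C \<in> c ` {1..n} \<longleftrightarrow> (\<exists>k\<in>{1..n}. \<forall>i\<in>{1..n}. y i = y k \<longleftrightarrow> i \<in> C)" if "C \<in> p" for C
    proof -
      have "C \<in> c ` {1..n} \<longleftrightarrow> (\<exists>k\<in>{1..n}. c k = C)" by auto
      then show ?thesis using eq[OF that] by (simp only: cong: bex_cong)
    qed
    ultimately show ?thesis by (simp only: cong: ball_cong)
  qed
  then have "ties_event M n Y p = {\<omega>\<in>space M. (\<forall>k\<in>{1..n}. \<exists>C\<in>p. \<forall>i\<in>{1..n}. Y \<omega> i = Y \<omega> k \<longleftrightarrow> i \<in> C) \<and>
      (\<forall>C\<in>p. \<exists>k\<in>{1..n}. \<forall>i\<in>{1..n}. Y \<omega> i = Y \<omega> k \<longleftrightarrow> i \<in> C)}"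
    by (simp add: ties_event_def)
  also have "\<dots> \<in> sets M"
  proof -
    have fin: "finite p" "finite {1..n}" using True by auto
    have pr: "Measurable.pred M (\<lambda>\<omega>. \<forall>i\<in>{1..n}. Y \<omega> i = Y \<omega> k \<longleftrightarrow> i \<in> C)" if "k \<in> {1..n}" for k C
    proof (rule pred_intros_finite(3))
      fix i assume "i \<in> {1..n}"
      with that have "Measurable.pred M (\<lambda>\<omega>. Y \<omega> i = Y \<omega> k)"
        unfolding pred_def by (intro measurable_equality_set) measurable
      then show "Measurable.pred M (\<lambda>\<omega>. Y \<omega> i = Y \<omega> k \<longleftrightarrow> i \<in> C)"
        by (cases "i \<in> C") simp_all
    qed simp
    show ?thesis
      by (intro predE pred_intros_logic pred_intros_finite fin pr)
  qed
  finally show ?thesis .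
next
  case False
  have "ties n y \<noteq> p" for y :: "nat \<Rightarrow> 'a"
    using False partition_finite[OF partition_on_ties[of n y]] partition_block(1)[OF partition_on_ties[of n y]] by blast
  then show ?thesis by (simp add: ties_event_def)
qed

section \<open>Nonatomic base measure\<close>

text \<open>A draw that differs from all earlier ones opens a new block.\<close>

lemma ties_Suc_new:
  assumes "x \<notin> y ` {1..n}"
  shows "ties (Suc n) (y(Suc n := x)) = insert {Suc n} (ties n y)"
proof -
  have old: "{i\<in>{1..Suc n}. (y(Suc n := x)) i = (y(Suc n := x)) k} = {i\<in>{1..n}. y i = y k}" if "k \<in> {1..n}" for k
    using that assms by (auto simp: le_Suc_eq)
  have new: "{i\<in>{1..Suc n}. (y(Suc n := x)) i = (y(Suc n := x)) (Suc n)} = {Suc n}"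
    using assms by (auto simp: le_Suc_eq)
  have img: "(\<lambda>k. {i\<in>{1..Suc n}. (y(Suc n := x)) i = (y(Suc n := x)) k}) ` {1..n} = ties n y"
    unfolding ties_def by (rule image_cong[OF refl old])
  have "{1..Suc n} = insert (Suc n) {1..n}" by auto
  then have "ties (Suc n) (y(Suc n := x)) = insert {i\<in>{1..Suc n}. (y(Suc n := x)) i = (y(Suc n := x)) (Suc n)}
      ((\<lambda>k. {i\<in>{1..Suc n}. (y(Suc n := x)) i = (y(Suc n := x)) k}) ` {1..n})"
    unfolding ties_def by (simp only: image_insert)
  also have "\<dots> = insert {Suc n} (ties n y)"
    unfolding new img ..
  finally show ?thesis .
qed

text \<open>Set-theoretic core of \<open>ties_Suc_old\<close>: \<open>B\<close> is a block before
  the new index joins it and \<open>X\<close> the block afterwards.\<close>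

lemma insert_image_if:
  assumes "\<And>j. j \<in> A \<Longrightarrow> f j \<noteq> B \<longleftrightarrow> \<not> P j"
  shows "insert X ((\<lambda>j. if P j then X else f j) ` A) = insert X (f ` A - {B})"
proof (intro equalityI subsetI)
  fix x assume "x \<in> insert X ((\<lambda>j. if P j then X else f j) ` A)"
  then consider "x = X" | j where "j \<in> A" "\<not> P j" "x = f j" by (auto split: if_splits)
  then show "x \<in> insert X (f ` A - {B})"
    by cases (simp_all add: assms)
next
  fix x assume "x \<in> insert X (f ` A - {B})"
  then consider "x = X" | j where "j \<in> A" "x = f j" "f j \<noteq> B" by blast
  then show "x \<in> insert X ((\<lambda>j. if P j then X else f j) ` A)"
  proof cases
    case 2
    then show ?thesis using assms[of j] by (intro insertI2 image_eqI[of _ _ j]) simp_all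
  qed simp
qed

text \<open>A draw that repeats \<open>y k\<close> joins the block of \<open>k\<close> and leaves
  all other blocks as they were.\<close>

lemma ties_Suc_old:
  assumes k: "k \<in> {1..n}" and B: "B = {i\<in>{1..n}. y i = y k}"
  shows "ties (Suc n) (y(Suc n := y k)) = insert (insert (Suc n) B) (ties n y - {B})"
proof -
  let ?y = "y(Suc n := y k)"
  have cls: "{i\<in>{1..Suc n}. ?y i = ?y j} = (if y j = y k then insert (Suc n) B else {i\<in>{1..n}. y i = y j})" if "j \<in> {1..n}" for j
    using that by (auto simp: le_Suc_eq B)
  have new: "{i\<in>{1..Suc n}. ?y i = ?y (Suc n)} = insert (Suc n) B"
    by (auto simp: le_Suc_eq B)
  have img: "(\<lambda>j. {i\<in>{1..Suc n}. ?y i = ?y j}) ` {1..n} =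
      (\<lambda>j. if y j = y k then insert (Suc n) B else {i\<in>{1..n}. y i = y j}) ` {1..n}"
    by (rule image_cong[OF refl cls])
  have "{1..Suc n} = insert (Suc n) {1..n}" by auto
  then have "ties (Suc n) ?y = insert {i\<in>{1..Suc n}. ?y i = ?y (Suc n)}
      ((\<lambda>j. {i\<in>{1..Suc n}. ?y i = ?y j}) ` {1..n})"
    unfolding ties_def by (simp only: image_insert)
  also have "\<dots> = insert (insert (Suc n) B) ((\<lambda>j. if y j = y k then insert (Suc n) B else {i\<in>{1..n}. y i = y j}) ` {1..n})"
    unfolding new img ..
  also have "\<dots> = insert (insert (Suc n) B) (ties n y - {B})"
  proof -
    have "{i\<in>{1..n}. y i = y j} \<noteq> B \<longleftrightarrow> \<not> y j = y k" if "j \<in> {1..n}" for j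
      using that k unfolding B by auto
    then show ?thesis unfolding ties_def by (rule insert_image_if)
  qed
  finally show ?thesis .
qed

text \<open>A test function that sees the partition and the distinct values at once. The functions
  are indexed by least elements of blocks because these do not change when a later index joins a
  block, so the same family \<open>a\<close> serves for all \<open>n\<close> in the
  induction.\<close>

definition ties_weight :: "nat \<Rightarrow> nat set set \<Rightarrow> (nat \<Rightarrow> 'a \<Rightarrow> ennreal) \<Rightarrow> (nat \<Rightarrow> 'a) \<Rightarrow> ennreal" where
  "ties_weight n p a y = (if ties n y = p then \<Prod>C\<in>p. a (Min C) (y (Min C)) else 0)"

lemma measurable_ties_weight:
  fixes a :: "nat \<Rightarrow> 'a::polish_space \<Rightarrow> ennreal"
  assumes p: "partition_on {1..n} p" and a: "\<And>i. a i \<in> borel_measurable borel"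
  shows "ties_weight n p a \<in> borel_measurable (seq_space n)"
proof -
  have ev: "{y\<in>space (seq_space n). ties n y = p} \<in> sets (seq_space n :: (nat \<Rightarrow> 'a) measure)"
    using sets_ties_event[of "\<lambda>y::nat \<Rightarrow> 'a. y" "seq_space n" n p] by (simp add: ties_event_def)
  have "(\<lambda>y. a (Min C) (y (Min C))) \<in> borel_measurable (seq_space n)" if "C \<in> p" for C
  proof -
    have "Min C \<in> {1..n}" using Min_block[OF p that] partition_block(1)[OF p that] by blast
    then have "(\<lambda>y. y (Min C)) \<in> measurable (seq_space n) (borel :: 'a measure)"
      by (rule measurable_component_singleton)
    then show ?thesis using a by (rule measurable_compose)
  qed
  then show ?thesis
    unfolding ties_weight_def
    by (intro measurable_If[OF _ _ ev] borel_measurable_prod_ennreal measurable_const) simp_all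
qed

text \<open>The Chinese restaurant recursion. If the last index is alone in its block, the last draw
  has to be fresh, which gives the factor \<open>\<theta>\<close> and one more integral. If its
  block is larger, the last draw has to repeat one of the other members, and their number turns
  \<open>(card C' - 1)!\<close> into \<open>(card C0 - 1)!\<close>.\<close>

lemma urn_integral_ties:
  fixes H :: "'a::polish_space measure" and a :: "nat \<Rightarrow> 'a \<Rightarrow> ennreal"
  assumes H: "prob_space H" "sets H = sets borel" and \<theta>: "0 < \<theta>"
    and nonatomic: "\<And>x. emeasure H {x} = 0" and a: "\<And>i. a i \<in> borel_measurable borel"
  shows "partition_on {1..n} p \<Longrightarrow> urn_integral (scale_measure (ennreal \<theta>) H) n (ties_weight n p a) =
    ennreal (\<theta> ^ card p * (\<Prod>C\<in>p. fact (card C - 1))) * (\<Prod>C\<in>p. \<integral>\<^sup>+x. a (Min C) x \<partial>H)"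
proof (induction n arbitrary: p)
  case 0
  then have "p = {}" using partition_block[OF 0] by auto
  then show ?case by (simp add: ties_weight_def ties_def)
next
  case (Suc n p)
  note p = Suc.prems
  interpret U: urn "scale_measure (ennreal \<theta>) H" by (rule urn_scale_measure[OF H])
  interpret H: prob_space H by fact
  note [measurable_cong] = H(2)
  have aH [measurable]: "a i \<in> borel_measurable H" for i
    using a measurable_cong_sets[OF H(2) refl] by blast
  have sH: "space H = UNIV" using sets_eq_imp_space_eq[OF H(2)] by simp
  \<comment> \<open>This is where nonatomicity enters: finite sets are null, so a draw from
    \<open>H\<close> almost surely differs from all earlier values.\<close>
  have AE_notin: "AE x in H. x \<notin> S" if "finite S" for S
  proof (rule AE_not_in)
    have S: "S \<in> sets H" using that H(2) by (simp add: finite_imp_closed)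
    moreover have "emeasure H S = (\<Sum>x\<in>S. emeasure H {x})"
      using that H(2) by (intro emeasure_eq_sum_singleton) auto
    ultimately show "S \<in> null_sets H" using nonatomic by (simp add: null_sets_def)
  qed
  \<comment> \<open>Only the block \<open>C0\<close> of the last index distinguishes
    \<open>p\<close> from a partition of the first \<open>n\<close> indices, and its size decides
    which part of the urn measure contributes.\<close>
  have "Suc n \<in> \<Union>p" using partition_onD1[OF p] by auto
  then obtain C0 where C0: "C0 \<in> p" "Suc n \<in> C0" by auto
  have sub: "C \<subseteq> {1..n}" if "C \<in> p" "C \<noteq> C0" for C
  proof
    fix i assume i: "i \<in> C"
    have "i \<in> {1..Suc n}" using partition_block(1)[OF p that(1)] i by blast
    moreover have "i \<noteq> Suc n" using partition_disjoint[OF p that(1) C0(1) i] C0(2) that(2) by blast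
    ultimately show "i \<in> {1..n}" by auto
  qed
  have fin: "finite p" by (rule partition_finite[OF p])
  note meas = measurable_ties_weight[OF p a]
  have int: "U.step n (ties_weight (Suc n) p a) y =
      ennreal \<theta> * (\<integral>\<^sup>+x. ties_weight (Suc n) p a (y(Suc n := x)) \<partial>H) + (\<Sum>j\<in>{1..n}. ties_weight (Suc n) p a (y(Suc n := y j)))"
    if y: "y \<in> space (seq_space n)" for y
    unfolding U.step_def
    using U.measurable_section[OF meas y] by (subst nn_integral_scale_measure) simp_all
  have no_Suc: "Suc n \<notin> C" if "C \<in> ties n y" for C and y :: "nat \<Rightarrow> 'a"
    using partition_block(1)[OF partition_on_ties that] by auto
  show ?case
  proof (cases "C0 = {Suc n}")
    case True
    define p' where "p' = p - {C0}"
    have p_eq: "p = insert {Suc n} p'" "{Suc n} \<notin> p'" using C0 True by (auto simp: p'_def)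
    have p': "partition_on {1..n} p'"
    proof (rule partition_onI)
      show "\<Union>p' = {1..n}"
      proof (intro equalityI subsetI)
        fix i assume i: "i \<in> {1..n}"
        then have "i \<in> \<Union>p" unfolding partition_onD1[OF p, symmetric] by simp
        then obtain C where C: "C \<in> p" "i \<in> C" by blast
        moreover have "C \<noteq> C0" using i C True by auto
        ultimately show "i \<in> \<Union>p'" unfolding p'_def by blast
      next
        fix i assume "i \<in> \<Union>p'"
        then show "i \<in> {1..n}" using sub unfolding p'_def by blast
      qed
      show "disjnt C D" if "C \<in> p'" "D \<in> p'" "C \<noteq> D" for C D
        using that partition_disjoint[OF p, of C D] by (auto simp: p'_def disjnt_def)
      show "{} \<notin> p'" using partition_onD3[OF p] by (simp add: p'_def)
    qed
    have fin': "finite p'" using fin by (simp add: p'_def)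
    have Min_le: "Min C \<noteq> Suc n" if "C \<in> p'" for C
      using Min_block[OF p' that] partition_block(1)[OF p' that] by auto
    define I where "I = (\<integral>\<^sup>+x. a (Suc n) x \<partial>H)"
    have step: "U.step n (ties_weight (Suc n) p a) y = (ennreal \<theta> * I) * ties_weight n p' a y" if y: "y \<in> space (seq_space n)" for y
    proof -
      have w_new: "ties_weight (Suc n) p a (y(Suc n := x)) = a (Suc n) x * ties_weight n p' a y" if x: "x \<notin> y ` {1..n}" for x
      proof -
        have "ties (Suc n) (y(Suc n := x)) = p \<longleftrightarrow> ties n y = p'"
          unfolding ties_Suc_new[OF x] p_eq(1)
          by (rule insert_ident[OF _ p_eq(2)]) (use no_Suc[of "{Suc n}" y] in blast)
        moreover have "(\<Prod>C\<in>p. a (Min C) ((y(Suc n := x)) (Min C))) = a (Suc n) x * (\<Prod>C\<in>p'. a (Min C) (y (Min C)))"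
          unfolding p_eq(1) using fin' p_eq(2) Min_le by (simp cong: prod.cong)
        ultimately show ?thesis unfolding ties_weight_def by simp
      qed
      \<comment> \<open>Repeating an earlier value would put \<open>Suc n\<close> into a block with
        another index, but its block in \<open>p\<close> is a singleton. So the point masses
        contribute nothing.\<close>
      have w_old: "ties_weight (Suc n) p a (y(Suc n := y k)) = 0" if k: "k \<in> {1..n}" for k
      proof -
        define B where "B = {i\<in>{1..n}. y i = y k}"
        have kB: "k \<in> B" using k by (simp add: B_def)
        note B = B_def ties_Suc_old[OF k B_def]
        have "ties (Suc n) (y(Suc n := y k)) \<noteq> p"
        proof
          assume "ties (Suc n) (y(Suc n := y k)) = p"
          then have "p = insert (insert (Suc n) B) (ties n y - {B})" unfolding B(2) by (rule sym)
          then have "insert (Suc n) B \<in> p" by (metis insertI1)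
          from partition_disjoint[OF p this C0(1) insertI1 C0(2)]
          have "insert (Suc n) B = {Suc n}" using True by simp
          with kB have "k \<in> {Suc n}" by blast
          then show False using k by simp
        qed
        then show ?thesis by (simp add: ties_weight_def)
      qed
      have "(\<integral>\<^sup>+x. ties_weight (Suc n) p a (y(Suc n := x)) \<partial>H) = (\<integral>\<^sup>+x. a (Suc n) x * ties_weight n p' a y \<partial>H)"
      proof (rule nn_integral_cong_AE, rule eventually_mono)
        show "AE x in H. x \<notin> y ` {1..n}" by (rule AE_notin) simp
      qed (rule w_new)
      also have "\<dots> = I * ties_weight n p' a y"
        unfolding I_def by (rule nn_integral_multc) measurable
      finally show ?thesis
        unfolding int[OF y] using w_old by (simp add: mult.assoc)
    qed
    have "urn_integral (scale_measure (ennreal \<theta>) H) (Suc n) (ties_weight (Suc n) p a) =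
        urn_integral (scale_measure (ennreal \<theta>) H) n (\<lambda>y. (ennreal \<theta> * I) * ties_weight n p' a y)"
      unfolding U.urn_integral_step[OF meas] by (rule U.urn_integral_cong[OF step])
    also have "\<dots> = (ennreal \<theta> * I) * (ennreal (\<theta> ^ card p' * (\<Prod>C\<in>p'. fact (card C - 1))) * (\<Prod>C\<in>p'. \<integral>\<^sup>+x. a (Min C) x \<partial>H))"
      unfolding U.urn_integral_cmult[OF measurable_ties_weight[OF p' a]] Suc.IH[OF p'] ..
    also have "\<dots> = ennreal (\<theta> * (\<theta> ^ card p' * (\<Prod>C\<in>p'. fact (card C - 1)))) * (I * (\<Prod>C\<in>p'. \<integral>\<^sup>+x. a (Min C) x \<partial>H))"
      using \<theta> by (simp add: ennreal_mult prod_nonneg mult_ac)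
    also have "\<dots> = ennreal (\<theta> ^ card p * (\<Prod>C\<in>p. fact (card C - 1))) * (\<Prod>C\<in>p. \<integral>\<^sup>+x. a (Min C) x \<partial>H)"
      unfolding p_eq(1) using fin' p_eq(2) by (simp add: I_def mult_ac)
    finally show ?thesis .
  next
    case False
    define C' where "C' = C0 - {Suc n}"
    define q where "q = p - {C0}"
    have C0_eq: "C0 = insert (Suc n) C'" and C'_notin: "Suc n \<notin> C'" using C0 by (auto simp: C'_def)
    have C'_sub: "C' \<subseteq> {1..n}" using partition_block(1)[OF p C0(1)] by (auto simp: C'_def le_Suc_eq)
    have C'_ne: "C' \<noteq> {}" using False C0(2) unfolding C'_def by blast
    have C'_fin: "finite C'" using finite_subset[OF C'_sub] by simp
    have p_eq: "p = insert C0 q" "C0 \<notin> q" using C0 by (auto simp: q_def)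
    have C'_q: "C' \<notin> q"
    proof
      assume "C' \<in> q"
      then have "C' \<in> p" by (simp add: q_def)
      moreover obtain i where "i \<in> C'" using C'_ne by auto
      ultimately have "C' = C0" using partition_disjoint[OF p _ C0(1)] by (metis C'_def DiffD1)
      then show False using C0(2) C'_notin by simp
    qed
    define p' where "p' = insert C' q"
    have fin': "finite q" using fin by (simp add: q_def)
    have p': "partition_on {1..n} p'"
    proof (rule partition_onI)
      show "\<Union>p' = {1..n}"
      proof (intro equalityI subsetI)
        fix i assume i: "i \<in> {1..n}"
        then have "i \<in> \<Union>p" unfolding partition_onD1[OF p, symmetric] by simp
        then obtain C where C: "C \<in> p" "i \<in> C" by blast
        show "i \<in> \<Union>p'"
        proof (cases "C = C0")
          case True
          then have "i \<in> C'" using C i by (auto simp: C'_def)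
          then show ?thesis unfolding p'_def by blast
        qed (use C in \<open>unfold p'_def q_def, blast\<close>)
      next
        fix i assume "i \<in> \<Union>p'"
        then show "i \<in> {1..n}" using sub C'_sub unfolding p'_def q_def by blast
      qed
      show "disjnt C D" if CD: "C \<in> p'" "D \<in> p'" "C \<noteq> D" for C D
      proof -
        have "C0 \<inter> E = {}" if "E \<in> q" for E
          using partition_disjoint[OF p C0(1), of E] that by (auto simp: q_def)
        moreover have "C \<inter> D = {}" if "C \<in> q" "D \<in> q" "C \<noteq> D" for C D
          using partition_disjoint[OF p, of C D] that by (auto simp: q_def)
        ultimately show ?thesis using CD unfolding p'_def disjnt_def C'_def by blast
      qed
      show "{} \<notin> p'" using partition_onD3[OF p] C'_ne by (auto simp: p'_def q_def)
    qed
    have Min_le: "Min C \<noteq> Suc n" if "C \<in> p'" for C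
      using Min_block[OF p' that] partition_block(1)[OF p' that] by auto
    have C'_p': "C' \<in> p'" by (simp add: p'_def)
    have Min_C0: "Min C0 = Min C'"
    proof -
      have "Min C' \<le> n" using Min_block[OF p' C'_p'] C'_sub by auto
      then show ?thesis unfolding C0_eq using C'_fin C'_ne by simp
    qed
    \<comment> \<open>A fresh draw would make \<open>Suc n\<close> a singleton, so the integral over
      \<open>H\<close> vanishes. Among the point masses exactly those at indices in
      \<open>C'\<close> lead from \<open>p'\<close> to \<open>p\<close>.\<close>
    have step: "U.step n (ties_weight (Suc n) p a) y = ennreal (real (card C')) * ties_weight n p' a y" if y: "y \<in> space (seq_space n)" for y
    proof -
      have w_new: "ties_weight (Suc n) p a (y(Suc n := x)) = 0" if x: "x \<notin> y ` {1..n}" for x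
      proof -
        have "ties (Suc n) (y(Suc n := x)) \<noteq> p"
        proof
          assume "ties (Suc n) (y(Suc n := x)) = p"
          then have "{Suc n} \<in> p" unfolding ties_Suc_new[OF x] by blast
          from partition_disjoint[OF p this C0(1) _ C0(2)] False show False by simp
        qed
        then show ?thesis by (simp add: ties_weight_def)
      qed
      have w_old: "ties_weight (Suc n) p a (y(Suc n := y k)) = ties_weight n p' a y * indicator C' k" if k: "k \<in> {1..n}" for k
      proof -
        define B where "B = {i\<in>{1..n}. y i = y k}"
        have kB: "k \<in> B" using k by (simp add: B_def)
        note B = B_def ties_Suc_old[OF k B_def]
        have B_ties: "B \<in> ties n y" unfolding ties_def B_def using k by (rule imageI)
        have "ties (Suc n) (y(Suc n := y k)) = p \<longleftrightarrow> ties n y = p' \<and> k \<in> C'"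
        proof
          assume eq: "ties (Suc n) (y(Suc n := y k)) = p"
          then have p_B: "p = insert (insert (Suc n) B) (ties n y - {B})" unfolding B(2) by (rule sym)
          then have "insert (Suc n) B \<in> p" by (metis insertI1)
          from partition_disjoint[OF p this C0(1) insertI1 C0(2)]
          have B_C0: "insert (Suc n) B = C0" .
          then have "B = C'" unfolding C'_def using no_Suc[OF B_ties] by blast
          moreover have "ties n y - {B} = q"
          proof -
            have "C0 \<notin> ties n y - {B}" using no_Suc[of C0 y] C0(2) by blast
            then show ?thesis unfolding q_def using p_B unfolding B_C0 by blast
          qed
          ultimately show "ties n y = p' \<and> k \<in> C'" using B_ties kB by (auto simp: p'_def)
        next
          assume *: "ties n y = p' \<and> k \<in> C'"
          then have "B \<in> p'" using B_ties by simp
          from partition_disjoint[OF p' this C'_p' kB] have "B = C'" using * by simp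
          then show "ties (Suc n) (y(Suc n := y k)) = p"
          proof -
            have "ties n y - {B} = q" using * \<open>B = C'\<close> C'_q by (simp add: p'_def)
            then show ?thesis unfolding B(2) p_eq(1) C0_eq using \<open>B = C'\<close> by simp
          qed
        qed
        moreover have "(\<Prod>C\<in>p. a (Min C) ((y(Suc n := y k)) (Min C))) = (\<Prod>C\<in>p'. a (Min C) (y (Min C)))"
        proof -
          have "Min C \<noteq> Suc n" if "C \<in> q" for C using Min_le that by (simp add: p'_def)
          then show ?thesis
            unfolding p_eq(1) p'_def using fin' p_eq(2) C'_q Min_C0 Min_le[OF C'_p'] by (simp cong: prod.cong)
        qed
        ultimately show ?thesis unfolding ties_weight_def by simp
      qed
      have "(\<integral>\<^sup>+x. ties_weight (Suc n) p a (y(Suc n := x)) \<partial>H) = (\<integral>\<^sup>+x. 0 \<partial>H)"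
      proof (rule nn_integral_cong_AE, rule eventually_mono)
        show "AE x in H. x \<notin> y ` {1..n}" by (rule AE_notin) simp
      qed (rule w_new)
      moreover have "(\<Sum>j\<in>{1..n}. ties_weight (Suc n) p a (y(Suc n := y j))) = (\<Sum>j\<in>{1..n}. ties_weight n p' a y * indicator C' j)"
        by (rule sum.cong[OF refl w_old])
      moreover have "(\<Sum>j\<in>{1..n}. ties_weight n p' a y * indicator C' j) = ennreal (real (card C')) * ties_weight n p' a y"
        using C'_sub by (simp add: sum_distrib_left[symmetric] indicator_def sum.If_cases Int_absorb1 ennreal_of_nat_eq_real_of_nat mult.commute del: One_nat_def)
      ultimately show ?thesis unfolding int[OF y] by simp
    qed
    have "urn_integral (scale_measure (ennreal \<theta>) H) (Suc n) (ties_weight (Suc n) p a) =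
        urn_integral (scale_measure (ennreal \<theta>) H) n (\<lambda>y. ennreal (real (card C')) * ties_weight n p' a y)"
      unfolding U.urn_integral_step[OF meas] by (rule U.urn_integral_cong[OF step])
    also have "\<dots> = ennreal (real (card C')) * (ennreal (\<theta> ^ card p' * (\<Prod>C\<in>p'. fact (card C - 1))) * (\<Prod>C\<in>p'. \<integral>\<^sup>+x. a (Min C) x \<partial>H))"
      unfolding U.urn_integral_cmult[OF measurable_ties_weight[OF p' a]] Suc.IH[OF p'] ..
    also have "\<dots> = ennreal (real (card C') * (\<theta> ^ card p' * (\<Prod>C\<in>p'. fact (card C - 1)))) * (\<Prod>C\<in>p'. \<integral>\<^sup>+x. a (Min C) x \<partial>H)"
      using \<theta> by (simp add: ennreal_mult prod_nonneg mult_ac)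
    also have "real (card C') * (\<theta> ^ card p' * (\<Prod>C\<in>p'. fact (card C - 1))) = \<theta> ^ card p * (\<Prod>C\<in>p. fact (card C - 1))"
    proof -
      have "card C' \<noteq> 0" using C'_fin C'_ne by simp
      then have "fact (card C') = real (card C') * fact (card C' - 1)" by (simp add: fact_reduce)
      moreover have "card C0 - 1 = card C'" unfolding C0_eq using C'_fin C'_notin by simp
      ultimately show ?thesis unfolding p'_def p_eq(1) using fin' p_eq(2) C'_q by simp
    qed
    also have "(\<Prod>C\<in>p'. \<integral>\<^sup>+x. a (Min C) x \<partial>H) = (\<Prod>C\<in>p. \<integral>\<^sup>+x. a (Min C) x \<partial>H)"
      unfolding p'_def p_eq(1) using fin' p_eq(2) C'_q Min_C0 by simp
    finally show ?thesis .
  qed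
qed

text \<open>With indicators of the sets \<open>B j\<close> as its functions,
  \<open>ties_weight\<close> becomes the indicator of the event, and its urn integral factorizes
  over the blocks.\<close>

lemma nonatomic_joint:
  fixes H :: "'a::polish_space measure" and B :: "nat \<Rightarrow> 'a set"
  assumes H: "prob_space H" "sets H = sets borel" and \<theta>: "0 < \<theta>"
    and nonatomic: "\<And>x. emeasure H {x} = 0"
    and Y: "Y \<in> measurable M (seq_space n)" "distr M (seq_space n) Y = blackwell_macqueen \<theta> H n"
    and p: "partition_on {1..n} p" and B: "\<And>j. B j \<in> sets borel"
  shows "emeasure M {\<omega>\<in>ties_event M n Y p. \<forall>j\<in>{1..card p}. distinct_value p (Y \<omega>) j \<in> B j} =
    ennreal (partition_prob \<theta> n p) * (\<Prod>j\<in>{1..card p}. emeasure H (B j))"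
proof -
  let ?J = "{1..card p}"
  define mi where "mi j = Min (block p j)" for j
  have inj: "inj_on mi ?J"
    unfolding mi_def using comp_inj_on[of "block p" ?J Min] bij_betw_block[OF p] inj_on_Min[OF p]
    by (simp add: bij_betw_def o_def)
  \<comment> \<open>The sets are numbered by blocks, but \<open>ties_weight\<close> is indexed by
    the least elements of blocks. The inverse of \<open>mi\<close> translates between the
    two.\<close>
  define a where "a i = (indicator (B (the_inv_into ?J mi i)) :: 'a \<Rightarrow> ennreal)" for i
  have a_meas: "a i \<in> borel_measurable borel" for i
    unfolding a_def using B by (rule borel_measurable_indicator)
  have a_mi: "a (Min (block p j)) = indicator (B j)" if "j \<in> ?J" for j
    using the_inv_into_f_f[OF inj that] by (simp add: a_def mi_def)
  have ev [measurable]: "ties_event M n Y p \<in> sets M" by (rule sets_ties_event[OF Y(1)])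
  have dv [measurable]: "(\<lambda>\<omega>. distinct_value p (Y \<omega>) j) \<in> borel_measurable M" if "j \<in> ?J" for j
    unfolding distinct_value_def
    using measurable_compose[OF Y(1) measurable_component_singleton[OF Min_block_mem[OF p that]]] .
  have S: "{\<omega>\<in>ties_event M n Y p. \<forall>j\<in>?J. distinct_value p (Y \<omega>) j \<in> B j} \<in> sets M" (is "?S \<in> _")
  proof -
    have "?S = ties_event M n Y p \<inter> {\<omega>\<in>space M. \<forall>j\<in>?J. distinct_value p (Y \<omega>) j \<in> B j}"
      by (auto simp: ties_event_def)
    also have "\<dots> \<in> sets M"
    proof (intro sets.Int ev sets.sets_Collect_finite_All)
      show "{\<omega>\<in>space M. distinct_value p (Y \<omega>) j \<in> B j} \<in> sets M" if "j \<in> ?J" for j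
        using measurable_sets[OF dv[OF that] B[of j]] by (simp add: vimage_def Int_def conj_commute)
    qed simp
    finally show ?thesis .
  qed
  have weight: "ties_weight n p a (Y \<omega>) = indicator ?S \<omega>" if "\<omega> \<in> space M" for \<omega>
  proof (cases "ties n (Y \<omega>) = p")
    case True
    have "(\<Prod>C\<in>p. a (Min C) (Y \<omega> (Min C))) = (\<Prod>j\<in>?J. a (Min (block p j)) (Y \<omega> (Min (block p j))))"
      by (rule prod.reindex_bij_betw[OF bij_betw_block[OF p], symmetric])
    also have "\<dots> = (\<Prod>j\<in>?J. indicator (B j) (distinct_value p (Y \<omega>) j))"
      by (rule prod.cong[OF refl]) (simp add: a_mi distinct_value_def)
    also have "\<dots> = (if \<forall>j\<in>?J. distinct_value p (Y \<omega>) j \<in> B j then 1 else 0)"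
      by (auto simp: indicator_def prod_zero_iff intro!: prod.neutral)
    finally show ?thesis using True that by (simp add: ties_weight_def ties_event_def indicator_def)
  qed (use that in \<open>simp add: ties_weight_def ties_event_def\<close>)
  have W: "ties_weight n p a \<in> borel_measurable (seq_space n)"
    by (rule measurable_ties_weight[OF p a_meas])
  have "emeasure M ?S = (\<integral>\<^sup>+\<omega>. ties_weight n p a (Y \<omega>) \<partial>M)"
    using weight S by (simp add: nn_integral_indicator[symmetric] cong: nn_integral_cong del: nn_integral_indicator)
  also have "\<dots> = (\<integral>\<^sup>+y. ties_weight n p a y \<partial>blackwell_macqueen \<theta> H n)"
    unfolding Y(2)[symmetric] by (rule nn_integral_distr[OF Y(1), symmetric]) (unfold measurable_distr_eq1, rule W)
  also have "\<dots> = ennreal (Gamma \<theta> / Gamma (\<theta> + real n)) *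
      (ennreal (\<theta> ^ card p * (\<Prod>C\<in>p. fact (card C - 1))) * (\<Prod>C\<in>p. \<integral>\<^sup>+x. a (Min C) x \<partial>H))"
    unfolding nn_integral_blackwell_macqueen[OF H W] urn_integral_ties[where a = a, OF H \<theta> nonatomic a_meas p] ..
  also have "(\<Prod>C\<in>p. \<integral>\<^sup>+x. a (Min C) x \<partial>H) = (\<Prod>j\<in>?J. \<integral>\<^sup>+x. a (Min (block p j)) x \<partial>H)"
    by (rule prod.reindex_bij_betw[OF bij_betw_block[OF p], symmetric])
  also have "\<dots> = (\<Prod>j\<in>?J. emeasure H (B j))"
    by (rule prod.cong[OF refl]) (use B H(2) in \<open>simp add: a_mi\<close>)
  also have "ennreal (Gamma \<theta> / Gamma (\<theta> + real n)) *
      (ennreal (\<theta> ^ card p * (\<Prod>C\<in>p. fact (card C - 1))) * (\<Prod>j\<in>?J. emeasure H (B j))) =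
      ennreal (partition_prob \<theta> n p) * (\<Prod>j\<in>?J. emeasure H (B j))"
  proof -
    have "0 \<le> Gamma \<theta> / Gamma (\<theta> + real n)" using \<theta> by (simp add: Gamma_real_pos less_imp_le)
    then have "ennreal (Gamma \<theta> / Gamma (\<theta> + real n)) * ennreal (\<theta> ^ card p * (\<Prod>C\<in>p. fact (card C - 1))) = ennreal (partition_prob \<theta> n p)"
      by (subst ennreal_mult'[symmetric]) (simp_all add: partition_prob_def mult_ac)
    then show ?thesis by (simp only: mult.assoc[symmetric])
  qed
  finally show ?thesis .
qed

text \<open>All three claims are read off from the joint formula: choosing \<open>UNIV\<close> for
  all, all but one, or some of the sets gives the probability of the partition, the marginal laws
  and the subfamilies in the definition of independence. Conditioning makes sense because every
  partition has positive probability.\<close>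

lemma nonatomic_given_ties:
  fixes H :: "'a::polish_space measure"
  assumes H: "prob_space H" "sets H = sets borel" and \<theta>: "0 < \<theta>"
    and nonatomic: "\<And>x. emeasure H {x} = 0" and M: "prob_space M"
    and Y: "Y \<in> measurable M (seq_space n)" "distr M (seq_space n) Y = blackwell_macqueen \<theta> H n"
    and p: "partition_on {1..n} p"
  shows "measure M (ties_event M n Y p) = partition_prob \<theta> n p"
    and "prob_space.indep_vars (given_ties M n Y p) (\<lambda>_. borel) (\<lambda>j \<omega>. distinct_value p (Y \<omega>) j) {1..card p}"
    and "j \<in> {1..card p} \<Longrightarrow> distr (given_ties M n Y p) borel (\<lambda>\<omega>. distinct_value p (Y \<omega>) j) = H"
proof -
  interpret M: prob_space M by fact
  interpret H: prob_space H by fact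
  let ?J = "{1..card p}" and ?E = "ties_event M n Y p"
  define X where "X j \<omega> = distinct_value p (Y \<omega>) j" for j \<omega>
  note joint = nonatomic_joint[OF H \<theta> nonatomic Y p, folded X_def]
  have sH: "space H = UNIV" using sets_eq_imp_space_eq[OF H(2)] by simp
  have ev [measurable]: "?E \<in> sets M" by (rule sets_ties_event[OF Y(1)])
  have X [measurable]: "X j \<in> borel_measurable M" if "j \<in> ?J" for j
    unfolding X_def distinct_value_def
    using measurable_compose[OF Y(1) measurable_component_singleton[OF Min_block_mem[OF p that]]] .
  have pos: "0 < partition_prob \<theta> n p"
    using \<theta> by (auto simp: partition_prob_def Gamma_real_pos intro!: mult_pos_pos divide_pos_pos prod_pos)
  have E: "emeasure M ?E = ennreal (partition_prob \<theta> n p)"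
    using joint[of "\<lambda>_. UNIV"] H.emeasure_space_1 sH by simp
  then show prob_E: "measure M ?E = partition_prob \<theta> n p"
    using pos by (simp add: measure_def)
  interpret Q: prob_space "given_ties M n Y p"
    by (rule prob_space_uniform_measure) (use E pos in auto)
  have QX [measurable]: "X j \<in> borel_measurable (given_ties M n Y p)" if "j \<in> ?J" for j
    using X[OF that] by simp
  have Q_joint: "Q.prob {\<omega>\<in>space M. \<forall>j\<in>?J. X j \<omega> \<in> B j} = (\<Prod>j\<in>?J. measure H (B j))"
    if B: "\<And>j. B j \<in> sets borel" for B
  proof -
    have S: "{\<omega>\<in>space M. \<forall>j\<in>?J. X j \<omega> \<in> B j} \<in> sets M"
    proof (intro sets.sets_Collect_finite_All)
      show "{\<omega>\<in>space M. X j \<omega> \<in> B j} \<in> sets M" if "j \<in> ?J" for j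
        using measurable_sets[OF X[OF that] B[of j]] by (simp add: vimage_def Int_def conj_commute)
    qed simp
    have "?E \<inter> {\<omega>\<in>space M. \<forall>j\<in>?J. X j \<omega> \<in> B j} = {\<omega>\<in>?E. \<forall>j\<in>?J. X j \<omega> \<in> B j}"
      by (auto simp: ties_event_def)
    then have "emeasure (given_ties M n Y p) {\<omega>\<in>space M. \<forall>j\<in>?J. X j \<omega> \<in> B j} =
        ennreal (partition_prob \<theta> n p) * (\<Prod>j\<in>?J. emeasure H (B j)) / ennreal (partition_prob \<theta> n p)"
      using S joint[OF B] E by (subst emeasure_uniform_measure[OF ev S]) simp
    also have "\<dots> = ennreal (\<Prod>j\<in>?J. measure H (B j))"
      using pos by (simp add: H.emeasure_eq_measure prod_ennreal ennreal_mult[symmetric] divide_ennreal prod_nonneg)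
    finally show ?thesis by (simp add: measure_def prod_nonneg)
  qed
  have marginal: "Q.prob {\<omega>\<in>space M. X j \<omega> \<in> A} = measure H A" if j: "j \<in> ?J" and A: "A \<in> sets borel" for j A
  proof -
    let ?B = "\<lambda>i. if i = j then A else UNIV"
    have "{\<omega>\<in>space M. \<forall>i\<in>?J. X i \<omega> \<in> ?B i} = {\<omega>\<in>space M. X j \<omega> \<in> A}"
      using j by auto
    moreover have "(\<Prod>i\<in>?J. measure H (?B i)) = (\<Prod>i\<in>?J. if i = j then measure H A else 1)"
      using H.prob_space sH by (intro prod.cong) auto
    ultimately show ?thesis
      using Q_joint[of ?B] A j by simp
  qed
  have "Q.indep_vars (\<lambda>_. borel) X ?J"
    unfolding Q.indep_vars_def2
  proof (intro conjI ballI)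
    show "Q.indep_sets (\<lambda>i. {X i -` A \<inter> space (given_ties M n Y p) |A. A \<in> sets borel}) ?J"
    proof (rule Q.indep_setsI)
      show "{X i -` A \<inter> space (given_ties M n Y p) |A. A \<in> sets borel} \<subseteq> Q.events" if "i \<in> ?J" for i
        using measurable_sets[OF QX[OF that]] by auto
      fix A K assume K: "K \<noteq> {}" "K \<subseteq> ?J" "finite K"
        "\<forall>j\<in>K. A j \<in> {X j -` A \<inter> space (given_ties M n Y p) |A. A \<in> sets borel}"
      have "\<forall>j\<in>K. \<exists>B\<in>sets borel. A j = X j -` B \<inter> space M"
      proof
        fix j assume "j \<in> K"
        from bspec[OF K(4) this] show "\<exists>B\<in>sets borel. A j = X j -` B \<inter> space M" by auto
      qed
      then obtain B where B: "\<And>j. j \<in> K \<Longrightarrow> B j \<in> sets borel \<and> A j = X j -` B j \<inter> space M" by metis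
      let ?B = "\<lambda>j. if j \<in> K then B j else UNIV"
      have "(\<Inter>j\<in>K. A j) = {\<omega>\<in>space M. \<forall>j\<in>?J. X j \<omega> \<in> ?B j}"
        using K(1,2) B by auto
      then have "Q.prob (\<Inter>j\<in>K. A j) = (\<Prod>j\<in>?J. measure H (?B j))"
        using Q_joint[of ?B] B by simp
      also have "\<dots> = (\<Prod>j\<in>K. measure H (B j))"
        using K(2) H.prob_space sH by (intro prod.mono_neutral_cong_right) auto
      also have "\<dots> = (\<Prod>j\<in>K. Q.prob (A j))"
      proof (rule prod.cong[OF refl])
        fix j assume j: "j \<in> K"
        then have "A j = {\<omega>\<in>space M. X j \<omega> \<in> B j}" using B by auto
        then show "measure H (B j) = Q.prob (A j)" using marginal[of j "B j"] j K(2) B by auto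
      qed
      finally show "Q.prob (\<Inter>j\<in>K. A j) = (\<Prod>j\<in>K. Q.prob (A j))" .
    qed
  qed (use X in simp)
  then show "Q.indep_vars (\<lambda>_. borel) (\<lambda>j \<omega>. distinct_value p (Y \<omega>) j) ?J"
    by (simp add: X_def[abs_def])
  show "distr (given_ties M n Y p) borel (\<lambda>\<omega>. distinct_value p (Y \<omega>) j) = H" if j: "j \<in> ?J"
  proof (rule measure_eqI)
    fix A assume "A \<in> sets (distr (given_ties M n Y p) borel (\<lambda>\<omega>. distinct_value p (Y \<omega>) j))"
    then have A: "A \<in> sets borel" by simp
    have "emeasure (distr (given_ties M n Y p) borel (X j)) A = emeasure (given_ties M n Y p) {\<omega>\<in>space M. X j \<omega> \<in> A}"
      using QX[OF j] A by (subst emeasure_distr) (auto simp: vimage_def Int_def conj_commute)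
    also have "\<dots> = emeasure H A"
      using marginal[OF j A] by (simp add: Q.emeasure_eq_measure H.emeasure_eq_measure)
    finally show "emeasure (distr (given_ties M n Y p) borel (\<lambda>\<omega>. distinct_value p (Y \<omega>) j)) A = emeasure H A"
      by (simp add: X_def[abs_def])
  qed (simp add: H(2))
qed

section \<open>The conditional model\<close>

lemma generated_uniform_measure [simp]: "generated (uniform_measure M E) N X = generated M N X"
  by (simp add: generated_def)

text \<open>The right-hand side of (i) with the partition as a separate argument. For a fixed
  \<open>p\<close> the number of atoms is deterministic, which suits measurability proofs and
  conditioning; the theorem inserts the random partition.\<close>

definition mixture_measure ::
    "nat \<Rightarrow> ('w \<Rightarrow> nat \<Rightarrow> 'a) \<Rightarrow> ('w \<Rightarrow> real) \<Rightarrow> ('w \<Rightarrow> 'a measure) \<Rightarrow> (nat \<Rightarrow> 'w \<Rightarrow> real) \<Rightarrow> nat set set \<Rightarrow> 'w \<Rightarrow> 'a measure" where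
  "mixture_measure n Y U \<mu> Z p \<omega> = add_atoms (scale_measure (ennreal (U \<omega>)) (\<mu> \<omega>)) {1..card p}
    (\<lambda>j. U \<omega> * Z j \<omega>) (distinct_value p (Y \<omega>))"

lemma measurable_mixture_measure:
  fixes Y :: "'w \<Rightarrow> nat \<Rightarrow> 'a::polish_space"
  assumes Y: "Y \<in> measurable M (seq_space n)" and U: "U \<in> borel_measurable M" and \<mu>: "\<mu> \<in> measurable M bf_algebra"
    and Z: "\<And>j. j \<in> {1..n} \<Longrightarrow> Z j \<in> borel_measurable M" and p: "partition_on {1..n} p"
  shows "mixture_measure n Y U \<mu> Z p \<in> measurable M bf_algebra"
proof -
  note [measurable] = U \<mu>
  have [measurable]: "Z j \<in> borel_measurable M" if "j \<in> {1..card p}" for j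
    using that card_partition_le[OF p] by (intro Z) auto
  have "(\<lambda>\<omega>. add_atoms (scale_measure (ennreal (U \<omega>)) (\<mu> \<omega>)) {1..card p} (\<lambda>j. (\<lambda>j \<omega>. U \<omega> * Z j \<omega>) j \<omega>)
      (\<lambda>j. (\<lambda>j \<omega>. Y \<omega> (Min (block p j))) j \<omega>)) \<in> measurable M bf_algebra"
  proof (rule measurable_add_atoms)
    show "(\<lambda>\<omega>. Y \<omega> (Min (block p j))) \<in> borel_measurable M" if "j \<in> {1..card p}" for j
      using measurable_compose[OF Y measurable_component_singleton[OF Min_block_mem[OF p that]]] .
  qed measurable
  then show ?thesis by (simp add: mixture_measure_def[abs_def] distinct_value_def[abs_def])
qed

text \<open>The partition takes finitely many values, so the map is glued together from the
  measurable maps for fixed \<open>p\<close> along the events that the ties equal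
  \<open>p\<close>.\<close>

lemma measurable_mixture_ties:
  fixes Y :: "'w \<Rightarrow> nat \<Rightarrow> 'a::polish_space"
  assumes Y: "Y \<in> measurable M (seq_space n)" and U: "U \<in> borel_measurable M" and \<mu>: "\<mu> \<in> measurable M bf_algebra"
    and Z: "\<And>j. j \<in> {1..n} \<Longrightarrow> Z j \<in> borel_measurable M"
  shows "(\<lambda>\<omega>. mixture_measure n Y U \<mu> Z (ties n (Y \<omega>)) \<omega>) \<in> measurable M bf_algebra"
proof (rule measurable_compose_countable'[where I = "{p. partition_on {1..n} p}"])
  have fin: "finite {p. partition_on {1..n} p}" by (rule finitely_many_partition_on) simp
  then show "countable {p. partition_on {1..n} p}" by (rule countable_finite)
  show "mixture_measure n Y U \<mu> Z p \<in> measurable M bf_algebra" if "p \<in> {p. partition_on {1..n} p}" for p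
    using that by (intro measurable_mixture_measure[OF Y U \<mu> Z]) auto
  show "(\<lambda>\<omega>. ties n (Y \<omega>)) \<in> measurable M (count_space {p. partition_on {1..n} p})"
    unfolding measurable_count_space_eq2[OF fin]
  proof (intro conjI ballI)
    show "(\<lambda>\<omega>. ties n (Y \<omega>)) \<in> space M \<rightarrow> {p. partition_on {1..n} p}" using partition_on_ties by auto
    fix p
    have "(\<lambda>\<omega>. ties n (Y \<omega>)) -` {p} \<inter> space M = ties_event M n Y p" by (auto simp: ties_event_def)
    then show "(\<lambda>\<omega>. ties n (Y \<omega>)) -` {p} \<inter> space M \<in> sets M" using sets_ties_event[OF Y] by simp
  qed
qed

text \<open>The vector \<open>V\<close> is frozen as a whole, since its coordinates may depend on
  each other. The Gamma masses are then independent, and each contributes its own Laplace transform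
  at \<open>u * f (V j)\<close>.\<close>

lemma block_gamma_Laplace:
  fixes f :: "'a::polish_space \<Rightarrow> real"
  assumes M: "prob_space M" and Z: "\<And>j. j \<in> {1..k} \<Longrightarrow> gamma_variable M (Z j) (e j)" and e: "\<And>j. j \<in> {1..k} \<Longrightarrow> 0 < e j"
    and V: "V \<in> measurable M (Pi\<^sub>M {1..k} (\<lambda>_. borel))"
    and indep: "mutually_indep M (generated M (Pi\<^sub>M {1..k} (\<lambda>_. borel)) V # map (\<lambda>j. generated M borel (Z j)) [1..<Suc k])"
    and f: "f \<in> test_functions" and u: "0 \<le> u"
  shows "(\<integral>\<^sup>+\<omega>. (\<Prod>j\<in>{1..k}. ennreal (exp (- (u * Z j \<omega> * f (V \<omega> j))))) \<partial>M) =
    (\<integral>\<^sup>+\<omega>. (\<Prod>j\<in>{1..k}. ennreal ((1 + u * f (V \<omega> j)) powr (- e j))) \<partial>M)"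
proof -
  note fm [measurable] = test_functionsD(1)[OF f]
  let ?js = "[1..<Suc k]"
  let ?Fs = "map (\<lambda>j. generated M borel (Z j)) ?js" and ?L = "Pi\<^sub>M {1..k} (\<lambda>_. borel) :: (nat \<Rightarrow> 'a) measure"
  let ?N2 = "sigma (space M) (\<Union>(set ?Fs))"
  have js: "set ?js = {1..k}" by auto
  have prod_list: "(\<Prod>j\<in>{1..k}. h j) = prod_list (map h ?js)" for h :: "nat \<Rightarrow> ennreal"
    unfolding js[symmetric] by (rule prod.distinct_set_conv_list) simp
  note indep' = mutually_indep_ConsD[OF M indep]
  have ev: "\<Union>(set ?Fs) \<subseteq> sets M" by (rule mutually_indep_events[OF M indep'])
  have Zm: "Z j \<in> borel_measurable ?N2" if "j \<in> {1..k}" for j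
    by (rule measurable_sigma_generated[OF gamma_variableD(1)[OF Z[OF that]] _ ev])
       (unfold set_map js, rule imageI[OF that])
  have fL: "(\<lambda>z. f (z j)) \<in> borel_measurable ?L" if "j \<in> {1..k}" for j
  proof -
    have "(\<lambda>z. z j) \<in> measurable ?L borel" using that by (rule measurable_component_singleton)
    then show ?thesis using fm by (rule measurable_compose)
  qed
  have "(\<integral>\<^sup>+\<omega>. (\<Prod>j\<in>{1..k}. ennreal (exp (- (u * Z j \<omega> * f (V \<omega> j))))) \<partial>M) =
      (\<integral>\<^sup>+z. (\<integral>\<^sup>+\<omega>. (\<Prod>j\<in>{1..k}. ennreal (exp (- (u * Z j \<omega> * f (z j))))) \<partial>M) \<partial>distr M ?L V)"
  proof (rule nn_integral_freeze(1)[OF M indep _ V])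
    show "(\<lambda>(z, \<omega>). \<Prod>j\<in>{1..k}. ennreal (exp (- (u * Z j \<omega> * f (z j))))) \<in> borel_measurable (?L \<Otimes>\<^sub>M ?N2)"
      unfolding case_prod_beta
    proof (rule borel_measurable_prod_ennreal)
      fix j assume j: "j \<in> {1..k}"
      note [measurable] = measurable_compose[OF measurable_snd Zm[OF j]] measurable_compose[OF measurable_fst fL[OF j]]
      show "(\<lambda>z. ennreal (exp (- (u * Z j (snd z) * f (fst z j))))) \<in> borel_measurable (?L \<Otimes>\<^sub>M ?N2)"
        by measurable
    qed
    show "Int_stable E" if "E \<in> set ?Fs" for E
      using that by (auto simp: Int_stable_generated)
  qed
  also have "\<dots> = (\<integral>\<^sup>+z. (\<Prod>j\<in>{1..k}. ennreal ((1 + u * f (z j)) powr (- e j))) \<partial>distr M ?L V)"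
  proof (rule nn_integral_cong)
    fix z
    have "(\<integral>\<^sup>+\<omega>. (\<Prod>j\<in>{1..k}. ennreal (exp (- (u * Z j \<omega> * f (z j))))) \<partial>M) =
        prod_list (map (\<lambda>j. \<integral>\<^sup>+\<omega>. ennreal (exp (- (u * Z j \<omega> * f (z j)))) \<partial>M) ?js)"
      unfolding prod_list
      by (rule mutually_indep_prod_list[OF M indep', where g = "\<lambda>j t. ennreal (exp (- (u * t * f (z j))))"])
         (use gamma_variableD(1)[OF Z] js in auto)
    also have "\<dots> = (\<Prod>j\<in>{1..k}. \<integral>\<^sup>+\<omega>. ennreal (exp (- (u * Z j \<omega> * f (z j)))) \<partial>M)"
      by (rule prod_list[symmetric])
    also have "\<dots> = (\<Prod>j\<in>{1..k}. ennreal ((1 + u * f (z j)) powr (- e j)))"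
    proof (rule prod.cong[OF refl])
      fix j assume j: "j \<in> {1..k}"
      have "0 \<le> u * f (z j)" using u test_functionsD(2)[OF f] by simp
      from gamma_expectation_exp[OF Z[OF j] e[OF j] this]
      show "(\<integral>\<^sup>+\<omega>. ennreal (exp (- (u * Z j \<omega> * f (z j)))) \<partial>M) = ennreal ((1 + u * f (z j)) powr (- e j))"
        by (simp add: mult_ac)
    qed
    finally show "(\<integral>\<^sup>+\<omega>. (\<Prod>j\<in>{1..k}. ennreal (exp (- (u * Z j \<omega> * f (z j))))) \<partial>M) =
      (\<Prod>j\<in>{1..k}. ennreal ((1 + u * f (z j)) powr (- e j)))" .
  qed
  also have "\<dots> = (\<integral>\<^sup>+\<omega>. (\<Prod>j\<in>{1..k}. ennreal ((1 + u * f (V \<omega> j)) powr (- e j))) \<partial>M)"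
  proof (rule nn_integral_distr[OF V], unfold measurable_distr_eq1, rule borel_measurable_prod_ennreal)
    fix j assume j: "j \<in> {1..k}"
    note [measurable] = fL[OF j]
    show "(\<lambda>z. ennreal ((1 + u * f (z j)) powr (- e j))) \<in> borel_measurable ?L" by measurable
  qed
  finally show ?thesis .
qed

context gamma_law
begin

text \<open>Given the partition, the mass of a block contributes a power of
  \<open>1 / (1 + u * f)\<close> at the common value, with the block size as exponent. That is the
  product over the members of the block, so the right-hand side contains \<open>p\<close> only
  through the conditioning and can be averaged.\<close>

lemma conditional_Laplace_given_ties:
  fixes Y :: "'w \<Rightarrow> nat \<Rightarrow> 'a"
  assumes M: "prob_space M" and Y: "Y \<in> measurable M (seq_space n)"
    and model: "conditional_model M n Y U \<mu> Z a b (scale_measure (ennreal \<theta>) H)"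
    and p: "partition_on {1..n} p" and pos: "0 < measure M (ties_event M n Y p)" and f: "f \<in> test_functions"
  shows "(\<integral>\<^sup>+\<omega>. elap f (mixture_measure n Y U \<mu> Z p \<omega>) \<partial>given_ties M n Y p) =
    (\<integral>\<^sup>+u. ennreal (beta_density a b u) * (ennreal (exp (- (\<theta> * log_mean (\<lambda>x. u * f x)))) *
      (\<integral>\<^sup>+\<omega>. ennreal (\<Prod>i\<in>{1..n}. 1 / (1 + u * f (Y \<omega> i))) \<partial>given_ties M n Y p)) \<partial>lborel)"
proof -
  interpret M: prob_space M by fact
  note fm [measurable] = test_functionsD(1)[OF f]
  have f0: "0 \<le> f x" for x by (rule test_functionsD(2)[OF f])
  define k where "k = card p"
  let ?Q = "given_ties M n Y p" and ?L = "Pi\<^sub>M {1..k} (\<lambda>_. borel) :: (nat \<Rightarrow> 'a) measure"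
  let ?V = "\<lambda>\<omega>. \<lambda>j\<in>{1..k}. distinct_value p (Y \<omega>) j"
  let ?Fs = "generated ?Q ?L ?V # map (\<lambda>j. generated ?Q borel (Z j)) [1..<Suc k]"
  have ev: "ties_event M n Y p \<in> sets M" by (rule sets_ties_event[OF Y])
  have E: "emeasure M (ties_event M n Y p) \<noteq> 0" "emeasure M (ties_event M n Y p) \<noteq> \<infinity>"
    using pos by (auto simp: M.emeasure_eq_measure)
  interpret Q: prob_space ?Q using E by (rule prob_space_uniform_measure)
  from model p pos have U: "beta_variable ?Q U a b" and \<mu>: "gamma_process ?Q \<mu> (scale_measure (ennreal \<theta>) H)"
    and Z: "\<And>j. j \<in> {1..k} \<Longrightarrow> gamma_variable ?Q (Z j) (real (card (block p j)))"
    and indep: "mutually_indep ?Q (generated ?Q borel U # generated ?Q bf_algebra \<mu> # ?Fs)"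
    unfolding conditional_model_def k_def by auto
  note indepFs = mutually_indep_ConsD[OF Q.prob_space_axioms mutually_indep_ConsD[OF Q.prob_space_axioms indep]]
  have evFs: "\<Union>(set ?Fs) \<subseteq> sets ?Q" by (rule mutually_indep_events[OF Q.prob_space_axioms indepFs])
  have V: "?V \<in> measurable ?Q ?L"
  proof (rule measurable_restrict)
    fix j assume "j \<in> {1..k}"
    then have "(\<lambda>y. y (Min (block p j))) \<in> measurable (seq_space n) (borel :: 'a measure)"
      unfolding k_def by (intro measurable_component_singleton Min_block_mem[OF p])
    from measurable_compose[OF Y this]
    show "(\<lambda>\<omega>. distinct_value p (Y \<omega>) j) \<in> borel_measurable ?Q" by (simp add: distinct_value_def)
  qed
  define w where "w u \<omega> = (\<Prod>j\<in>{1..k}. ennreal (exp (- (u * Z j \<omega> * f (?V \<omega> j)))))" for u \<omega>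
  have \<mu>m: "\<mu> \<in> measurable ?Q bf_algebra" by (rule gamma_processD(1)[OF \<mu>])
  have "(\<integral>\<^sup>+\<omega>. elap f (mixture_measure n Y U \<mu> Z p \<omega>) \<partial>?Q) =
      (\<integral>\<^sup>+\<omega>. elap f (scale_measure (ennreal (U \<omega>)) (\<mu> \<omega>)) * w (U \<omega>) \<omega> \<partial>?Q)"
  proof (rule nn_integral_cong_AE)
    \<comment> \<open>\<open>add_atoms\<close> truncates negative masses through
      \<open>ennreal\<close>, so the product formula is applied where all masses are positive, which
      is almost everywhere.\<close>
    have "AE \<omega> in ?Q. \<forall>j\<in>{1..k}. 0 < Z j \<omega>"
      using gamma_variableD(3)[OF Z] by (intro AE_finite_allI) auto
    with beta_variableD(3)[OF U] AE_space
    show "AE \<omega> in ?Q. elap f (mixture_measure n Y U \<mu> Z p \<omega>) = elap f (scale_measure (ennreal (U \<omega>)) (\<mu> \<omega>)) * w (U \<omega>) \<omega>"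
    proof eventually_elim
      case (elim \<omega>)
      have "\<mu> \<omega> \<in> boundedly_finite" using measurable_space[OF \<mu>m elim(2)] by simp
      then have bf: "scale_measure (ennreal (U \<omega>)) (\<mu> \<omega>) \<in> boundedly_finite"
        by (rule scale_measure_boundedly_finite)
      have "elap f (mixture_measure n Y U \<mu> Z p \<omega>) = elap f (scale_measure (ennreal (U \<omega>)) (\<mu> \<omega>)) *
          (\<Prod>j\<in>{1..k}. ennreal (exp (- (U \<omega> * Z j \<omega> * f (distinct_value p (Y \<omega>) j)))))"
        unfolding mixture_measure_def k_def[symmetric]
      proof (rule elap_add_atoms[OF bf f])
        show "0 \<le> U \<omega> * Z j \<omega>" if "j \<in> {1..k}" for j
          using elim(1) bspec[OF elim(3) that] by simp
      qed simp
      also have "(\<Prod>j\<in>{1..k}. ennreal (exp (- (U \<omega> * Z j \<omega> * f (distinct_value p (Y \<omega>) j))))) = w (U \<omega>) \<omega>"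
        unfolding w_def by (rule prod.cong[OF refl]) simp
      finally show ?case .
    qed
  qed
  also have "\<dots> = (\<integral>\<^sup>+u. ennreal (beta_density a b u) *
      (ennreal (exp (- (\<theta> * log_mean (\<lambda>x. u * f x)))) * (\<integral>\<^sup>+\<omega>. w u \<omega> \<partial>?Q)) \<partial>lborel)"
  proof (rule nn_integral_beta_scaled_process[OF Q.prob_space_axioms U \<mu> indep _ f])
    show "Int_stable E" if "E \<in> set ?Fs" for E
      using that by (auto simp: Int_stable_generated)
    have V': "?V \<in> measurable (sigma (space ?Q) (\<Union>(set ?Fs))) ?L"
      by (rule measurable_sigma_generated[OF V _ evFs]) simp
    show "case_prod w \<in> borel_measurable (borel \<Otimes>\<^sub>M sigma (space ?Q) (\<Union>(set ?Fs)))"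
      unfolding w_def case_prod_beta
    proof (rule borel_measurable_prod_ennreal)
      fix j assume j: "j \<in> {1..k}"
      have "Z j \<in> borel_measurable (sigma (space ?Q) (\<Union>(set ?Fs)))"
      proof (rule measurable_sigma_generated[OF gamma_variableD(1)[OF Z[OF j]] _ evFs])
        have "j \<in> set [1..<Suc k]" using j by auto
        then show "generated ?Q borel (Z j) \<in> set ?Fs" unfolding list.set set_map by (intro insertI2 imageI)
      qed
      note Zj [measurable] = measurable_compose[OF measurable_snd this]
      have "(\<lambda>z. z j) \<in> measurable ?L borel" using j by (rule measurable_component_singleton)
      from measurable_compose[OF measurable_compose[OF V' this] fm]
      have "(\<lambda>\<omega>. f (?V \<omega> j)) \<in> borel_measurable (sigma (space ?Q) (\<Union>(set ?Fs)))" .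
      note fj [measurable] = measurable_compose[OF measurable_snd this]
      show "(\<lambda>z. ennreal (exp (- (fst z * Z j (snd z) * f (?V (snd z) j))))) \<in>
          borel_measurable (borel \<Otimes>\<^sub>M sigma (space ?Q) (\<Union>(set ?Fs)))"
        by (intro measurable_compose[OF _ measurable_ennreal] measurable_compose[OF _ borel_measurable_exp]
            borel_measurable_uminus borel_measurable_times Zj fj measurable_fst)
    qed
  qed
  also have "\<dots> = (\<integral>\<^sup>+u. ennreal (beta_density a b u) * (ennreal (exp (- (\<theta> * log_mean (\<lambda>x. u * f x)))) *
      (\<integral>\<^sup>+\<omega>. ennreal (\<Prod>i\<in>{1..n}. 1 / (1 + u * f (Y \<omega> i))) \<partial>?Q)) \<partial>lborel)"
  proof (rule nn_integral_cong)
    fix u :: real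
    show "ennreal (beta_density a b u) * (ennreal (exp (- (\<theta> * log_mean (\<lambda>x. u * f x)))) * (\<integral>\<^sup>+\<omega>. w u \<omega> \<partial>?Q)) =
      ennreal (beta_density a b u) * (ennreal (exp (- (\<theta> * log_mean (\<lambda>x. u * f x)))) *
        (\<integral>\<^sup>+\<omega>. ennreal (\<Prod>i\<in>{1..n}. 1 / (1 + u * f (Y \<omega> i))) \<partial>?Q))"
    proof (cases "0 < u")
      case True
      have card_pos: "0 < card (block p j)" if "j \<in> {1..k}" for j
        using partition_block(2,3)[OF p block_mem[OF p]] that unfolding k_def by (simp add: card_gt_0_iff)
      have "(\<integral>\<^sup>+\<omega>. w u \<omega> \<partial>?Q) = (\<integral>\<^sup>+\<omega>. (\<Prod>j\<in>{1..k}. ennreal ((1 + u * f (?V \<omega> j)) powr (- real (card (block p j))))) \<partial>?Q)"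
        unfolding w_def
        by (rule block_gamma_Laplace[OF Q.prob_space_axioms Z _ V indepFs f]) (use True card_pos in auto)
      also have "\<dots> = (\<integral>\<^sup>+\<omega>. ennreal (\<Prod>i\<in>{1..n}. 1 / (1 + u * f (Y \<omega> i))) \<partial>?Q)"
      proof (rule nn_integral_cong_AE)
        have "AE \<omega> in ?Q. \<omega> \<in> ties_event M n Y p"
          by (rule AE_uniform_measureI[OF ev]) simp
        then show "AE \<omega> in ?Q. (\<Prod>j\<in>{1..k}. ennreal ((1 + u * f (?V \<omega> j)) powr (- real (card (block p j))))) =
          ennreal (\<Prod>i\<in>{1..n}. 1 / (1 + u * f (Y \<omega> i)))"
        proof eventually_elim
          case (elim \<omega>)
          then have ties: "ties n (Y \<omega>) = p" by (simp add: ties_event_def)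
          have "(\<Prod>i\<in>{1..n}. 1 / (1 + u * f (Y \<omega> i))) =
              (\<Prod>j\<in>{1..k}. (1 / (1 + u * f (distinct_value p (Y \<omega>) j))) ^ card (block p j))"
            unfolding k_def by (rule prod_ties[OF p ties, of "\<lambda>x. 1 / (1 + u * f x)"])
          also have "\<dots> = (\<Prod>j\<in>{1..k}. (1 + u * f (?V \<omega> j)) powr (- real (card (block p j))))"
          proof (rule prod.cong[OF refl])
            fix j assume j: "j \<in> {1..k}"
            have "0 < 1 + u * f (distinct_value p (Y \<omega>) j)"
              using True f0 by (simp add: add_pos_nonneg)
            then show "(1 / (1 + u * f (distinct_value p (Y \<omega>) j))) ^ card (block p j) =
              (1 + u * f (?V \<omega> j)) powr (- real (card (block p j)))"
              using j by (simp add: powr_minus_divide powr_realpow power_one_over)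
          qed
          finally show ?case by (simp add: prod_ennreal)
        qed
      qed
      finally show ?thesis by simp
    qed (simp add: beta_density_def)
  qed
  finally show ?thesis .
qed

lemma measurable_Laplace_scaled:
  assumes f: "f \<in> test_functions"
  shows "(\<lambda>u. log_mean (\<lambda>x. u * f x)) \<in> borel_measurable borel"
proof -
  note [measurable] = test_functionsD(1)[OF f]
  show ?thesis unfolding log_mean_def by measurable
qed

text \<open>The law of total probability over the finitely many partitions. Summing the conditional
  formulas restores the unconditional expectation of the product, which is
  \<open>urn_Laplace\<close>, and the Beta mixture does the rest.\<close>

lemma conditional_Laplace:
  fixes Y :: "'w \<Rightarrow> nat \<Rightarrow> 'a"
  assumes M: "prob_space M" and Y: "Y \<in> measurable M (seq_space n)" "distr M (seq_space n) Y = BM n"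
    and q: "0 < q" "0 < \<theta> + real n - q"
    and model: "conditional_model M n Y U \<mu> Z q (\<theta> + real n - q) (scale_measure (ennreal \<theta>) H)"
    and f: "f \<in> test_functions"
  shows "(\<integral>\<^sup>+\<omega>. elap f (mixture_measure n Y U \<mu> Z (ties n (Y \<omega>)) \<omega>) \<partial>M) = \<Phi> q f"
proof -
  interpret M: prob_space M by fact
  note fm [measurable] = test_functionsD(1)[OF f]
  have f0: "0 \<le> f x" for x by (rule test_functionsD(2)[OF f])
  let ?b = "\<theta> + real n - q" and ?parts = "{p. partition_on {1..n} p}"
  let ?l = "\<lambda>u. ennreal (exp (- (\<theta> * log_mean (\<lambda>x. u * f x))))"
  have fin: "finite ?parts" by (rule finitely_many_partition_on) simp
  define E where "E p = ties_event M n Y p" for p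
  have ev [measurable]: "E p \<in> sets M" for p unfolding E_def by (rule sets_ties_event[OF Y(1)])
  define K where "K u \<omega> = ennreal (\<Prod>i\<in>{1..n}. 1 / (1 + u * f (Y \<omega> i)))" for u \<omega>
  have Yi: "(\<lambda>\<omega>. f (Y \<omega> i)) \<in> borel_measurable M" if "i \<in> {1..n}" for i
  proof -
    have "(\<lambda>y. y i) \<in> measurable (seq_space n) (borel :: 'a measure)"
      using that by (rule measurable_component_singleton)
    from measurable_compose[OF measurable_compose[OF Y(1) this] fm] show ?thesis .
  qed
  have K2 [measurable]: "case_prod K \<in> borel_measurable (borel \<Otimes>\<^sub>M M)"
    unfolding K_def case_prod_beta
  proof (intro measurable_compose[OF _ measurable_ennreal] borel_measurable_prod)
    fix i assume i: "i \<in> {1..n}"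
    note [measurable] = measurable_compose[OF measurable_snd Yi[OF i]]
    show "(\<lambda>z. 1 / (1 + fst z * f (Y (snd z) i))) \<in> borel_measurable (borel \<Otimes>\<^sub>M M)" by measurable
  qed
  have KM [measurable]: "K u \<in> borel_measurable M" for u
    using measurable_Pair2[OF K2, of u] by simp
  have l [measurable]: "?l \<in> borel_measurable borel"
    using measurable_Laplace_scaled[OF f] by measurable
  define I where "I p u = (\<integral>\<^sup>+\<omega>. K u \<omega> * indicator (E p) \<omega> \<partial>M)" for p u
  have I_meas [measurable]: "I p \<in> borel_measurable borel" for p
    unfolding I_def by measurable
  have mm [measurable]: "mixture_measure n Y U \<mu> Z p \<in> measurable M bf_algebra" if "p \<in> ?parts" for p
    by (rule measurable_mixture_measure[OF Y(1)]) (use model that in \<open>auto simp: conditional_model_def\<close>)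
  have part: "(\<integral>\<^sup>+\<omega>. elap f (mixture_measure n Y U \<mu> Z p \<omega>) * indicator (E p) \<omega> \<partial>M) =
      (\<integral>\<^sup>+u. ennreal (beta_density q ?b u) * (?l u * I p u) \<partial>lborel)" if p: "p \<in> ?parts" for p
  \<comment> \<open>\<open>conditional_model\<close> speaks of partitions of positive probability.
    The remaining ones contribute 0 to both sides.\<close>
  proof (cases "measure M (E p) = 0")
    case True
    then have null: "E p \<in> null_sets M" by (simp add: null_sets_def M.emeasure_eq_measure)
    have "(\<integral>\<^sup>+\<omega>. g \<omega> * indicator (E p) \<omega> \<partial>M) = 0" for g :: "'w \<Rightarrow> ennreal"
    proof -
      have "(\<integral>\<^sup>+\<omega>. g \<omega> * indicator (E p) \<omega> \<partial>M) = (\<integral>\<^sup>+\<omega>. 0 \<partial>M)"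
        using AE_not_in[OF null] by (intro nn_integral_cong_AE) (auto elim!: eventually_mono)
      then show ?thesis by simp
    qed
    then show ?thesis by (simp add: I_def)
  next
    case False
    then have pos: "0 < measure M (ties_event M n Y p)" unfolding E_def by (simp add: less_le)
    let ?Q = "given_ties M n Y p" and ?c = "emeasure M (E p)"
    have c: "?c \<noteq> 0" "?c \<noteq> top" using pos by (simp_all add: E_def M.emeasure_eq_measure)
    have cond: "(\<integral>\<^sup>+\<omega>. g \<omega> * indicator (E p) \<omega> \<partial>M) = ?c * (\<integral>\<^sup>+\<omega>. g \<omega> \<partial>?Q)" if g: "g \<in> borel_measurable M" for g
      unfolding E_def[symmetric] nn_integral_uniform_measure[OF g ev]
      by (metis c ennreal_times_divide mult.commute mult_divide_eq_ennreal)
    have "p \<in> ?parts \<Longrightarrow> partition_on {1..n} p" by simp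
    note cl = conditional_Laplace_given_ties[OF M Y(1) model this[OF p] pos f]
    have "(\<integral>\<^sup>+\<omega>. elap f (mixture_measure n Y U \<mu> Z p \<omega>) * indicator (E p) \<omega> \<partial>M) =
        ?c * (\<integral>\<^sup>+u. ennreal (beta_density q ?b u) * (?l u * (\<integral>\<^sup>+\<omega>. K u \<omega> \<partial>?Q)) \<partial>lborel)"
      unfolding K_def cl[symmetric]
      by (rule cond) (rule measurable_compose[OF mm[OF p] measurable_elap[OF fm]])
    also have "\<dots> = (\<integral>\<^sup>+u. ?c * (ennreal (beta_density q ?b u) * (?l u * (\<integral>\<^sup>+\<omega>. K u \<omega> \<partial>?Q))) \<partial>lborel)"
    proof (rule nn_integral_cmult[symmetric])
      have "(\<integral>\<^sup>+\<omega>. K u \<omega> \<partial>?Q) = I p u / ?c" for u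
        unfolding I_def E_def[symmetric] by (rule nn_integral_uniform_measure[OF KM ev])
      then show "(\<lambda>u. ennreal (beta_density q ?b u) * (?l u * (\<integral>\<^sup>+\<omega>. K u \<omega> \<partial>?Q))) \<in> borel_measurable lborel"
        by simp
    qed
    also have "\<dots> = (\<integral>\<^sup>+u. ennreal (beta_density q ?b u) * (?l u * I p u) \<partial>lborel)"
      unfolding I_def cond[OF KM] by (simp add: mult_ac)
    finally show ?thesis .
  qed
  have "(\<integral>\<^sup>+\<omega>. elap f (mixture_measure n Y U \<mu> Z (ties n (Y \<omega>)) \<omega>) \<partial>M) =
      (\<integral>\<^sup>+\<omega>. (\<Sum>p\<in>?parts. elap f (mixture_measure n Y U \<mu> Z p \<omega>) * indicator (E p) \<omega>) \<partial>M)"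
  proof (rule nn_integral_cong)
    fix \<omega> assume "\<omega> \<in> space M"
    then have "(\<Sum>p\<in>?parts. elap f (mixture_measure n Y U \<mu> Z p \<omega>) * indicator (E p) \<omega>) =
        (\<Sum>p\<in>?parts. if p = ties n (Y \<omega>) then elap f (mixture_measure n Y U \<mu> Z p \<omega>) else 0)"
      by (intro sum.cong) (auto simp: E_def ties_event_def)
    also have "\<dots> = elap f (mixture_measure n Y U \<mu> Z (ties n (Y \<omega>)) \<omega>)"
      using fin partition_on_ties[of n "Y \<omega>"] by (subst sum.delta) auto
    finally show "elap f (mixture_measure n Y U \<mu> Z (ties n (Y \<omega>)) \<omega>) =
      (\<Sum>p\<in>?parts. elap f (mixture_measure n Y U \<mu> Z p \<omega>) * indicator (E p) \<omega>)" by simp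
  qed
  also have "\<dots> = (\<Sum>p\<in>?parts. \<integral>\<^sup>+\<omega>. elap f (mixture_measure n Y U \<mu> Z p \<omega>) * indicator (E p) \<omega> \<partial>M)"
  proof (rule nn_integral_sum)
    fix p assume "p \<in> ?parts"
    note [measurable] = measurable_compose[OF mm[OF this] measurable_elap[OF fm]]
    show "(\<lambda>\<omega>. elap f (mixture_measure n Y U \<mu> Z p \<omega>) * indicator (E p) \<omega>) \<in> borel_measurable M" by measurable
  qed
  also have "\<dots> = (\<Sum>p\<in>?parts. \<integral>\<^sup>+u. ennreal (beta_density q ?b u) * (?l u * I p u) \<partial>lborel)"
    by (rule sum.cong[OF refl part])
  also have "\<dots> = (\<integral>\<^sup>+u. (\<Sum>p\<in>?parts. ennreal (beta_density q ?b u) * (?l u * I p u)) \<partial>lborel)"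
    by (rule nn_integral_sum[symmetric]) measurable
  also have "\<dots> = (\<integral>\<^sup>+u. ennreal (beta_density q ?b u) * (?l u * urn_Laplace n (\<lambda>x. u * f x)) \<partial>lborel)"
  proof (rule nn_integral_cong)
    fix u :: real
    have "(\<Sum>p\<in>?parts. I p u) = (\<integral>\<^sup>+\<omega>. (\<Sum>p\<in>?parts. K u \<omega> * indicator (E p) \<omega>) \<partial>M)"
      unfolding I_def by (rule nn_integral_sum[symmetric]) measurable
    also have "\<dots> = (\<integral>\<^sup>+\<omega>. K u \<omega> \<partial>M)"
    proof (rule nn_integral_cong)
      fix \<omega> assume "\<omega> \<in> space M"
      then have "(\<Sum>p\<in>?parts. K u \<omega> * indicator (E p) \<omega>) = (\<Sum>p\<in>?parts. if p = ties n (Y \<omega>) then K u \<omega> else 0)"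
        by (intro sum.cong) (auto simp: E_def ties_event_def)
      also have "\<dots> = K u \<omega>"
        using fin partition_on_ties[of n "Y \<omega>"] by (subst sum.delta) auto
      finally show "(\<Sum>p\<in>?parts. K u \<omega> * indicator (E p) \<omega>) = K u \<omega>" .
    qed
    also have "\<dots> = urn_Laplace n (\<lambda>x. u * f x)"
      unfolding urn_Laplace_def Y(2)[symmetric] K_def
    proof (rule nn_integral_distr[OF Y(1), symmetric], unfold measurable_distr_eq1,
        intro measurable_compose[OF _ measurable_ennreal] borel_measurable_prod)
      fix i assume "i \<in> {1..n}"
      then have "(\<lambda>y. y i) \<in> measurable (seq_space n) (borel :: 'a measure)"
        by (rule measurable_component_singleton)
      note [measurable] = measurable_compose[OF this fm]
      show "(\<lambda>y. 1 / (1 + u * f (y i))) \<in> borel_measurable (seq_space n)" by measurable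
    qed
    finally show "(\<Sum>p\<in>?parts. ennreal (beta_density q ?b u) * (?l u * I p u)) =
      ennreal (beta_density q ?b u) * (?l u * urn_Laplace n (\<lambda>x. u * f x))"
      by (simp add: sum_distrib_left[symmetric])
  qed
  also have "\<dots> = \<Phi> q f" by (rule beta_mixture[OF f q])
  finally show ?thesis .
qed

end

section \<open>The identities in distribution\<close>

theorem theorem2p2:
  fixes H :: "'a::polish_space measure" and \<theta> q :: real
  assumes H: "prob_space H" "sets H = sets borel"
    and \<theta>: "\<theta> > 0" and q: "q > 0"
  shows "
    \<comment> \<open>(i)\<close>
    (\<forall>n::nat. \<theta> + real n - q > 0 \<longrightarrow>
      (\<forall>(M :: 'w measure) Y.
        prob_space M \<and> Y \<in> measurable M (Pi\<^sub>M {1..n} (\<lambda>_. borel)) \<and>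
        distr M (Pi\<^sub>M {1..n} (\<lambda>_. borel)) Y = blackwell_macqueen \<theta> H n \<longrightarrow>
        (\<forall>U \<mu> G (N :: 'v measure) \<nu>.
          conditional_model M n Y U \<mu> G q (\<theta> + real n - q) (scale_measure (ennreal \<theta>) H) \<and>
          prob_space N \<and> beta_gamma_process N \<nu> \<theta> H (\<theta> - q) \<longrightarrow>
          distr N bf_algebra \<nu> =
          distr M bf_algebra (\<lambda>\<omega>. let p = ties n (Y \<omega>) in
            add_atoms (scale_measure (ennreal (U \<omega>)) (\<mu> \<omega>)) {1..card p}
              (\<lambda>j. U \<omega> * G j \<omega>) (distinct_value p (Y \<omega>)))) \<and>
        ((\<forall>x. emeasure H {x} = 0) \<longrightarrow>
          (\<forall>p. partition_on {1..n} p \<longrightarrow>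
            measure M (ties_event M n Y p) = partition_prob \<theta> n p \<and>
            prob_space.indep_vars (given_ties M n Y p) (\<lambda>_. borel)
              (\<lambda>j \<omega>. distinct_value p (Y \<omega>) j) {1..card p} \<and>
            (\<forall>j\<in>{1..card p}.
              distr (given_ties M n Y p) borel (\<lambda>\<omega>. distinct_value p (Y \<omega>) j) = H))))) \<and>
    \<comment> \<open>(ii)\<close>
    (\<forall>(M :: 'w measure) U \<mu> T Y (N :: 'v measure) \<nu>.
      prob_space M \<and> beta_variable M U 1 \<theta> \<and>
      gamma_process M \<mu> (scale_measure (ennreal \<theta>) H) \<and> gamma_variable M T 1 \<and>
      Y \<in> measurable M borel \<and> distr M borel Y = H \<and>
      mutually_indep M [generated M borel U, generated M bf_algebra \<mu>,
        generated M borel T, generated M borel Y] \<and>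
      prob_space N \<and> beta_gamma_process N \<nu> \<theta> H (\<theta> - 1) \<longrightarrow>
      distr N bf_algebra \<nu> =
      distr M bf_algebra (\<lambda>\<omega>. add_atoms (scale_measure (ennreal (U \<omega>)) (\<mu> \<omega>)) {1}
        (\<lambda>_. U \<omega> * T \<omega>) (\<lambda>_. Y \<omega>))) \<and>
    (\<forall>(M :: 'w measure) U \<mu> T Y (N :: 'v measure) \<nu>.
      prob_space M \<and> beta_variable M U \<theta> 1 \<and>
      gamma_process M \<mu> (scale_measure (ennreal \<theta>) H) \<and> gamma_variable M T 1 \<and>
      Y \<in> measurable M borel \<and> distr M borel Y = H \<and>
      mutually_indep M [generated M borel U, generated M bf_algebra \<mu>,
        generated M borel T, generated M borel Y] \<and>
      prob_space N \<and> gamma_process N \<nu> (scale_measure (ennreal \<theta>) H) \<longrightarrow>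
      distr N bf_algebra \<nu> =
      distr M bf_algebra (\<lambda>\<omega>. add_atoms (scale_measure (ennreal (U \<omega>)) (\<mu> \<omega>)) {1}
        (\<lambda>_. U \<omega> * T \<omega>) (\<lambda>_. Y \<omega>))) \<and>
    \<comment> \<open>(iii)\<close>
    (\<forall>(M :: 'w measure) T P (N :: 'v measure) \<nu>.
      prob_space M \<and> gamma_variable M T q \<and>
      dirichlet_process M P (scale_measure (ennreal \<theta>) H) \<and>
      mutually_indep M [generated M borel T, generated M bf_algebra P] \<and>
      prob_space N \<and> beta_gamma_process N \<nu> \<theta> H (\<theta> - q) \<longrightarrow>
      distr N bf_algebra \<nu> =
      distr M bf_algebra (\<lambda>\<omega>. scale_measure (ennreal (T \<omega>)) (P \<omega>))) \<and>
    (\<forall>(M :: 'w measure) T \<mu> (N :: 'v measure) S \<nu>.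
      prob_space M \<and> gamma_variable M T q \<and>
      gamma_process M \<mu> (scale_measure (ennreal \<theta>) H) \<and>
      mutually_indep M [generated M borel T, generated M bf_algebra \<mu>] \<and>
      prob_space N \<and> gamma_variable N S \<theta> \<and> beta_gamma_process N \<nu> \<theta> H (\<theta> - q) \<and>
      mutually_indep N [generated N borel S, generated N bf_algebra \<nu>] \<longrightarrow>
      distr N bf_algebra (\<lambda>\<omega>. scale_measure (ennreal (S \<omega>)) (\<nu> \<omega>)) =
      distr M bf_algebra (\<lambda>\<omega>. scale_measure (ennreal (T \<omega>)) (\<mu> \<omega>)))"
proof -
  let ?\<alpha> = "scale_measure (ennreal \<theta>) H"
  \<comment> \<open>Each of the five equalities of laws is reduced by this to an equality of Laplace
    functionals on test functions.\<close>
  have eqI: "distr N bf_algebra \<nu> = distr M bf_algebra R"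
    if M: "prob_space M" "R \<in> measurable M bf_algebra" and N: "prob_space N" "\<nu> \<in> measurable N bf_algebra"
      and eq: "\<And>f. f \<in> test_functions \<Longrightarrow> (\<integral>\<^sup>+m. elap f m \<partial>distr N bf_algebra \<nu>) = (\<integral>\<^sup>+\<omega>. elap f (R \<omega>) \<partial>M)"
    for M :: "'w measure" and N :: "'v measure" and R :: "'w \<Rightarrow> 'a measure" and \<nu> :: "'v \<Rightarrow> 'a measure"
  proof (rule bf_measure_eqI_elap)
    show "finite_measure (distr N bf_algebra \<nu>)"
      using prob_space.finite_measure[OF prob_space.prob_space_distr[OF N]] .
    show "finite_measure (distr M bf_algebra R)"
      using prob_space.finite_measure[OF prob_space.prob_space_distr[OF M]] .
    fix f :: "'a \<Rightarrow> real" assume f: "f \<in> test_functions"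
    note [measurable] = test_functionsD(1)[OF f]
    have "(\<integral>\<^sup>+m. elap f m \<partial>distr M bf_algebra R) = (\<integral>\<^sup>+\<omega>. elap f (R \<omega>) \<partial>M)"
      by (rule nn_integral_distr[OF M(2)]) measurable
    with eq[OF f] show "(\<integral>\<^sup>+m. elap f m \<partial>distr N bf_algebra \<nu>) = (\<integral>\<^sup>+m. elap f m \<partial>distr M bf_algebra R)"
      by simp
  qed simp_all
  \<comment> \<open>A Beta-Gamma law comes with a Gamma law as its base measure, so the hypothesis
    on \<open>\<nu>\<close> provides the \<open>G\<close> of the locale.\<close>
  have G_ex: "\<exists>G. gamma_law H \<theta> G" if "beta_gamma_law \<theta> H d B" for d B
    using that assms by (auto simp: beta_gamma_law_def gamma_law_def)
  have atom: "(\<lambda>\<omega>. add_atoms (scale_measure (ennreal (U \<omega>)) (\<mu> \<omega>)) {1} (\<lambda>_. U \<omega> * T \<omega>) (\<lambda>_. Y \<omega>)) \<in> measurable M bf_algebra"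
    if [measurable]: "U \<in> borel_measurable M" "\<mu> \<in> measurable M bf_algebra" "T \<in> borel_measurable M" "Y \<in> borel_measurable M"
    for M :: "'w measure" and U \<mu> T and Y :: "'w \<Rightarrow> 'a"
    using measurable_add_atoms[where I = "{1::nat}" and c = "\<lambda>_ \<omega>. U \<omega> * T \<omega>" and y = "\<lambda>_ \<omega>. Y \<omega>" and M = M
        and m = "\<lambda>\<omega>. scale_measure (ennreal (U \<omega>)) (\<mu> \<omega>)"] by measurable
  have i: "distr N bf_algebra \<nu> =
      distr M bf_algebra (\<lambda>\<omega>. let p = ties n (Y \<omega>) in
        add_atoms (scale_measure (ennreal (U \<omega>)) (\<mu> \<omega>)) {1..card p}
          (\<lambda>j. U \<omega> * G j \<omega>) (distinct_value p (Y \<omega>)))"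
    if b: "0 < \<theta> + real n - q" and M: "prob_space M" and Y: "Y \<in> measurable M (seq_space n)"
      "distr M (seq_space n) Y = blackwell_macqueen \<theta> H n"
      and model: "conditional_model M n Y U \<mu> G q (\<theta> + real n - q) ?\<alpha>"
      and N: "prob_space N" "beta_gamma_process N \<nu> \<theta> H (\<theta> - q)"
    for n and M :: "'w measure" and Y U \<mu> G and N :: "'v measure" and \<nu>
  proof -
    have \<nu>: "\<nu> \<in> measurable N bf_algebra" "beta_gamma_law \<theta> H (\<theta> - q) (distr N bf_algebra \<nu>)"
      using N(2) by (auto simp: beta_gamma_process_def)
    obtain L where "gamma_law H \<theta> L" using G_ex[OF \<nu>(2)] by auto
    then interpret gamma_law H \<theta> L .
    have "distr N bf_algebra \<nu> = distr M bf_algebra (\<lambda>\<omega>. mixture_measure n Y U \<mu> G (ties n (Y \<omega>)) \<omega>)"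
    proof (rule eqI[OF M _ N(1) \<nu>(1)])
      show "(\<lambda>\<omega>. mixture_measure n Y U \<mu> G (ties n (Y \<omega>)) \<omega>) \<in> measurable M bf_algebra"
        by (rule measurable_mixture_ties[OF Y(1)]) (use model in \<open>auto simp: conditional_model_def\<close>)
      show "(\<integral>\<^sup>+m. elap f m \<partial>distr N bf_algebra \<nu>) = (\<integral>\<^sup>+\<omega>. elap f (mixture_measure n Y U \<mu> G (ties n (Y \<omega>)) \<omega>) \<partial>M)"
        if f: "f \<in> test_functions" for f
        unfolding beta_gamma_Laplace[OF \<nu>(2) q f] conditional_Laplace[OF M Y q b model f] ..
    qed
    then show ?thesis by (simp only: mixture_measure_def Let_def)
  qed
  \<comment> \<open>Both identities of (ii) at once, with Beta parameters \<open>r\<close> and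
    \<open>\<theta> + 1 - r\<close>. Here \<open>r = 1\<close> is the Beta-Gamma case, while
    \<open>r = \<theta>\<close> yields the Gamma process, whose Laplace functional is the transform
    of order \<open>\<theta>\<close>.\<close>
  have ii: "distr N bf_algebra \<nu> =
      distr M bf_algebra (\<lambda>\<omega>. add_atoms (scale_measure (ennreal (U \<omega>)) (\<mu> \<omega>)) {1} (\<lambda>_. U \<omega> * T \<omega>) (\<lambda>_. Y \<omega>))"
    if r: "0 < r" "0 < \<theta> + 1 - r" and L: "gamma_law H \<theta> L"
      and \<nu>: "\<nu> \<in> measurable N bf_algebra" "\<And>f. f \<in> test_functions \<Longrightarrow> (\<integral>\<^sup>+m. elap f m \<partial>distr N bf_algebra \<nu>) = gamma_law.\<Phi> L r f"
      and M: "prob_space M" "beta_variable M U r (\<theta> + 1 - r)" "gamma_process M \<mu> ?\<alpha>" "gamma_variable M T 1"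
        "Y \<in> measurable M borel" "distr M borel Y = H"
        "mutually_indep M [generated M borel U, generated M bf_algebra \<mu>, generated M borel T, generated M borel Y]"
      and N: "prob_space N"
    for r L and M :: "'w measure" and U \<mu> T Y and N :: "'v measure" and \<nu>
  proof -
    interpret gamma_law H \<theta> L by (rule L)
    show ?thesis
    proof (rule eqI[OF M(1) _ N \<nu>(1)])
      show "(\<lambda>\<omega>. add_atoms (scale_measure (ennreal (U \<omega>)) (\<mu> \<omega>)) {1} (\<lambda>_. U \<omega> * T \<omega>) (\<lambda>_. Y \<omega>)) \<in> measurable M bf_algebra"
        by (rule atom[OF beta_variableD(1)[OF M(2)] gamma_processD(1)[OF M(3)] gamma_variableD(1)[OF M(4)] M(5)])
      show "(\<integral>\<^sup>+m. elap f m \<partial>distr N bf_algebra \<nu>) = (\<integral>\<^sup>+\<omega>. elap f (add_atoms (scale_measure (ennreal (U \<omega>)) (\<mu> \<omega>)) {1} (\<lambda>_. U \<omega> * T \<omega>) (\<lambda>_. Y \<omega>)) \<partial>M)"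
        if f: "f \<in> test_functions" for f
        unfolding \<nu>(2)[OF f] single_atom_Laplace[OF M(1,2) r M(3-7) f] ..
    qed
  qed
  have ii1: "distr N bf_algebra \<nu> =
      distr M bf_algebra (\<lambda>\<omega>. add_atoms (scale_measure (ennreal (U \<omega>)) (\<mu> \<omega>)) {1} (\<lambda>_. U \<omega> * T \<omega>) (\<lambda>_. Y \<omega>))"
    if M: "prob_space M" "beta_variable M U 1 \<theta>" "gamma_process M \<mu> ?\<alpha>" "gamma_variable M T 1"
        "Y \<in> measurable M borel" "distr M borel Y = H"
        "mutually_indep M [generated M borel U, generated M bf_algebra \<mu>, generated M borel T, generated M borel Y]"
      and N: "prob_space N" "beta_gamma_process N \<nu> \<theta> H (\<theta> - 1)"
    for M :: "'w measure" and U \<mu> T Y and N :: "'v measure" and \<nu>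
  proof -
    have \<nu>: "\<nu> \<in> measurable N bf_algebra" "beta_gamma_law \<theta> H (\<theta> - 1) (distr N bf_algebra \<nu>)"
      using N(2) by (auto simp: beta_gamma_process_def)
    obtain L where L: "gamma_law H \<theta> L" using G_ex[OF \<nu>(2)] by auto
    show ?thesis
      by (rule ii[OF _ _ L \<nu>(1) gamma_law.beta_gamma_Laplace[OF L \<nu>(2)] M(1) _ M(3-7) N(1)])
         (use \<theta> M(2) in simp_all)
  qed
  have ii2: "distr N bf_algebra \<nu> =
      distr M bf_algebra (\<lambda>\<omega>. add_atoms (scale_measure (ennreal (U \<omega>)) (\<mu> \<omega>)) {1} (\<lambda>_. U \<omega> * T \<omega>) (\<lambda>_. Y \<omega>))"
    if M: "prob_space M" "beta_variable M U \<theta> 1" "gamma_process M \<mu> ?\<alpha>" "gamma_variable M T 1"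
        "Y \<in> measurable M borel" "distr M borel Y = H"
        "mutually_indep M [generated M borel U, generated M bf_algebra \<mu>, generated M borel T, generated M borel Y]"
      and N: "prob_space N" "gamma_process N \<nu> ?\<alpha>"
    for M :: "'w measure" and U \<mu> T Y and N :: "'v measure" and \<nu>
  proof -
    \<comment> \<open>In this identity \<open>\<nu>\<close> is itself a Gamma process, so its own
      law serves as the \<open>G\<close> of the locale.\<close>
    have L: "gamma_law H \<theta> (distr N bf_algebra \<nu>)"
      using N(2) assms by (auto simp: gamma_process_def gamma_law_def)
    have \<nu>: "\<nu> \<in> measurable N bf_algebra" using N(2) by (simp add: gamma_process_def)
    show ?thesis
    proof (rule ii[OF \<theta> _ L \<nu> _ M(1) _ M(3-7) N(1)])
      show "(\<integral>\<^sup>+m. elap f m \<partial>distr N bf_algebra \<nu>) = gamma_law.\<Phi> (distr N bf_algebra \<nu>) \<theta> f" if "f \<in> test_functions" for f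
        unfolding gamma_law.Laplace_G[OF L that] gamma_law.\<Phi>_theta[OF L that] ..
    qed (use M(2) in simp_all)
  qed
  have iii1: "distr N bf_algebra \<nu> = distr M bf_algebra (\<lambda>\<omega>. scale_measure (ennreal (T \<omega>)) (P \<omega>))"
    if M: "prob_space M" "gamma_variable M T q" "dirichlet_process M P ?\<alpha>"
        "mutually_indep M [generated M borel T, generated M bf_algebra P]"
      and N: "prob_space N" "beta_gamma_process N \<nu> \<theta> H (\<theta> - q)"
    for M :: "'w measure" and T P and N :: "'v measure" and \<nu>
  proof -
    have \<nu>: "\<nu> \<in> measurable N bf_algebra" "beta_gamma_law \<theta> H (\<theta> - q) (distr N bf_algebra \<nu>)"
      using N(2) by (auto simp: beta_gamma_process_def)
    obtain L where "gamma_law H \<theta> L" using G_ex[OF \<nu>(2)] by auto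
    then interpret gamma_law H \<theta> L .
    show ?thesis
    proof (rule eqI[OF M(1) _ N(1) \<nu>(1)])
      show "(\<lambda>\<omega>. scale_measure (ennreal (T \<omega>)) (P \<omega>)) \<in> measurable M bf_algebra"
        by (rule measurable_scale_measure_bf[OF gamma_variableD(1)[OF M(2)] dirichlet_processD(1)[OF M(3)]])
      show "(\<integral>\<^sup>+m. elap f m \<partial>distr N bf_algebra \<nu>) = (\<integral>\<^sup>+\<omega>. elap f (scale_measure (ennreal (T \<omega>)) (P \<omega>)) \<partial>M)"
        if f: "f \<in> test_functions" for f
        unfolding beta_gamma_Laplace[OF \<nu>(2) q f] scaled_dirichlet_Laplace[OF M(1,2) q M(3,4) f] ..
    qed
  qed
  have iii2: "distr N bf_algebra (\<lambda>\<omega>. scale_measure (ennreal (S \<omega>)) (\<nu> \<omega>)) =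
      distr M bf_algebra (\<lambda>\<omega>. scale_measure (ennreal (T \<omega>)) (\<mu> \<omega>))"
    if M: "prob_space M" "gamma_variable M T q" "gamma_process M \<mu> ?\<alpha>"
        "mutually_indep M [generated M borel T, generated M bf_algebra \<mu>]"
      and N: "prob_space N" "gamma_variable N S \<theta>" "beta_gamma_process N \<nu> \<theta> H (\<theta> - q)"
        "mutually_indep N [generated N borel S, generated N bf_algebra \<nu>]"
    for M :: "'w measure" and T \<mu> and N :: "'v measure" and S \<nu>
  proof -
    have \<nu>: "\<nu> \<in> measurable N bf_algebra" "beta_gamma_law \<theta> H (\<theta> - q) (distr N bf_algebra \<nu>)"
      using N(3) by (auto simp: beta_gamma_process_def)
    obtain L where "gamma_law H \<theta> L" using G_ex[OF \<nu>(2)] by auto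
    then interpret gamma_law H \<theta> L .
    have S\<nu>: "(\<lambda>\<omega>. scale_measure (ennreal (S \<omega>)) (\<nu> \<omega>)) \<in> measurable N bf_algebra"
      by (rule measurable_scale_measure_bf[OF gamma_variableD(1)[OF N(2)] \<nu>(1)])
    show ?thesis
    proof (rule eqI[OF M(1) _ N(1) S\<nu>])
      show "(\<lambda>\<omega>. scale_measure (ennreal (T \<omega>)) (\<mu> \<omega>)) \<in> measurable M bf_algebra"
        by (rule measurable_scale_measure_bf[OF gamma_variableD(1)[OF M(2)] gamma_processD(1)[OF M(3)]])
      fix f :: "'a \<Rightarrow> real" assume f: "f \<in> test_functions"
      note [measurable] = test_functionsD(1)[OF f]
      have "(\<integral>\<^sup>+m. elap f m \<partial>distr N bf_algebra (\<lambda>\<omega>. scale_measure (ennreal (S \<omega>)) (\<nu> \<omega>))) =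
          (\<integral>\<^sup>+\<omega>. elap f (scale_measure (ennreal (S \<omega>)) (\<nu> \<omega>)) \<partial>N)"
        by (rule nn_integral_distr[OF S\<nu>]) measurable
      also have "\<dots> = (\<integral>\<^sup>+s. ennreal (gamma_density \<theta> s) * \<Phi> q (\<lambda>x. s * f x) \<partial>lborel)"
        by (rule gamma_scaled_Laplace[OF N(1,2) \<nu>(1) N(4) f beta_gamma_Laplace[OF \<nu>(2) q]])
      \<comment> \<open>Both expressions are the Laplace functional of a product of independent
        Gamma variables of shapes \<open>\<theta>\<close> and \<open>q\<close> with the Dirichlet
        process.\<close>
      also have "\<dots> = (\<integral>\<^sup>+s. ennreal (gamma_density q s) * \<Phi> \<theta> (\<lambda>x. s * f x) \<partial>lborel)"
        by (rule gamma_mixture_commute[OF f \<theta> q])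
      also have "\<dots> = (\<integral>\<^sup>+\<omega>. elap f (scale_measure (ennreal (T \<omega>)) (\<mu> \<omega>)) \<partial>M)"
      proof (rule gamma_scaled_Laplace[symmetric, OF M(1,2) gamma_processD(1)[OF M(3)] M(4) f])
        show "(\<integral>\<^sup>+m. elap g m \<partial>distr M bf_algebra \<mu>) = \<Phi> \<theta> g" if "g \<in> test_functions" for g
          unfolding gamma_processD(2)[OF M(3)] Laplace_G[OF that] \<Phi>_theta[OF that] ..
      qed
      finally show "(\<integral>\<^sup>+m. elap f m \<partial>distr N bf_algebra (\<lambda>\<omega>. scale_measure (ennreal (S \<omega>)) (\<nu> \<omega>))) =
          (\<integral>\<^sup>+\<omega>. elap f (scale_measure (ennreal (T \<omega>)) (\<mu> \<omega>)) \<partial>M)" .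
    qed
  qed
  show ?thesis
    apply (intro conjI allI impI; (elim conjE)?)
    subgoal by (rule i)
    subgoal by (rule nonatomic_given_ties(1)[OF H \<theta>]) blast+
    subgoal by (rule nonatomic_given_ties(2)[OF H \<theta>]) blast+
    subgoal by (intro ballI, rule nonatomic_given_ties(3)[OF H \<theta>]) blast+
    subgoal by (rule ii1)
    subgoal by (rule ii2)
    subgoal by (rule iii1)
    subgoal by (rule iii2)
    done
qed

end
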